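(* Let $\phi$ be an LTL formula over $P=I\uplus O$ with a weight function $w:\mathrm{Lit}(P)\to\mathbb{Z}$. Then one can construct a (finite, turn-based) safety game in which Player 1 has a winning strategy if and only if $\phi$ is E-realizable.
   Context: $P$ is a finite set of atomic propositions partitioned into inputs $I$ (Player $I$) and outputs $O$ (Player $O$); $\Sigma_P=2^P$, $\Sigma_I=2^I$, $\Sigma_O=2^O$. Game: Player $O$ chooses $o_0\in\Sigma_O$, Player $I$ responds $i_0\in\Sigma_I$, then $o_1$, $i_1$, ...; the outcome is $(o_0\cup i_0)(o_1\cup i_1)\cdots$. Strategies: $\lambda_O:(\Sigma_O\Sigma_I)^*\to\Sigma_O$, $\lambda_I:(\Sigma_O\Sigma_I)^*\Sigma_O\to\Sigma_I$. $w$ extends to $\Sigma_I$ by $w(i)=\sum_{p\in i}w(p)+\sum_{p\in I\setminus i}w(\neg p)$, similarly to $\Sigma_O$, and $w(o\cup i)=w(o)+w(i)$; $\mathsf{EL}(u(n))=\sum_{k<n}w(\sigma_k)$ for $u=\sigma_0\sigma_1\cdots$. $\phi$ is E-realizable if there exist $\lambda_O$ and $c_0\in\mathbb{N}$ such that for all $\lambda_I$, $u=\mathsf{Outcome}(\lambda_O,\lambda_I)\models\phi$ and $c_0+\mathsf{EL}(u(n))\ge0$ for all $n\ge0$. A safety game consists of a finite game graph $(S=S_1\uplus S_2,s_0,E)$ (every state has a successor; Player 1 chooses the successor from states of $S_1$, Player 2 from states of $S_2$) and a set $\alpha\subseteq S$; a strategy of Player 1 is winning if every play from $s_0$ consistent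 with it stays in $\alpha$ forever. *)

theory Defs
  imports Main "HOL-Library.FuncSet" "HOL-Library.Nat_Bijection"
begin

section \<open>LTL over infinite words\<close>

datatype (atoms: 'p) ltl =
    LTrue
  | LAtom 'p
  | LNot "'p ltl"
  | LOr "'p ltl" "'p ltl"
  | LNext "'p ltl"
  | LUntil "'p ltl" "'p ltl"

text \<open>\<open>holds_at u i \<phi>\<close>: the suffix of \<open>u\<close> starting at position \<open>i\<close> satisfies \<open>\<phi>\<close>.\<close>

fun holds_at :: "(nat \<Rightarrow> 'p set) \<Rightarrow> nat \<Rightarrow> 'p ltl \<Rightarrow> bool" where
  "holds_at u i LTrue \<longleftrightarrow> True"
| "holds_at u i (LAtom p) \<longleftrightarrow> p \<in> u i"
| "holds_at u i (LNot \<phi>) \<longleftrightarrow> \<not> holds_at u i \<phi>"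
| "holds_at u i (LOr \<phi> \<psi>) \<longleftrightarrow> holds_at u i \<phi> \<or> holds_at u i \<psi>"
| "holds_at u i (LNext \<phi>) \<longleftrightarrow> holds_at u (Suc i) \<phi>"
| "holds_at u i (LUntil \<phi> \<psi>) \<longleftrightarrow>
     (\<exists>j\<ge>i. holds_at u j \<psi> \<and> (\<forall>k. i \<le> k \<and> k < j \<longrightarrow> holds_at u k \<phi>))"

definition models :: "(nat \<Rightarrow> 'p set) \<Rightarrow> 'p ltl \<Rightarrow> bool" where
  "models u \<phi> \<longleftrightarrow> holds_at u 0 \<phi>"


section \<open>The realizability game and energy levels\<close>

datatype 'p literal = Pos 'p | Neg 'p

definition letter_weight :: "('p literal \<Rightarrow> int) \<Rightarrow> 'p set \<Rightarrow> 'p set \<Rightarrow> int" where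
  "letter_weight w X x = (\<Sum>p\<in>x. w (Pos p)) + (\<Sum>p\<in>X - x. w (Neg p))"

definition energy_level ::
  "'p set \<Rightarrow> 'p set \<Rightarrow> ('p literal \<Rightarrow> int) \<Rightarrow> (nat \<Rightarrow> 'p set) \<Rightarrow> nat \<Rightarrow> int" where
  "energy_level inputs outputs w u n =
     (\<Sum>k<n. letter_weight w outputs (u k \<inter> outputs) + letter_weight w inputs (u k \<inter> inputs))"

text \<open>A word in \<open>(\<Sigma>\<^sub>O \<Sigma>\<^sub>I)\<^sup>*\<close> is a list of pairs (output letter, input letter).\<close>

type_synonym 'p history = "('p set \<times> 'p set) list"

definition histories :: "'p set \<Rightarrow> 'p set \<Rightarrow> 'p history set" where
  "histories inputs outputs = lists (Pow outputs \<times> Pow inputs)"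

definition strategies_O :: "'p set \<Rightarrow> 'p set \<Rightarrow> ('p history \<Rightarrow> 'p set) set" where
  "strategies_O inputs outputs = histories inputs outputs \<rightarrow> Pow outputs"

definition strategies_I :: "'p set \<Rightarrow> 'p set \<Rightarrow> ('p history \<times> 'p set \<Rightarrow> 'p set) set" where
  "strategies_I inputs outputs = histories inputs outputs \<times> Pow outputs \<rightarrow> Pow inputs"

fun history_after ::
  "('p history \<Rightarrow> 'p set) \<Rightarrow> ('p history \<times> 'p set \<Rightarrow> 'p set) \<Rightarrow> nat \<Rightarrow> 'p history" where
  "history_after lO lI 0 = []"
| "history_after lO lI (Suc n) =
     (let h = history_after lO lI n in h @ [(lO h, lI (h, lO h))])"

definition outcome ::
  "('p history \<Rightarrow> 'p set) \<Rightarrow> ('p history \<times> 'p set \<Rightarrow> 'p set) \<Rightarrow> nat \<Rightarrow> 'p set" where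
  "outcome lO lI n = (let h = history_after lO lI n in lO h \<union> lI (h, lO h))"

definition E_realizable ::
  "'p set \<Rightarrow> 'p set \<Rightarrow> ('p literal \<Rightarrow> int) \<Rightarrow> 'p ltl \<Rightarrow> bool" where
  "E_realizable inputs outputs w \<phi> \<longleftrightarrow>
     (\<exists>lO\<in>strategies_O inputs outputs. \<exists>c0::nat. \<forall>lI\<in>strategies_I inputs outputs.
        models (outcome lO lI) \<phi> \<and>
        (\<forall>n. int c0 + energy_level inputs outputs w (outcome lO lI) n \<ge> 0))"


section \<open>Finite turn-based safety games\<close>

record 's safety_game =
  states1 :: "'s set"
  states2 :: "'s set"
  init :: 's
  edges :: "('s \<times> 's) set"
  safe :: "'s set"

definition states :: "'s safety_game \<Rightarrow> 's set" where
  "states G = states1 G \<union> states2 G"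

definition is_safety_game :: "'s safety_game \<Rightarrow> bool" where
  "is_safety_game G \<longleftrightarrow>
     finite (states G) \<and> states1 G \<inter> states2 G = {} \<and> init G \<in> states G \<and>
     edges G \<subseteq> states G \<times> states G \<and> (\<forall>s\<in>states G. \<exists>t. (s, t) \<in> edges G) \<and>
     safe G \<subseteq> states G"

definition strategies1 :: "'s safety_game \<Rightarrow> ('s list \<Rightarrow> 's) set" where
  "strategies1 G =
     {\<tau>. \<forall>h\<in>lists (states G). \<forall>s\<in>states1 G. (s, \<tau> (h @ [s])) \<in> edges G}"

definition plays :: "'s safety_game \<Rightarrow> (nat \<Rightarrow> 's) set" where
  "plays G = {\<rho>. \<rho> 0 = init G \<and> (\<forall>n. (\<rho> n, \<rho> (Suc n)) \<in> edges G)}"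

definition consistent1 :: "'s safety_game \<Rightarrow> ('s list \<Rightarrow> 's) \<Rightarrow> (nat \<Rightarrow> 's) \<Rightarrow> bool" where
  "consistent1 G \<tau> \<rho> \<longleftrightarrow> (\<forall>n. \<rho> n \<in> states1 G \<longrightarrow> \<rho> (Suc n) = \<tau> (map \<rho> [0..<Suc n]))"

definition winning1 :: "'s safety_game \<Rightarrow> ('s list \<Rightarrow> 's) \<Rightarrow> bool" where
  "winning1 G \<tau> \<longleftrightarrow> (\<forall>\<rho>\<in>plays G. consistent1 G \<tau> \<rho> \<longrightarrow> (\<forall>n. \<rho> n \<in> safe G))"

definition player1_wins :: "'s safety_game \<Rightarrow> bool" where
  "player1_wins G \<longleftrightarrow> (\<exists>\<tau>\<in>strategies1 G. winning1 G \<tau>)"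


section \<open>Computable functions\<close>

text \<open>
  \<open>recursive n f\<close>: \<open>f\<close> is a total recursive function of \<open>n\<close> arguments, in Kleene's
  presentation in which minimisation is applied only to functions that have a zero for every
  choice of the parameters. Only the values of \<open>f\<close> on lists of length \<open>n\<close> are meaningful.
\<close>

inductive recursive :: "nat \<Rightarrow> (nat list \<Rightarrow> nat) \<Rightarrow> bool" where
  zero: "recursive n (\<lambda>_. 0)"
| succ: "recursive 1 (\<lambda>xs. Suc (hd xs))"
| proj: "i < n \<Longrightarrow> recursive n (\<lambda>xs. xs ! i)"
| comp: "recursive (length fs) g \<Longrightarrow> \<forall>f\<in>set fs. recursive n f \<Longrightarrow>
     recursive n (\<lambda>xs. g (map (\<lambda>f. f xs) fs))"
| prim_rec: "recursive n g \<Longrightarrow> recursive (Suc (Suc n)) h \<Longrightarrow>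
     recursive (Suc n) (\<lambda>xs. rec_nat (g (tl xs)) (\<lambda>k r. h (k # r # tl xs)) (hd xs))"
| minimise: "recursive (Suc n) g \<Longrightarrow> \<forall>xs. length xs = n \<longrightarrow> (\<exists>k. g (k # xs) = 0) \<Longrightarrow>
     recursive n (\<lambda>xs. LEAST k. g (k # xs) = 0)"

definition computable :: "(nat \<Rightarrow> nat) \<Rightarrow> bool" where
  "computable f \<longleftrightarrow> (\<exists>g. recursive 1 g \<and> (\<forall>x. f x = g [x]))"

text \<open>
  Atomic propositions and game states are natural numbers, so that specifications and games are
  finite objects with a numerical code. Of the weight function, the code lists just the weights of
  the literals over the propositions at hand.
\<close>

fun encode_ltl :: "nat ltl \<Rightarrow> nat" where
  "encode_ltl LTrue = prod_encode (0, 0)"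
| "encode_ltl (LAtom p) = prod_encode (1, p)"
| "encode_ltl (LNot \<phi>) = prod_encode (2, encode_ltl \<phi>)"
| "encode_ltl (LOr \<phi> \<psi>) = prod_encode (3, prod_encode (encode_ltl \<phi>, encode_ltl \<psi>))"
| "encode_ltl (LNext \<phi>) = prod_encode (4, encode_ltl \<phi>)"
| "encode_ltl (LUntil \<phi> \<psi>) = prod_encode (5, prod_encode (encode_ltl \<phi>, encode_ltl \<psi>))"

definition encode_weights :: "nat set \<Rightarrow> (nat literal \<Rightarrow> int) \<Rightarrow> nat" where
  "encode_weights P w =
     list_encode (map (\<lambda>p. prod_encode (int_encode (w (Pos p)), int_encode (w (Neg p))))
       (sorted_list_of_set P))"

definition encode_spec ::
  "nat set \<Rightarrow> nat set \<Rightarrow> (nat literal \<Rightarrow> int) \<Rightarrow> nat ltl \<Rightarrow> nat" where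
  "encode_spec inputs outputs w \<phi> =
     list_encode [set_encode inputs, set_encode outputs,
       encode_weights (inputs \<union> outputs) w, encode_ltl \<phi>]"

definition encode_game :: "nat safety_game \<Rightarrow> nat" where
  "encode_game G =
     list_encode [set_encode (states1 G), set_encode (states2 G), init G,
       set_encode (prod_encode ` edges G), set_encode (safe G)]"

lemma encode_ltl_inject: "encode_ltl \<phi> = encode_ltl \<psi> \<longleftrightarrow> \<phi> = \<psi>"
proof (induction \<phi> arbitrary: \<psi>)
  case LTrue then show ?case by (cases \<psi>) auto
next
  case (LAtom p) then show ?case by (cases \<psi>) auto
next
  case (LNot \<phi>) then show ?case by (cases \<psi>) auto
next
  case (LOr \<phi>1 \<phi>2) then show ?case by (cases \<psi>) auto
next
  case (LNext \<phi>) then show ?case by (cases \<psi>) auto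
next
  case (LUntil \<phi>1 \<phi>2) then show ?case by (cases \<psi>) auto
qed

lemma encode_game_inject:
  fixes G H :: "nat safety_game"
  assumes "is_safety_game G" and "is_safety_game H"
  shows "encode_game G = encode_game H \<longleftrightarrow> G = H"
proof -
  have fin: "finite (states1 K)" "finite (states2 K)" "finite (edges K)" "finite (safe K)"
    if "is_safety_game K" for K :: "nat safety_game"
    using that finite_subset[of "edges K" "states K \<times> states K"]
      finite_subset[of "safe K" "states K"]
    by (auto simp: is_safety_game_def states_def)
  show ?thesis
    using fin[OF assms(1)] fin[OF assms(2)]
    by (auto simp: encode_game_def set_encode_eq inj_image_eq_iff[OF inj_prod_encode])
qed

lemma encode_spec_inject:
  assumes "finite inputs" "finite outputs" "finite inputs'" "finite outputs'"
  shows "encode_spec inputs outputs w \<phi> = encode_spec inputs' outputs' w' \<phi>' \<longleftrightarrow>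
    inputs = inputs' \<and> outputs = outputs' \<and> \<phi> = \<phi>' \<and>
    (\<forall>p\<in>inputs \<union> outputs. w (Pos p) = w' (Pos p) \<and> w (Neg p) = w' (Neg p))"
  using assms
  by (auto simp: encode_spec_def encode_weights_def set_encode_eq encode_ltl_inject
      list_encode_eq int_encode_eq)

end

theory Submission
  imports Defs "HOL-Library.Omega_Words_Fun" "HOL-Library.Multiset"
begin

text \<open>
  Since the game only has to have the right winner, it suffices to decide E-realizability, and for
  that it suffices to give finite certificates, checkable by a recursive predicate, for
  E-realizability and for its negation, such that one of the two always exists: an unbounded search
  then terminates.

  A certificate is a finite-state machine for one of the players whose product with the tableau
  automaton of the formula carries a progress measure. Soundness is immediate. For existence, the
  formula is turned into a deterministic parity automaton, which together with the weights gives a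
  finite game in which the output player wants every cycle to have nonnegative weight and an even
  least priority. A shuffle of two such cycles is again one, so by induction on the number of edges
  either the output player wins with finite memory or the input player has a positional strategy
  that beats every initial credit.
\<close>

section \<open>Walks and progress measures in finite graphs\<close>

inductive walk :: "('v \<times> 'v) set \<Rightarrow> 'v \<Rightarrow> 'v list \<Rightarrow> 'v \<Rightarrow> bool" for E where
  walk_Nil: "walk E x [] x"
| walk_Cons: "(x, y) \<in> E \<Longrightarrow> walk E y xs z \<Longrightarrow> walk E x (x # xs) z"

lemma walk_Nil_iff [simp]: "walk E x [] y \<longleftrightarrow> x = y"
  by (auto elim: walk.cases intro: walk.intros)

lemma walk_Cons_iff [simp]: "walk E x (a # xs) z \<longleftrightarrow> a = x \<and> (\<exists>y. (x, y) \<in> E \<and> walk E y xs z)"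
  by (auto elim: walk.cases intro: walk.intros)

lemma walk_append [simp]: "walk E x (xs @ ys) z \<longleftrightarrow> (\<exists>y. walk E x xs y \<and> walk E y ys z)"
  by (induction xs arbitrary: x) auto

lemma walk_mono: "walk E x xs y \<Longrightarrow> E \<subseteq> E' \<Longrightarrow> walk E' x xs y"
  by (induction rule: walk.induct) auto

lemma walk_map:
  assumes "walk E x xs y" and "\<And>a b. a \<in> set xs \<Longrightarrow> (a, b) \<in> E \<Longrightarrow> (f a, f b) \<in> E'"
  shows "walk E' (f x) (map f xs) (f y)"
  using assms by (induction rule: walk.induct) auto

lemma walk_subset_Domain: "walk E x xs y \<Longrightarrow> set xs \<subseteq> Domain E"
  by (induction rule: walk.induct) auto

lemma walk_start_in_set: "walk E x xs y \<Longrightarrow> xs \<noteq> [] \<Longrightarrow> x \<in> set xs"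
  by (cases xs) auto

lemma walk_imp_rtrancl: "walk E x xs y \<Longrightarrow> (x, y) \<in> E\<^sup>*"
  by (induction rule: walk.induct) auto

lemma rtrancl_imp_walk:
  assumes "(x, y) \<in> E\<^sup>*"
  obtains xs where "walk E x xs y"
  using assms
proof (induction arbitrary: thesis rule: converse_rtrancl_induct)
  case base
  then show ?case using walk_Nil by metis
next
  case (step a b)
  then show ?case using walk_Cons by metis
qed

lemma trancl_imp_walk:
  assumes "(x, y) \<in> E\<^sup>+"
  obtains xs where "walk E x xs y" "xs \<noteq> []"
proof -
  obtain z where "(x, z) \<in> E" "(z, y) \<in> E\<^sup>*" using assms by (meson tranclD)
  then show ?thesis using that rtrancl_imp_walk walk_Cons list.distinct(1) by metis
qed

lemma walk_replicate: "walk E x xs x \<Longrightarrow> walk E x (concat (replicate k xs)) x"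
  by (induction k) auto

lemma walk_rotate: "walk E x (as @ b # bs) x \<Longrightarrow> walk E b (b # bs @ as) b"
  by auto

lemma walk_nth_edge:
  assumes "walk E x xs y" and "i < length xs"
  shows "(xs ! i, (xs @ [y]) ! Suc i) \<in> E"
  using assms
proof (induction arbitrary: i rule: walk.induct)
  case (walk_Cons x y xs z)
  have "(xs @ [z]) ! 0 = y" using walk_Cons.hyps(2) by (cases xs) auto
  then show ?case using walk_Cons by (cases i) auto
qed simp

definition infinite_path :: "('v \<times> 'v) set \<Rightarrow> 'v word \<Rightarrow> bool" where
  "infinite_path E \<rho> \<longleftrightarrow> (\<forall>n. (\<rho> n, \<rho> (Suc n)) \<in> E)"

lemma infinite_pathD: "infinite_path E \<rho> \<Longrightarrow> (\<rho> n, \<rho> (Suc n)) \<in> E"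
  by (simp add: infinite_path_def)

lemma infinite_path_walk:
  assumes "infinite_path E \<rho>" and "i \<le> j"
  shows "walk E (\<rho> i) (subsequence \<rho> i j) (\<rho> j)"
  using assms(2) by (induction rule: dec_induct) (auto simp: infinite_pathD[OF assms(1)])

lemma infinite_path_iter:
  assumes "walk E x xs x" and "xs \<noteq> []"
  shows "infinite_path E xs\<^sup>\<omega>" and "xs\<^sup>\<omega> 0 = x"
proof -
  show start: "xs\<^sup>\<omega> 0 = x" using assms by (cases xs) auto
  show "infinite_path E xs\<^sup>\<omega>" unfolding infinite_path_def
  proof
    fix n
    let ?k = "n mod length xs"
    have k: "?k < length xs" using assms(2) by simp
    then consider "Suc ?k < length xs" | "Suc ?k = length xs" by linarith
    then have "(xs @ [x]) ! Suc ?k = xs ! (Suc n mod length xs)"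
      using assms(2) start by cases (auto simp: nth_append mod_Suc)
    then show "(xs\<^sup>\<omega> n, xs\<^sup>\<omega> (Suc n)) \<in> E" using walk_nth_edge[OF assms(1) k] assms(2) by simp
  qed
qed

lemma conc_start: "walk E x xs (\<rho> 0) \<Longrightarrow> (xs \<frown> \<rho>) 0 = x"
  by (cases xs) auto

lemma infinite_path_conc:
  assumes "walk E x xs (\<rho> 0)" and "infinite_path E \<rho>"
  shows "infinite_path E (xs \<frown> \<rho>)"
  using assms(1)
proof (induction xs arbitrary: x)
  case (Cons a xs)
  then obtain y where y: "(a, y) \<in> E" "walk E y xs (\<rho> 0)" by auto
  show ?case unfolding infinite_path_def
  proof
    fix n
    show "(((a # xs) \<frown> \<rho>) n, ((a # xs) \<frown> \<rho>) (Suc n)) \<in> E"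
      using y(1) conc_start[of E y xs \<rho>] y(2) infinite_pathD[OF Cons.IH[OF y(2)]]
      by (cases n) simp_all
  qed
qed (simp add: assms(2))

lemma finite_graph_reaches_cycle:
  assumes fin: "finite X" and total: "\<And>x. x \<in> X \<Longrightarrow> \<exists>y\<in>X. (x, y) \<in> E" and "x \<in> X"
  obtains y xs where "(x, y) \<in> E\<^sup>*" "walk E y xs y" "xs \<noteq> []"
proof -
  obtain f where f: "\<And>x. x \<in> X \<Longrightarrow> f x \<in> X \<and> (x, f x) \<in> E" using total by metis
  define \<rho> where "\<rho> n = (f ^^ n) x" for n
  have X: "\<rho> n \<in> X" for n by (induction n) (auto simp: \<rho>_def \<open>x \<in> X\<close> f)
  have path: "infinite_path E \<rho>" using f[OF X] by (simp add: infinite_path_def \<rho>_def)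
  have "\<not> inj \<rho>" using X fin by (meson finite_subset image_subsetI infinite_UNIV_nat finite_imageD)
  then obtain i j where ij: "i < j" "\<rho> i = \<rho> j" unfolding inj_def by (metis linorder_neqE_nat)
  have "(x, \<rho> i) \<in> E\<^sup>*"
    using walk_imp_rtrancl[OF infinite_path_walk[OF path le0]] by (simp add: \<rho>_def)
  moreover have "walk E (\<rho> i) (subsequence \<rho> i j) (\<rho> i)"
    using infinite_path_walk[OF path, of i j] ij by simp
  ultimately show ?thesis using that ij(1) by force
qed

lemma long_walk_contains_cycle:
  assumes fin: "finite V" and E: "E \<subseteq> V \<times> V" and w: "walk E x xs y" and long: "card V < length xs"
  obtains as cs bs z where "xs = as @ cs @ bs" "walk E x as z" "walk E z cs z" "walk E z bs y"
    "cs \<noteq> []" "length cs \<le> card V"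
proof -
  let ?ys = "take (Suc (card V)) xs"
  have len: "length ?ys = Suc (card V)" using long by simp
  have "set ?ys \<subseteq> V" using walk_subset_Domain[OF w] E set_take_subset by fast
  then have "card (set ?ys) < length ?ys" using fin len by (simp add: card_mono le_imp_less_Suc)
  then have "\<not> distinct ?ys" using distinct_card by fastforce
  then obtain as z cs ds where d: "?ys = as @ [z] @ cs @ [z] @ ds"
    using not_distinct_decomp by blast
  define bs where "bs = ds @ drop (Suc (card V)) xs"
  have xs: "xs = as @ (z # cs) @ z # bs"
    using d append_take_drop_id[of "Suc (card V)" xs] by (simp add: bs_def)
  have "length as + length cs + 2 \<le> Suc (card V)" using arg_cong[OF d, of length] len by simp
  then have "length (z # cs) \<le> card V" by simp
  then show ?thesis using that[OF xs] w unfolding xs by auto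
qed

lemma sum_list_walk_le:
  fixes \<omega> :: "'v \<Rightarrow> int"
  assumes fin: "finite V" and E: "E \<subseteq> V \<times> V"
    and cycle: "\<And>x xs. walk E x xs x \<Longrightarrow> xs \<noteq> [] \<Longrightarrow> length xs \<le> card V \<Longrightarrow> sum_list (map \<omega> xs) \<le> 0"
    and bound: "\<And>x. x \<in> V \<Longrightarrow> \<omega> x \<le> W" "0 \<le> W"
    and "walk E x xs y"
  shows "sum_list (map \<omega> xs) \<le> int (card V) * W"
  using \<open>walk E x xs y\<close>
proof (induction xs arbitrary: x y rule: measure_induct_rule[where f = length])
  case (less xs)
  note w = less.prems
  show ?case
  proof (cases "length xs \<le> card V")
    case True
    have "set xs \<subseteq> V" using walk_subset_Domain[OF w] E by auto
    then have "sum_list (map \<omega> xs) \<le> int (length xs) * W"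
      by (induction xs) (auto simp: algebra_simps intro!: add_mono bound)
    also have "\<dots> \<le> int (card V) * W" using True bound(2) by (simp add: mult_right_mono)
    finally show ?thesis .
  next
    case False
    then have "card V < length xs" by simp
    then obtain as cs bs z where xs: "xs = as @ cs @ bs" "walk E x as z" "walk E z cs z"
        "walk E z bs y" "cs \<noteq> []" "length cs \<le> card V"
      by (rule long_walk_contains_cycle[OF fin E w])
    have "length (as @ bs) < length xs" "walk E x (as @ bs) y" using xs by auto
    then have "sum_list (map \<omega> (as @ bs)) \<le> int (card V) * W" by (rule less.IH)
    then show ?thesis using cycle[OF xs(3,5,6)] by (simp add: xs(1))
  qed
qed

text \<open>The potential of \<open>x\<close> is the supremum of the weights of all walks from \<open>x\<close>.\<close>

lemma potential_exists:
  fixes \<omega> :: "'v \<Rightarrow> int"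
  assumes fin: "finite V" and E: "E \<subseteq> V \<times> V"
    and cycle: "\<And>x xs. walk E x xs x \<Longrightarrow> xs \<noteq> [] \<Longrightarrow> length xs \<le> card V \<Longrightarrow> sum_list (map \<omega> xs) \<le> 0"
  obtains \<pi> :: "'v \<Rightarrow> int" where "\<And>x y. (x, y) \<in> E \<Longrightarrow> \<pi> y + \<omega> x \<le> \<pi> x"
proof -
  define W where "W = Max (insert 0 (\<omega> ` V))"
  have W: "0 \<le> W" "x \<in> V \<Longrightarrow> \<omega> x \<le> W" for x using fin by (auto simp: W_def)
  define S where "S x = {sum_list (map \<omega> xs) |xs y. walk E x xs y}" for x
  have bdd: "bdd_above (S x)" for x
    using sum_list_walk_le[OF fin E cycle W(2,1)] by (fastforce simp: S_def intro: bdd_aboveI)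
  have "0 \<in> S x" for x
    unfolding S_def by (intro CollectI exI[of _ "[]"] exI[of _ x] conjI walk_Nil) simp
  then have nonempty: "S x \<noteq> {}" for x by blast
  show ?thesis
  proof (rule that[of "\<lambda>x. Sup (S x)"])
    fix x y assume e: "(x, y) \<in> E"
    have "Sup (S y) \<le> Sup (S x) - \<omega> x"
    proof (rule cSup_least[OF nonempty])
      fix t assume "t \<in> S y"
      then obtain xs z where "t = sum_list (map \<omega> xs)" "walk E y xs z" by (auto simp: S_def)
      then have "walk E x (x # xs) z" "\<omega> x + t = sum_list (map \<omega> (x # xs))" using e by auto
      then have "\<omega> x + t \<in> S x" unfolding S_def by blast
      then show "t \<le> Sup (S x) - \<omega> x" using cSup_upper[OF _ bdd] by fastforce
    qed
    then show "Sup (S y) + \<omega> x \<le> Sup (S x)" by simp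
  qed
qed

text \<open>A step of a progress measure with ranks \<open>k\<close>, \<open>k'\<close> and potentials \<open>p\<close>, \<open>p'\<close>: on odd ranks the
  potential pays for the cost \<open>c\<close> and for every accepting visit, on even ranks there is none.\<close>

definition progress_step :: "nat \<Rightarrow> nat \<Rightarrow> int \<Rightarrow> int \<Rightarrow> int \<Rightarrow> bool \<Rightarrow> bool" where
  "progress_step k k' p p' c acc \<longleftrightarrow>
     k' < k \<or> k' = k \<and> (if even k then \<not> acc else p' + c + of_bool acc \<le> p)"

lemma decreasing_nat_eventually_const:
  fixes f :: "nat \<Rightarrow> nat"
  assumes "\<And>n. i \<le> n \<Longrightarrow> f (Suc n) \<le> f n"
  shows "\<exists>j\<ge>i. \<forall>n\<ge>j. f n = f j"
proof -
  obtain j where j: "i \<le> j" "\<And>n. i \<le> n \<Longrightarrow> f j \<le> f n"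
    using ex_has_least_nat[of "\<lambda>n. i \<le> n" i f] by auto
  have "f n = f j" if "j \<le> n" for n
    using that
  proof (induction rule: dec_induct)
    case (step n)
    then show ?case using assms[of n] j by (metis antisym le_SucI order_trans)
  qed simp
  then show ?thesis using j(1) by blast
qed

lemma progress_cost_unbounded:
  fixes k :: "nat \<Rightarrow> nat" and p c :: "nat \<Rightarrow> int" and acc :: "nat \<Rightarrow> bool"
  assumes step: "\<And>n. progress_step (k n) (k (Suc n)) (p n) (p (Suc n)) (C * c n) (acc n)"
    and C: "0 < C" and nonneg: "\<And>n. 0 \<le> p n" and acc: "\<exists>\<^sub>\<infinity>n. acc n"
  shows "\<exists>n. (\<Sum>m<n. c m) < b"
proof (rule ccontr)
  assume "\<not> ?thesis"
  then have low: "C * b \<le> C * (\<Sum>m<n. c m)" for n using C by (simp add: not_less)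
  have "k (Suc n) \<le> k n" for n using step[of n] by (auto simp: progress_step_def)
  then obtain i where i: "\<forall>n\<ge>i. k n = k i"
    using decreasing_nat_eventually_const[of 0 k] by blast
  have step': "if even (k i) then \<not> acc n
      else p (Suc n) + C * c n + of_bool (acc n) \<le> p n" if "i \<le> n" for n
    using step[of n] i[rule_format, of n] i[rule_format, of "Suc n"] that
    by (auto simp: progress_step_def)
  then have "odd (k i)" using acc unfolding INFM_nat_le by metis
  define f where "f n = p n + C * (\<Sum>m<n. c m) - C * b" for n
  have nonneg': "0 \<le> f n" for n using nonneg[of n] low[of n] by (simp add: f_def)
  have drop: "f (Suc n) + of_bool (acc n) \<le> f n" if "i \<le> n" for n
    using step'[OF that] \<open>odd (k i)\<close> by (simp add: f_def algebra_simps)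
  have "nat (f (Suc n)) \<le> nat (f n)" if "i \<le> n" for n
    using drop[OF that] by (intro nat_mono) (simp split: if_splits add: of_bool_def)
  then obtain j where j: "i \<le> j" "\<forall>n\<ge>j. nat (f n) = nat (f j)"
    using decreasing_nat_eventually_const[of i "\<lambda>n. nat (f n)"] by blast
  obtain n where "j \<le> n" "acc n" using acc unfolding INFM_nat_le by blast
  moreover from this have "f (Suc n) = f n"
    using j(2)[rule_format, of n] j(2)[rule_format, of "Suc n"] nonneg'[of n] nonneg'[of "Suc n"]
    by simp
  ultimately show False using drop[of n] j(1) by simp
qed

definition on_accepting_cycle :: "('v \<times> 'v) set \<Rightarrow> ('v \<Rightarrow> bool) \<Rightarrow> 'v \<Rightarrow> bool" where
  "on_accepting_cycle E acc x \<longleftrightarrow> (\<exists>z. acc z \<and> (x, z) \<in> E\<^sup>* \<and> (z, x) \<in> E\<^sup>+)"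

lemma on_accepting_cycleE:
  assumes "on_accepting_cycle E acc x"
  obtains xs z where "walk E x xs x" "z \<in> set xs" "acc z"
proof -
  obtain z where z: "acc z" "(x, z) \<in> E\<^sup>*" "(z, x) \<in> E\<^sup>+"
    using assms by (auto simp: on_accepting_cycle_def)
  obtain xs where xs: "walk E x xs z" using z(2) by (rule rtrancl_imp_walk)
  obtain ys where ys: "walk E z ys x" "ys \<noteq> []" using z(3) by (rule trancl_imp_walk)
  show ?thesis
  proof (rule that)
    show "walk E x (xs @ ys) x" using xs ys by auto
    show "z \<in> set (xs @ ys)" using walk_start_in_set[OF ys] by simp
  qed (rule z)
qed

lemma on_accepting_cycle_cong:
  assumes "(x, y) \<in> E\<^sup>*" and "(y, x) \<in> E\<^sup>*"
  shows "on_accepting_cycle E acc x \<longleftrightarrow> on_accepting_cycle E acc y"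
  unfolding on_accepting_cycle_def using assms by (meson rtrancl_trans trancl_rtrancl_trancl)

text \<open>Repeating a closed walk of positive weight would outweigh any closed walk through its start.\<close>

lemma closed_walk_sum_nonpos:
  fixes \<omega> :: "'v \<Rightarrow> int"
  assumes neg: "\<And>x xs. walk E x xs x \<Longrightarrow> \<exists>z\<in>set xs. acc z \<Longrightarrow> sum_list (map \<omega> xs) < 0"
    and x: "on_accepting_cycle E acc x" and w: "walk E x xs x"
  shows "sum_list (map \<omega> xs) \<le> 0"
proof (rule ccontr)
  assume "\<not> ?thesis"
  then have pos: "1 \<le> sum_list (map \<omega> xs)" by simp
  obtain ys z where ys: "walk E x ys x" "z \<in> set ys" "acc z" using x by (rule on_accepting_cycleE)
  define k where "k = nat (- sum_list (map \<omega> ys))"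
  let ?zs = "concat (replicate k xs) @ ys"
  have "sum_list (map \<omega> (concat (replicate k xs))) = int k * sum_list (map \<omega> xs)"
    by (induction k) (auto simp: algebra_simps)
  moreover have "int k \<le> int k * sum_list (map \<omega> xs)"
    using mult_left_mono[OF pos, of "int k"] by simp
  moreover have "- sum_list (map \<omega> ys) \<le> int k" by (simp add: k_def)
  ultimately have "0 \<le> sum_list (map \<omega> ?zs)" by simp
  moreover have "walk E x ?zs x" using walk_replicate[OF w] ys(1) unfolding walk_append by blast
  ultimately show False using neg[of x ?zs] ys(2,3) by fastforce
qed

lemma scaled_closed_walk_sum_nonpos:
  fixes \<omega> :: "'v \<Rightarrow> int"
  assumes neg: "\<And>x xs. walk E x xs x \<Longrightarrow> \<exists>z\<in>set xs. acc z \<Longrightarrow> sum_list (map \<omega> xs) < 0"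
    and "on_accepting_cycle E acc x" and w: "walk E x xs x" and len: "length xs \<le> C"
  shows "(\<Sum>z\<leftarrow>xs. int C * \<omega> z + of_bool (acc z)) \<le> 0"
proof -
  have eq: "(\<Sum>z\<leftarrow>xs. int C * \<omega> z + of_bool (acc z)) =
      int C * sum_list (map \<omega> xs) + int (length (filter acc xs))"
    by (induction xs) (auto simp: algebra_simps)
  show ?thesis
  proof (cases "\<exists>z\<in>set xs. acc z")
    case True
    then have "sum_list (map \<omega> xs) \<le> -1" using neg[OF w] by simp
    then have "int C * sum_list (map \<omega> xs) \<le> int C * -1" by (intro mult_left_mono) auto
    moreover have "length (filter acc xs) \<le> C" using len length_filter_le le_trans by blast
    ultimately show ?thesis unfolding eq by simp
  next
    case False
    then have "filter acc xs = []" by (auto simp: filter_empty_conv)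
    then show ?thesis
      unfolding eq using closed_walk_sum_nonpos[OF assms(1-3)] by (simp add: mult_nonneg_nonpos)
  qed
qed

lemma scc_potential_exists:
  fixes \<omega> :: "'v \<Rightarrow> int"
  assumes fin: "finite V" and E: "E \<subseteq> V \<times> V"
    and neg: "\<And>x xs. walk E x xs x \<Longrightarrow> \<exists>z\<in>set xs. acc z \<Longrightarrow> sum_list (map \<omega> xs) < 0"
  obtains \<pi> :: "'v \<Rightarrow> int" where
    "\<And>x y. (x, y) \<in> E \<Longrightarrow> (y, x) \<in> E\<^sup>* \<Longrightarrow> on_accepting_cycle E acc x \<Longrightarrow>
      \<pi> y + int (Suc (card V)) * \<omega> x + of_bool (acc x) \<le> \<pi> x"
proof -
  define F where "F = {(x, y) \<in> E. (y, x) \<in> E\<^sup>* \<and> on_accepting_cycle E acc x}"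
  have "F \<subseteq> V \<times> V" using E by (auto simp: F_def)
  moreover have "(\<Sum>z\<leftarrow>xs. int (Suc (card V)) * \<omega> z + of_bool (acc z)) \<le> 0"
    if "walk F x xs x" "xs \<noteq> []" "length xs \<le> card V" for x xs
  proof (rule scaled_closed_walk_sum_nonpos[OF neg])
    show "on_accepting_cycle E acc x" using that by (cases xs) (auto simp: F_def)
    show "walk E x xs x" using that(1) by (rule walk_mono) (auto simp: F_def)
    show "length xs \<le> Suc (card V)" using that(3) by simp
  qed simp_all
  ultimately obtain \<pi> :: "'v \<Rightarrow> int" where
    "\<And>x y. (x, y) \<in> F \<Longrightarrow> \<pi> y + (int (Suc (card V)) * \<omega> x + of_bool (acc x)) \<le> \<pi> x"
    using potential_exists[OF fin, of F "\<lambda>z. int (Suc (card V)) * \<omega> z + of_bool (acc z)"] by metis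
  then show ?thesis by (intro that[of \<pi>]) (simp add: F_def add.assoc)
qed

text \<open>The rank descends along the strongly connected components and is odd on those that contain an
  accepting cycle.\<close>

lemma progress_measure_exists:
  fixes \<omega> :: "'v \<Rightarrow> int" and acc :: "'v \<Rightarrow> bool"
  assumes fin: "finite V" and E: "E \<subseteq> V \<times> V"
    and neg: "\<And>x xs. walk E x xs x \<Longrightarrow> \<exists>z\<in>set xs. acc z \<Longrightarrow> sum_list (map \<omega> xs) < 0"
  obtains \<kappa> :: "'v \<Rightarrow> nat" and \<pi> :: "'v \<Rightarrow> int" and C :: nat where "0 < C"
    "\<And>x y. (x, y) \<in> E \<Longrightarrow> progress_step (\<kappa> x) (\<kappa> y) (\<pi> x) (\<pi> y) (int C * \<omega> x) (acc x)"
proof -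
  obtain \<pi> :: "'v \<Rightarrow> int" where \<pi>:
    "\<And>x y. (x, y) \<in> E \<Longrightarrow> (y, x) \<in> E\<^sup>* \<Longrightarrow> on_accepting_cycle E acc x \<Longrightarrow>
      \<pi> y + int (Suc (card V)) * \<omega> x + of_bool (acc x) \<le> \<pi> x"
    by (rule scc_potential_exists[OF fin E, of acc \<omega>]) (use neg in blast)+
  define R where "R x = E\<^sup>* `` {x}" for x
  define \<kappa> where "\<kappa> x = 2 * card (R x) + of_bool (on_accepting_cycle E acc x)" for x
  have "R x \<subseteq> insert x V" for x unfolding R_def using E by (auto elim: rtranclE)
  then have finR: "finite (R x)" for x using fin by (meson finite_insert finite_subset)
  have "progress_step (\<kappa> x) (\<kappa> y) (\<pi> x) (\<pi> y) (int (Suc (card V)) * \<omega> x) (acc x)"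
    if e: "(x, y) \<in> E" for x y
  proof (cases "(y, x) \<in> E\<^sup>*")
    case False
    have "R y \<subseteq> R x" using e by (auto simp: R_def intro: converse_rtrancl_into_rtrancl)
    moreover have "x \<in> R x - R y" using False by (simp add: R_def)
    ultimately have "card (R y) < card (R x)"
      using finR by (metis Diff_iff psubsetI psubset_card_mono)
    then have "\<kappa> y < \<kappa> x" by (simp add: \<kappa>_def of_bool_def)
    then show ?thesis by (simp add: progress_step_def)
  next
    case True
    have xy: "(x, y) \<in> E\<^sup>*" using e by blast
    have "R y = R x" unfolding R_def using xy True by (auto intro: rtrancl_trans)
    then have \<kappa>: "\<kappa> y = \<kappa> x" using on_accepting_cycle_cong[OF xy True] by (simp add: \<kappa>_def)
    show ?thesis
    proof (cases "on_accepting_cycle E acc x")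
      case on: True
      then show ?thesis using \<pi>[OF e True on] \<kappa> by (simp add: progress_step_def \<kappa>_def)
    next
      case off: False
      have "(x, x) \<in> E\<^sup>+" using e True by (rule rtrancl_into_trancl2)
      then have "\<not> acc x" using off by (auto simp: on_accepting_cycle_def)
      then show ?thesis using \<kappa> off by (simp add: progress_step_def \<kappa>_def)
    qed
  qed
  then show ?thesis using that[of "Suc (card V)" \<kappa> \<pi>] by simp
qed

lemma finite_nonneg_shift:
  fixes f :: "'v \<Rightarrow> int"
  assumes "finite V" obtains D where "\<And>v. v \<in> V \<Longrightarrow> 0 \<le> f v + D"
proof (rule that)
  fix v assume "v \<in> V"
  then have "- f v \<le> Max ((\<lambda>v. - f v) ` V)" using assms by (intro Max_ge) auto
  then show "0 \<le> f v + Max ((\<lambda>v. - f v) ` V)" by simp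
qed

text \<open>Subtracting the weight from the potential moves the weights from the sources of the edges to
  their targets.\<close>

lemma nat_progress_measure_exists:
  fixes \<omega> :: "'v \<Rightarrow> int" and acc :: "'v \<Rightarrow> bool"
  assumes fin: "finite V" and E: "E \<subseteq> V \<times> V"
    and neg: "\<And>x xs. walk E x xs x \<Longrightarrow> \<exists>z\<in>set xs. acc z \<Longrightarrow> sum_list (map \<omega> xs) < 0"
  obtains \<kappa> \<pi> :: "'v \<Rightarrow> nat" and C :: nat where "0 < C"
    "\<And>x y. (x, y) \<in> E \<Longrightarrow>
      progress_step (\<kappa> x) (\<kappa> y) (int (\<pi> x)) (int (\<pi> y)) (int C * \<omega> y) (acc x)"
proof -
  obtain \<kappa> :: "'v \<Rightarrow> nat" and \<pi> :: "'v \<Rightarrow> int" and C :: nat where C: "0 < C"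
    and step: "\<And>x y. (x, y) \<in> E \<Longrightarrow>
      progress_step (\<kappa> x) (\<kappa> y) (\<pi> x) (\<pi> y) (int C * \<omega> x) (acc x)"
    by (rule progress_measure_exists[OF fin E, of acc \<omega>]) (use neg in blast)+
  obtain D where D: "\<And>v. v \<in> V \<Longrightarrow> 0 \<le> (\<pi> v - int C * \<omega> v) + D"
    using finite_nonneg_shift[OF fin, of "\<lambda>v. \<pi> v - int C * \<omega> v"] by blast
  define \<pi>' where "\<pi>' v = nat (\<pi> v - int C * \<omega> v + D)" for v
  have \<pi>': "int (\<pi>' v) = \<pi> v - int C * \<omega> v + D" if "v \<in> V" for v
    using D[OF that] by (simp add: \<pi>'_def)
  have "progress_step (\<kappa> x) (\<kappa> y) (int (\<pi>' x)) (int (\<pi>' y)) (int C * \<omega> y) (acc x)"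
    if "(x, y) \<in> E" for x y
  proof -
    have "x \<in> V" "y \<in> V" using that E by auto
    then show ?thesis using step[OF that] by (auto simp: progress_step_def \<pi>' split: if_splits)
  qed
  then show ?thesis using that C by blast
qed

section \<open>Finite-memory determinacy of energy parity games\<close>

definition good_cycle :: "('v \<Rightarrow> int) \<Rightarrow> ('v \<Rightarrow> nat) \<Rightarrow> 'v list \<Rightarrow> bool" where
  "good_cycle wt pr xs \<longleftrightarrow> 0 \<le> sum_list (map wt xs) \<and> even (Min (pr ` set xs))"

text \<open>A finite-memory strategy of the player who wants good cycles: the memory states \<open>X\<close> sit at
  positions \<open>pos\<close>, and the moves \<open>F\<close> follow every edge of the opponent, who owns the positions
  \<open>V2\<close>.\<close>

locale strategy_graph =
  fixes V2 :: "'v set" and wt :: "'v \<Rightarrow> int" and pr :: "'v \<Rightarrow> nat" and E :: "('v \<times> 'v) set"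
    and X :: "'m set" and F :: "('m \<times> 'm) set" and pos :: "'m \<Rightarrow> 'v"
  assumes finite_states: "finite X" and moves_subset: "F \<subseteq> X \<times> X"
    and moves_edges: "(x, y) \<in> F \<Longrightarrow> (pos x, pos y) \<in> E"
    and moves_total: "x \<in> X \<Longrightarrow> \<exists>y. (x, y) \<in> F"
    and moves_cover: "x \<in> X \<Longrightarrow> pos x \<in> V2 \<Longrightarrow> (pos x, v) \<in> E \<Longrightarrow> \<exists>y. (x, y) \<in> F \<and> pos y = v"
    and cycles_good: "walk F x xs x \<Longrightarrow> xs \<noteq> [] \<Longrightarrow> good_cycle wt pr (map pos xs)"

definition player_wins ::
  "'v set \<Rightarrow> ('v \<Rightarrow> int) \<Rightarrow> ('v \<Rightarrow> nat) \<Rightarrow> ('v \<times> 'v) set \<Rightarrow> 'v \<Rightarrow> bool" where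
  "player_wins V2 wt pr E s \<longleftrightarrow>
     (\<exists>(X :: nat set) F pos. strategy_graph V2 wt pr E X F pos \<and> s \<in> pos ` X)"

text \<open>A positional strategy of the opponent, given by the remaining edges \<open>E'\<close>.\<close>

locale spoiler_graph =
  fixes V2 :: "'v set" and wt :: "'v \<Rightarrow> int" and pr :: "'v \<Rightarrow> nat" and V :: "'v set"
    and E :: "('v \<times> 'v) set" and s :: 'v and E' :: "('v \<times> 'v) set"
  assumes subset: "E' \<subseteq> E" and player_edges: "(u, v) \<in> E \<Longrightarrow> u \<notin> V2 \<Longrightarrow> (u, v) \<in> E'"
    and total: "u \<in> V \<Longrightarrow> \<exists>v. (u, v) \<in> E'"
    and cycles_bad: "(s, x) \<in> E'\<^sup>* \<Longrightarrow> walk E' x xs x \<Longrightarrow> xs \<noteq> [] \<Longrightarrow> \<not> good_cycle wt pr xs"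

definition opponent_wins ::
  "'v set \<Rightarrow> ('v \<Rightarrow> int) \<Rightarrow> ('v \<Rightarrow> nat) \<Rightarrow> 'v set \<Rightarrow> ('v \<times> 'v) set \<Rightarrow> 'v \<Rightarrow> bool" where
  "opponent_wins V2 wt pr V E s \<longleftrightarrow> (\<exists>E'. spoiler_graph V2 wt pr V E s E')"

lemma strategy_graph_rename:
  assumes "strategy_graph V2 wt pr E X F pos" and inj: "inj_on f X"
  shows "strategy_graph V2 wt pr E (f ` X) (map_prod f f ` F) (pos \<circ> inv_into X f)"
proof -
  interpret strategy_graph V2 wt pr E X F pos by fact
  have inv: "inv_into X f (f x) = x" if "x \<in> X" for x using inv_into_f_f[OF inj that] .
  have edge: "(inv_into X f p, inv_into X f q) \<in> F" if "(p, q) \<in> map_prod f f ` F" for p q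
    using that moves_subset inv by auto
  show ?thesis
  proof
    show "\<exists>q. (p, q) \<in> map_prod f f ` F" if "p \<in> f ` X" for p
      using that moves_total by (metis imageE map_prod_imageI)
    show "\<exists>q. (p, q) \<in> map_prod f f ` F \<and> (pos \<circ> inv_into X f) q = v"
      if p: "p \<in> f ` X" "(pos \<circ> inv_into X f) p \<in> V2" "((pos \<circ> inv_into X f) p, v) \<in> E" for p v
    proof -
      obtain x where x: "x \<in> X" "p = f x" using p(1) by blast
      then obtain y where "(x, y) \<in> F" "pos y = v" using moves_cover[of x v] p inv by auto
      then show ?thesis using x inv moves_subset by (intro exI[of _ "f y"]) auto
    qed
    show "good_cycle wt pr (map (pos \<circ> inv_into X f) ps)"
      if "walk (map_prod f f ` F) p ps p" "ps \<noteq> []" for p ps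
      using cycles_good[OF walk_map[OF that(1) edge]] that(2) by simp
  qed (use finite_states moves_subset moves_edges edge in auto)
qed

lemma player_winsI:
  fixes X :: "'m set"
  assumes "strategy_graph V2 wt pr E X F pos" and "x \<in> X"
  shows "player_wins V2 wt pr E (pos x)"
proof -
  have "finite X" using assms(1) by (rule strategy_graph.finite_states)
  then obtain f :: "'m \<Rightarrow> nat" where f: "inj_on f X" using finite_imp_inj_to_nat_seg by blast
  have "pos x \<in> (pos \<circ> inv_into X f) ` f ` X" using assms(2) f by (force simp: inv_into_f_f)
  then show ?thesis unfolding player_wins_def using strategy_graph_rename[OF assms(1) f] by blast
qed

lemma strategy_graph_mono:
  assumes "strategy_graph V2 wt pr E X F pos" and "E \<subseteq> E'"
    and "\<And>x v. x \<in> X \<Longrightarrow> pos x \<in> V2 \<Longrightarrow> (pos x, v) \<in> E' \<Longrightarrow> (pos x, v) \<in> E"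
  shows "strategy_graph V2 wt pr E' X F pos"
proof -
  interpret strategy_graph V2 wt pr E X F pos by fact
  show ?thesis
    by standard (use finite_states moves_subset moves_edges moves_total moves_cover cycles_good
        assms(2,3) in auto)
qed

lemma opponent_wins_mono:
  assumes "opponent_wins V2 wt pr V E s" and "E \<subseteq> E'"
    and "\<And>u v. (u, v) \<in> E' \<Longrightarrow> u \<notin> V2 \<Longrightarrow> (u, v) \<in> E"
  shows "opponent_wins V2 wt pr V E' s"
proof -
  obtain E0 where "spoiler_graph V2 wt pr V E s E0" using assms(1) by (auto simp: opponent_wins_def)
  then interpret spoiler_graph V2 wt pr V E s E0 .
  have "spoiler_graph V2 wt pr V E' s E0"
    by standard (use subset player_edges total cycles_bad assms(2,3) in auto)
  then show ?thesis by (auto simp: opponent_wins_def)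
qed

text \<open>If the opponent won from a position of the strategy graph, the two strategies would meet in a
  cycle that is both good and bad.\<close>

lemma strategy_graph_avoids_opponent_wins:
  assumes "strategy_graph V2 wt pr E X F pos" and E: "E \<subseteq> V \<times> V" and x: "x \<in> X"
  shows "\<not> opponent_wins V2 wt pr V E (pos x)"
proof
  assume "opponent_wins V2 wt pr V E (pos x)"
  then obtain E' where "spoiler_graph V2 wt pr V E (pos x) E'" by (auto simp: opponent_wins_def)
  then interpret spoiler_graph V2 wt pr V E "pos x" E' .
  interpret strategy_graph V2 wt pr E X F pos by fact
  define F' where "F' = {(y, z) \<in> F. (pos y, pos z) \<in> E'}"
  have "\<exists>z\<in>X. (y, z) \<in> F'" if y: "y \<in> X" for y
  proof (cases "pos y \<in> V2")
    case False
    then show ?thesis using moves_total[OF y] moves_edges moves_subset player_edges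
      by (force simp: F'_def)
  next
    case True
    have "pos y \<in> V" using moves_total[OF y] moves_edges E by blast
    then obtain v where v: "(pos y, v) \<in> E'" using total by blast
    then obtain z where "(y, z) \<in> F" "pos z = v" using moves_cover[OF y True] subset by blast
    then show ?thesis using v moves_subset by (auto simp: F'_def)
  qed
  then obtain y xs where y: "(x, y) \<in> F'\<^sup>*" and xs: "walk F' y xs y" "xs \<noteq> []"
    using finite_graph_reaches_cycle[OF finite_states _ x] by metis
  have edges: "(pos p, pos q) \<in> E'" "(p, q) \<in> F" if "(p, q) \<in> F'" for p q
    using that by (auto simp: F'_def)
  have "walk F y xs y" using xs(1) by (rule walk_mono) (use edges(2) in auto)
  then have "good_cycle wt pr (map pos xs)" using xs(2) by (rule cycles_good)
  moreover obtain ys where "walk F' x ys y" using y by (rule rtrancl_imp_walk)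
  then have "(pos x, pos y) \<in> E'\<^sup>*" using walk_imp_rtrancl[OF walk_map] edges(1) by metis
  moreover have "walk E' (pos y) (map pos xs) (pos y)" using walk_map[OF xs(1)] edges(1) by metis
  ultimately show False using cycles_bad xs(2) by blast
qed

lemma player_wins_avoiding_opponent_wins:
  assumes "player_wins V2 wt pr E s" "opponent_wins V2 wt pr V E v"
    and "E \<subseteq> V \<times> V" "E \<subseteq> E'" "\<And>u z. (u, z) \<in> E' \<Longrightarrow> u \<noteq> v \<Longrightarrow> (u, z) \<in> E"
  shows "player_wins V2 wt pr E' s"
proof -
  obtain X :: "nat set" and F pos x where S: "strategy_graph V2 wt pr E X F pos"
    and x: "x \<in> X" "pos x = s" using assms(1) by (auto simp: player_wins_def)
  have "pos y \<noteq> v" if "y \<in> X" for y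
    using strategy_graph_avoids_opponent_wins[OF S assms(3) that] assms(2) by blast
  then have "strategy_graph V2 wt pr E' X F pos"
    using assms(5) by (intro strategy_graph_mono[OF S assms(4)]) blast
  from player_winsI[OF this x(1)] show ?thesis by (simp only: x(2))
qed

lemma sum_list_shuffles:
  fixes f :: "'a \<Rightarrow> 'b :: comm_monoid_add"
  assumes "zs \<in> shuffles xs ys"
  shows "sum_list (map f zs) = sum_list (map f xs) + sum_list (map f ys)"
  using arg_cong[OF mset_shuffles[OF assms], of "\<lambda>M. \<Sum>x\<in>#M. f x"]
  by (simp flip: sum_mset_sum_list)

lemma good_cycle_shuffles:
  assumes zs: "zs \<in> shuffles xs ys" "zs \<noteq> []"
    and xs: "xs \<noteq> [] \<Longrightarrow> good_cycle wt pr xs" and ys: "ys \<noteq> [] \<Longrightarrow> good_cycle wt pr ys"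
  shows "good_cycle wt pr zs"
proof (cases "xs = [] \<or> ys = []")
  case True
  then show ?thesis using assms by auto
next
  case False
  then have "Min (pr ` set zs) = min (Min (pr ` set xs)) (Min (pr ` set ys))"
    by (simp add: set_shuffles[OF zs(1)] image_Un Min_Un)
  then show ?thesis
    using False xs ys by (auto simp: good_cycle_def sum_list_shuffles[OF zs(1)] min_def)
qed

text \<open>Two strategies, one for the game without the edge \<open>(v, a)\<close> and one for the game in which this
  is the only edge from \<open>v\<close>, are played alternately, each remembering where it was interrupted:
  whenever the opponent moves at \<open>v\<close>, the chosen edge tells which of them continues.\<close>

locale strategy_shuffle =
  left: strategy_graph V2 wt pr "E - {(v, a)}" X1 F1 pos1 +
  right: strategy_graph V2 wt pr "{(u, z) \<in> E. u = v \<longrightarrow> z = a}" X2 F2 pos2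
  for V2 :: "'v set" and wt pr E v a and X1 :: "'m set" and F1 pos1
    and X2 :: "'n set" and F2 pos2 +
  assumes v: "v \<in> V2"
begin

definition states :: "('m \<times> 'n) set" where
  "states = {(x, y). x \<in> X1 \<and> y \<in> X2 \<and> (pos1 x = v \<or> pos2 y = v)}"

definition moves :: "(('m \<times> 'n) \<times> ('m \<times> 'n)) set" where
  "moves = {((x, y), (x', y)) |x x' y. (x, x') \<in> F1 \<and> y \<in> X2 \<and> pos2 y = v} \<union>
    {((x, y), (x, y')) |x y y'. (y, y') \<in> F2 \<and> x \<in> X1 \<and> pos1 x = v}"

definition pos :: "'m \<times> 'n \<Rightarrow> 'v" where
  "pos = (\<lambda>(x, y). if pos2 y = v then pos1 x else pos2 y)"

lemma pos_eq: "pos2 y = v \<Longrightarrow> pos (x, y) = pos1 x" "pos1 x = v \<Longrightarrow> pos (x, y) = pos2 y"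
  by (auto simp: pos_def)

lemma moves_cases:
  assumes "(p, q) \<in> moves"
  obtains (left) "(fst p, fst q) \<in> F1" "snd p = snd q" "pos p = pos1 (fst p)" "pos q = pos1 (fst q)"
    | (right) "(snd p, snd q) \<in> F2" "fst p = fst q" "pos p = pos2 (snd p)" "pos q = pos2 (snd q)"
  using assms by (auto simp: moves_def pos_def)

lemma moves_subset: "moves \<subseteq> states \<times> states"
  using left.moves_subset right.moves_subset by (auto simp: moves_def states_def)

lemma moves_edges: "(p, q) \<in> moves \<Longrightarrow> (pos p, pos q) \<in> E"
  by (erule moves_cases) (auto dest!: left.moves_edges right.moves_edges)

lemma moves_total:
  assumes "p \<in> states"
  shows "\<exists>q. (p, q) \<in> moves"
proof -
  obtain x y where p: "p = (x, y)" "x \<in> X1" "y \<in> X2" "pos1 x = v \<or> pos2 y = v"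
    using assms by (auto simp: states_def)
  obtain x' y' where "(x, x') \<in> F1" "(y, y') \<in> F2"
    using p(2,3) left.moves_total right.moves_total by metis
  then show ?thesis using p by (auto simp: moves_def)
qed

lemma moves_cover:
  assumes "p \<in> states" and "pos p \<in> V2" and "(pos p, u) \<in> E"
  shows "\<exists>q. (p, q) \<in> moves \<and> pos q = u"
proof -
  obtain x y where p: "p = (x, y)" "x \<in> X1" "y \<in> X2" "pos1 x = v \<or> pos2 y = v"
    using assms(1) by (auto simp: states_def)
  consider (left) "pos2 y = v" "(pos1 x, u) \<noteq> (v, a)"
    | (right) "pos1 x = v" "pos2 y = v \<longrightarrow> u = a"
    using p(4) by blast
  then show ?thesis
  proof cases
    case left
    then obtain x' where "(x, x') \<in> F1" "pos1 x' = u"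
      using left.moves_cover[of x u] assms(2,3) p by (auto simp: pos_eq)
    then show ?thesis using left p by (intro exI[of _ "(x', y)"]) (auto simp: moves_def pos_eq)
  next
    case right
    then obtain y' where "(y, y') \<in> F2" "pos2 y' = u"
      using right.moves_cover[of y u] assms(2,3) p by (auto simp: pos_eq)
    then show ?thesis using right p by (intro exI[of _ "(x, y')"]) (auto simp: moves_def pos_eq)
  qed
qed

lemma walk_is_shuffle:
  assumes "walk moves p ps q"
  obtains xs ys where "walk F1 (fst p) xs (fst q)" "walk F2 (snd p) ys (snd q)"
    "map pos ps \<in> shuffles (map pos1 xs) (map pos2 ys)"
  using assms
proof (induction arbitrary: thesis rule: walk.induct)
  case (walk_Nil p)
  show ?case by (rule walk_Nil[of "[]" "[]"]) simp_all
next
  case (walk_Cons p p' ps q)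
  obtain xs ys where walks: "walk F1 (fst p') xs (fst q)" "walk F2 (snd p') ys (snd q)"
    and shuffle: "map pos ps \<in> shuffles (map pos1 xs) (map pos2 ys)" by (rule walk_Cons.IH)
  from walk_Cons.hyps(1) show ?case
  proof (cases rule: moves_cases)
    case left
    then show ?thesis using walks shuffle
      by (intro walk_Cons.prems[of "fst p # xs" ys]) (auto intro: Cons_in_shuffles_leftI)
  next
    case right
    then show ?thesis using walks shuffle
      by (intro walk_Cons.prems[of xs "snd p # ys"]) (auto intro: Cons_in_shuffles_rightI)
  qed
qed

lemma cycles_good:
  assumes "walk moves p ps p" and "ps \<noteq> []"
  shows "good_cycle wt pr (map pos ps)"
proof -
  obtain xs ys where walks: "walk F1 (fst p) xs (fst p)" "walk F2 (snd p) ys (snd p)"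
    and shuffle: "map pos ps \<in> shuffles (map pos1 xs) (map pos2 ys)"
    using assms(1) by (rule walk_is_shuffle)
  show ?thesis
    by (rule good_cycle_shuffles[OF shuffle])
      (use assms(2) left.cycles_good[OF walks(1)] right.cycles_good[OF walks(2)] in auto)
qed

lemma strategy_graph: "strategy_graph V2 wt pr E states moves pos"
proof
  show "finite states"
    by (rule finite_subset[of _ "X1 \<times> X2"])
      (auto simp: states_def left.finite_states right.finite_states)
qed (fact moves_subset moves_edges moves_total moves_cover cycles_good)+

end

lemma player_wins_shuffle:
  assumes v: "v \<in> V2"
    and left: "player_wins V2 wt pr (E - {(v, a)}) s"
    and right: "player_wins V2 wt pr {(u, z) \<in> E. u = v \<longrightarrow> z = a} v"
  shows "player_wins V2 wt pr E s"
proof -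
  obtain X1 :: "nat set" and F1 pos1 x where
    S1: "strategy_graph V2 wt pr (E - {(v, a)}) X1 F1 pos1" "x \<in> X1" "pos1 x = s"
    using left by (auto simp: player_wins_def)
  obtain X2 :: "nat set" and F2 pos2 y where
    S2: "strategy_graph V2 wt pr {(u, z) \<in> E. u = v \<longrightarrow> z = a} X2 F2 pos2" "y \<in> X2" "pos2 y = v"
    using right by (auto simp: player_wins_def)
  interpret strategy_shuffle V2 wt pr E v a X1 F1 pos1 X2 F2 pos2
    by (intro strategy_shuffle.intro strategy_shuffle_axioms.intro S1 S2 v)
  have "(x, y) \<in> states" "pos (x, y) = s" using S1 S2 by (auto simp: states_def pos_eq)
  then show ?thesis using player_winsI[OF strategy_graph] by metis
qed

definition cyclic_graph :: "nat \<Rightarrow> (nat \<times> nat) set" where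
  "cyclic_graph n = {(i, Suc i mod n) |i. i < n}"

lemma closed_walk_successor:
  assumes "walk E x xs x" and "y \<in> set xs"
  shows "\<exists>z\<in>set xs. (y, z) \<in> E"
proof -
  obtain as bs where xs: "xs = as @ y # bs" using assms(2) by (meson split_list)
  then have "walk E y (y # bs @ as) y" using assms(1) walk_rotate by metis
  then obtain z where z: "(y, z) \<in> E" "walk E z (bs @ as) y" by auto
  then have "z \<in> set (y # bs @ as)" using walk_start_in_set[OF z(2)] by (cases "bs @ as") auto
  then show ?thesis using z(1) by (auto simp: xs)
qed

lemma closed_walk_cyclic_graph_set:
  assumes w: "walk (cyclic_graph n) i xs i" and "xs \<noteq> []"
  shows "set xs = {..<n}"
proof
  show "set xs \<subseteq> {..<n}" using walk_subset_Domain[OF w] by (auto simp: cyclic_graph_def)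
  have i: "i \<in> set xs" using w \<open>xs \<noteq> []\<close> by (rule walk_start_in_set)
  then have "i < n" using \<open>set xs \<subseteq> {..<n}\<close> by auto
  have "(i + d) mod n \<in> set xs" for d
  proof (induction d)
    case (Suc d)
    then show ?case using closed_walk_successor[OF w Suc]
      by (auto simp: cyclic_graph_def mod_Suc_eq)
  qed (simp add: i \<open>i < n\<close>)
  then have "j \<in> set xs" if "j < n" for j
    using that \<open>i < n\<close>
    by (metis add.assoc add.commute le_add_diff_inverse2 less_imp_le mod_add_self2 mod_less)
  then show "{..<n} \<subseteq> set xs" by blast
qed

lemma walk_cyclic_graph_sum:
  fixes f :: "nat \<Rightarrow> int"
  assumes "walk (cyclic_graph n) i xs j" and nonneg: "0 \<le> (\<Sum>k<n. f k)"
  shows "(\<Sum>k<j. f k) \<le> (\<Sum>k<i. f k) + sum_list (map f xs)"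
  using assms(1)
proof (induction rule: walk.induct)
  case (walk_Cons i j xs l)
  have "(\<Sum>k<j. f k) \<le> (\<Sum>k<Suc i. f k)"
    using walk_Cons.hyps(1) nonneg by (auto simp: cyclic_graph_def mod_Suc)
  then show ?case using walk_Cons.IH by simp
qed simp

lemma player_wins_cycle:
  assumes forced: "\<And>u a b. u \<in> V2 \<Longrightarrow> (u, a) \<in> E \<Longrightarrow> (u, b) \<in> E \<Longrightarrow> a = b"
    and w: "walk E x cs x" and ne: "cs \<noteq> []" and good: "good_cycle wt pr cs"
  shows "player_wins V2 wt pr E x"
proof -
  let ?n = "length cs"
  have edge: "(cs ! i, cs ! (Suc i mod ?n)) \<in> E" if "i < ?n" for i
    using infinite_pathD[OF infinite_path_iter(1)[OF w ne], of i] that ne by simp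
  have "strategy_graph V2 wt pr E {..<?n} (cyclic_graph ?n) ((!) cs)"
  proof
    show "\<exists>j. (i, j) \<in> cyclic_graph ?n \<and> cs ! j = v"
      if "i \<in> {..<?n}" "cs ! i \<in> V2" "(cs ! i, v) \<in> E" for i v
    proof (intro exI conjI)
      show "(i, Suc i mod ?n) \<in> cyclic_graph ?n" using that(1) by (auto simp: cyclic_graph_def)
      show "cs ! (Suc i mod ?n) = v" using that(1) by (intro forced[OF that(2) edge that(3)]) simp
    qed
    show "good_cycle wt pr (map ((!) cs) js)"
      if "walk (cyclic_graph ?n) i js i" "js \<noteq> []" for i js
    proof -
      have "set (map ((!) cs) js) = set cs"
        using closed_walk_cyclic_graph_set[OF that] nth_image[of ?n cs]
        by (simp add: atLeast0LessThan)
      moreover have "sum_list (map wt cs) = (\<Sum>i<?n. wt (cs ! i))"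
        by (simp add: sum_list_sum_nth atLeast0LessThan)
      then have "0 \<le> sum_list (map (\<lambda>i. wt (cs ! i)) js)"
        using walk_cyclic_graph_sum[OF that(1)] good by (simp add: good_cycle_def)
      ultimately show ?thesis using good by (simp add: good_cycle_def comp_def)
    qed
  qed (use edge ne in \<open>auto simp: cyclic_graph_def\<close>)
  moreover have "cs ! 0 = x" using w ne by (cases cs) auto
  ultimately show ?thesis using player_winsI[of V2 wt pr E _ _ "(!) cs" 0] ne by simp
qed

lemma closed_walk_subset_Range:
  assumes "walk E x xs x"
  shows "set xs \<subseteq> Range E"
proof -
  have "set ys \<subseteq> insert y (Range E)" if "walk E y ys z" for y ys z
    using that by (induction rule: walk.induct) auto
  moreover have "xs \<noteq> [] \<Longrightarrow> x \<in> Range E"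
    using walk_nth_edge[OF assms, of "length xs - 1"] by (auto simp: nth_append)
  ultimately show ?thesis using assms by fastforce
qed

lemma player_wins_predecessor:
  assumes "player_wins V2 wt pr E v" and uv: "(u, v) \<in> E"
    and forced: "\<And>b. u \<in> V2 \<Longrightarrow> (u, b) \<in> E \<Longrightarrow> b = v"
  shows "player_wins V2 wt pr E u"
proof -
  obtain X :: "nat set" and F pos x where S: "strategy_graph V2 wt pr E X F pos"
    and x: "x \<in> X" "pos x = v" using assms(1) unfolding player_wins_def by blast
  interpret strategy_graph V2 wt pr E X F pos by (rule S)
  let ?X = "insert None (Some ` X)" and ?F = "insert (None, Some x) (map_prod Some Some ` F)"
    and ?pos = "case_option u pos"
  have "strategy_graph V2 wt pr E ?X ?F ?pos"
  proof
    show "\<exists>q. (p, q) \<in> ?F" if p: "p \<in> ?X" for p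
    proof (cases p)
      case (Some y)
      then obtain z where "(y, z) \<in> F" using p moves_total by blast
      then show ?thesis using Some by force
    qed auto
    show "\<exists>q. (p, q) \<in> ?F \<and> ?pos q = b" if p: "p \<in> ?X" "?pos p \<in> V2" "(?pos p, b) \<in> E" for p b
    proof (cases p)
      case None
      then show ?thesis using p x forced by (intro exI[of _ "Some x"]) auto
    next
      case (Some y)
      then obtain z where "(y, z) \<in> F" "pos z = b" using p moves_cover[of y b] by auto
      then show ?thesis using Some by (intro exI[of _ "Some z"]) auto
    qed
    show "good_cycle wt pr (map ?pos ps)" if "walk ?F p ps p" "ps \<noteq> []" for p ps
    proof -
      have "None \<notin> set ps" using closed_walk_subset_Range[OF that(1)] by auto
      then have "walk F (the p) (map the ps) (the p)" by (intro walk_map[OF that(1)]) auto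
      then have "good_cycle wt pr (map pos (map the ps))"
        using that(2) by (intro cycles_good) simp_all
      moreover have "map ?pos ps = map pos (map the ps)"
        using \<open>None \<notin> set ps\<close> by (auto split: option.split)
      ultimately show ?thesis by (simp only:)
    qed
  qed (use finite_states moves_subset moves_edges x uv in auto)
  from player_winsI[OF this, of None] show ?thesis by simp
qed

lemma player_wins_reaches_cycle:
  assumes forced: "\<And>u a b. u \<in> V2 \<Longrightarrow> (u, a) \<in> E \<Longrightarrow> (u, b) \<in> E \<Longrightarrow> a = b"
    and "(s, x) \<in> E\<^sup>*" and "walk E x cs x" "cs \<noteq> []" "good_cycle wt pr cs"
  shows "player_wins V2 wt pr E s"
  using assms(2)
proof (induction rule: converse_rtrancl_induct)
  case base
  show ?case by (rule player_wins_cycle[OF forced assms(3-5)])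
next
  case (step u v)
  show ?case by (rule player_wins_predecessor[OF step.IH step.hyps(1)]) (use forced step in blast)
qed

lemma player_wins_or_opponent_wins_forced:
  assumes "\<And>u a b. u \<in> V2 \<Longrightarrow> (u, a) \<in> E \<Longrightarrow> (u, b) \<in> E \<Longrightarrow> a = b"
    and total: "\<And>u. u \<in> V \<Longrightarrow> \<exists>v. (u, v) \<in> E"
  shows "player_wins V2 wt pr E s \<or> opponent_wins V2 wt pr V E s"
proof (cases "\<exists>x cs. (s, x) \<in> E\<^sup>* \<and> walk E x cs x \<and> cs \<noteq> [] \<and> good_cycle wt pr cs")
  case True
  then show ?thesis using player_wins_reaches_cycle[of V2 E] assms(1) by metis
next
  case False
  then have "spoiler_graph V2 wt pr V E s E" using total by unfold_locales auto
  then show ?thesis by (auto simp: opponent_wins_def)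
qed

lemma player_wins_edge_split:
  assumes v: "v \<in> V2" and E: "E \<subseteq> V \<times> V"
    and left: "player_wins V2 wt pr (E - {(v, a)}) s"
    and right: "player_wins V2 wt pr {(u, z) \<in> E. u = v \<longrightarrow> z = a} s"
    and determined: "player_wins V2 wt pr {(u, z) \<in> E. u = v \<longrightarrow> z = a} v \<or>
      opponent_wins V2 wt pr V {(u, z) \<in> E. u = v \<longrightarrow> z = a} v"
  shows "player_wins V2 wt pr E s"
  using determined
proof
  assume "player_wins V2 wt pr {(u, z) \<in> E. u = v \<longrightarrow> z = a} v"
  with v left show ?thesis by (rule player_wins_shuffle)
next
  assume "opponent_wins V2 wt pr V {(u, z) \<in> E. u = v \<longrightarrow> z = a} v"
  with right show ?thesis by (rule player_wins_avoiding_opponent_wins) (use E in auto)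
qed

text \<open>Induction on the number of edges: at an opponent's position with a choice, either the edge
  \<open>(v, a)\<close> or all others can be discarded, or the two subgames are combined by shuffling.\<close>

theorem player_wins_or_opponent_wins:
  assumes "finite V" "E \<subseteq> V \<times> V" "\<And>u. u \<in> V \<Longrightarrow> \<exists>v. (u, v) \<in> E" "s \<in> V"
  shows "player_wins V2 wt pr E s \<or> opponent_wins V2 wt pr V E s"
  using assms
proof (induction "card E" arbitrary: E s rule: less_induct)
  case less
  show ?case
  proof (cases "\<exists>v\<in>V2. \<exists>a b. (v, a) \<in> E \<and> (v, b) \<in> E \<and> a \<noteq> b")
    case False
    then show ?thesis by (intro player_wins_or_opponent_wins_forced less.prems(3)) blast+
  next
    case True
    then obtain v a b where v: "v \<in> V2" "(v, a) \<in> E" "(v, b) \<in> E" "a \<noteq> b" by blast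
    then have "v \<in> V" using less.prems(2) by blast
    define E1 where "E1 = E - {(v, a)}"
    define E2 where "E2 = {(u, z) \<in> E. u = v \<longrightarrow> z = a}"
    have sub: "E1 \<subset> E" "E2 \<subset> E" using v by (auto simp: E1_def E2_def)
    have total: "\<exists>z. (u, z) \<in> E1" "\<exists>z. (u, z) \<in> E2" if "u \<in> V" for u
      using less.prems(3)[OF that] v by (cases "u = v"; auto simp: E1_def E2_def)+
    have IH: "player_wins V2 wt pr K u \<or> opponent_wins V2 wt pr V K u"
      if "K \<subset> E" "\<And>u. u \<in> V \<Longrightarrow> \<exists>z. (u, z) \<in> K" "u \<in> V" for K u
    proof (rule less.hyps)
      have "finite E" using less.prems(1,2) by (meson finite_SigmaI finite_subset)
      then show "card K < card E" using that(1) by (rule psubset_card_mono)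
    qed (use that less.prems in auto)
    have lift: "opponent_wins V2 wt pr V E s" if "opponent_wins V2 wt pr V K s" "K \<in> {E1, E2}" for K
      using that v(1) by (intro opponent_wins_mono[OF that(1)]) (auto simp: E1_def E2_def)
    have "player_wins V2 wt pr E s"
      if "player_wins V2 wt pr E1 s" "player_wins V2 wt pr E2 s"
      using v(1) less.prems(2) that IH[OF sub(2) total(2) \<open>v \<in> V\<close>] unfolding E1_def E2_def
      by (rule player_wins_edge_split)
    then show ?thesis
      using lift IH[OF sub(1) total(1)] IH[OF sub(2) total(2)] less.prems(4) by blast
  qed
qed

section \<open>Tableaux for LTL\<close>

definition ltl_tag :: "nat \<Rightarrow> nat" where "ltl_tag n = fst (prod_decode n)"
definition ltl_arg :: "nat \<Rightarrow> nat" where "ltl_arg n = snd (prod_decode n)"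
definition ltl_left :: "nat \<Rightarrow> nat" where "ltl_left n = fst (prod_decode (ltl_arg n))"
definition ltl_right :: "nat \<Rightarrow> nat" where "ltl_right n = snd (prod_decode (ltl_arg n))"

lemma less_prod_encode: "0 < a \<Longrightarrow> b < prod_encode (a, b)"
  using le_prod_encode_2[of "a + b" 0] by (simp add: prod_encode_def)

lemma ltl_arg_less: "ltl_tag n \<noteq> 0 \<Longrightarrow> ltl_arg n < n"
  using less_prod_encode[of "ltl_tag n" "ltl_arg n"] by (simp add: ltl_tag_def ltl_arg_def)

lemma ltl_left_less: "ltl_tag n \<noteq> 0 \<Longrightarrow> ltl_left n < n"
  and ltl_right_less: "ltl_tag n \<noteq> 0 \<Longrightarrow> ltl_right n < n"
  using ltl_arg_less[of n] le_prod_encode_1[of "ltl_left n" "ltl_right n"]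
    le_prod_encode_2[of "ltl_right n" "ltl_left n"]
  by (simp_all add: ltl_left_def ltl_right_def)

function decode_ltl :: "nat \<Rightarrow> nat ltl" where
  "decode_ltl n =
    (if ltl_tag n = 1 then LAtom (ltl_arg n)
     else if ltl_tag n = 2 then LNot (decode_ltl (ltl_arg n))
     else if ltl_tag n = 3 then LOr (decode_ltl (ltl_left n)) (decode_ltl (ltl_right n))
     else if ltl_tag n = 4 then LNext (decode_ltl (ltl_arg n))
     else if ltl_tag n = 5 then LUntil (decode_ltl (ltl_left n)) (decode_ltl (ltl_right n))
     else LTrue)"
  by auto
termination
  by (relation "measure id") (auto intro: ltl_arg_less ltl_left_less ltl_right_less)

declare decode_ltl.simps [simp del]

lemma decode_encode_ltl: "decode_ltl (encode_ltl \<phi>) = \<phi>"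
  by (induction \<phi>)
    (subst decode_ltl.simps, simp add: ltl_tag_def ltl_arg_def ltl_left_def ltl_right_def)+

lemma ltl_tag_cases:
  obtains (Atom) "ltl_tag n = 1" | (Not) "ltl_tag n = 2" | (Or) "ltl_tag n = 3"
    | (Next) "ltl_tag n = 4" | (Until) "ltl_tag n = 5" | (True) "ltl_tag n \<notin> {1, 2, 3, 4, 5}"
  by blast

definition truth :: "nat set word \<Rightarrow> nat \<Rightarrow> nat \<Rightarrow> bool" where
  "truth u i n \<longleftrightarrow> holds_at u i (decode_ltl n)"

definition true_codes :: "nat \<Rightarrow> nat set word \<Rightarrow> nat \<Rightarrow> nat set" where
  "true_codes N u i = {n. n \<le> N \<and> truth u i n}"

lemma true_codes_subset: "true_codes N u i \<subseteq> {..N}"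
  by (auto simp: true_codes_def)

text \<open>The set \<open>A\<close> guesses which formula codes hold at a position with letter \<open>x\<close>, and \<open>A'\<close> does so
  for the next position. Codes that denote no formula behave like \<open>LTrue\<close>.\<close>

definition local_condition :: "nat \<Rightarrow> nat set \<Rightarrow> nat set \<Rightarrow> nat set \<Rightarrow> bool" where
  "local_condition n A x A' \<longleftrightarrow>
    (if ltl_tag n = 1 then ltl_arg n \<in> x
     else if ltl_tag n = 2 then ltl_arg n \<notin> A
     else if ltl_tag n = 3 then ltl_left n \<in> A \<or> ltl_right n \<in> A
     else if ltl_tag n = 4 then ltl_arg n \<in> A'
     else if ltl_tag n = 5 then ltl_right n \<in> A \<or> ltl_left n \<in> A \<and> n \<in> A'
     else True)"

definition tableau_step :: "nat \<Rightarrow> nat set \<Rightarrow> nat set \<Rightarrow> nat set \<Rightarrow> bool" where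
  "tableau_step N A x A' \<longleftrightarrow> (\<forall>n\<le>N. n \<in> A \<longleftrightarrow> local_condition n A x A')"

definition fulfilled :: "nat \<Rightarrow> nat set \<Rightarrow> nat set" where
  "fulfilled N A = {n. n \<le> N \<and> (ltl_tag n = 5 \<longrightarrow> n \<notin> A \<or> ltl_right n \<in> A)}"

lemma fulfilled_subset: "fulfilled N A \<subseteq> {..N}"
  by (auto simp: fulfilled_def)

lemma until_unfold:
  "(\<exists>j\<ge>i. Q j \<and> (\<forall>k. i \<le> k \<and> k < j \<longrightarrow> P k)) \<longleftrightarrow>
   Q i \<or> P i \<and> (\<exists>j\<ge>Suc i. Q j \<and> (\<forall>k. Suc i \<le> k \<and> k < j \<longrightarrow> P k))" (is "?L \<longleftrightarrow> ?R")
proof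
  assume ?L
  then obtain j where j: "j \<ge> i" "Q j" "\<forall>k. i \<le> k \<and> k < j \<longrightarrow> P k" by blast
  show ?R
  proof (cases "j = i")
    case False
    then have "Suc i \<le> j" "P i" using j by auto
    then show ?thesis using j by auto
  qed (use j in simp)
next
  assume ?R
  then show ?L
  proof
    assume "P i \<and> (\<exists>j\<ge>Suc i. Q j \<and> (\<forall>k. Suc i \<le> k \<and> k < j \<longrightarrow> P k))"
    then obtain j where j: "P i" "j \<ge> Suc i" "Q j" "\<forall>k. Suc i \<le> k \<and> k < j \<longrightarrow> P k" by blast
    have "P k" if "i \<le> k" "k < j" for k using j that by (cases "k = i") auto
    then show ?L using j by (intro exI[of _ j]) auto
  qed auto
qed

lemma fair_unfolding_imp_until:
  assumes unfold: "\<And>i. X i \<longleftrightarrow> Q i \<or> P i \<and> X (Suc i)" and fair: "\<And>i. \<exists>j\<ge>i. \<not> X j \<or> Q j"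
  shows "X i \<longleftrightarrow> (\<exists>j\<ge>i. Q j \<and> (\<forall>k. i \<le> k \<and> k < j \<longrightarrow> P k))" (is "_ \<longleftrightarrow> ?U i")
proof
  obtain j where j: "j \<ge> i" "\<not> X j \<or> Q j" using fair by blast
  assume "X i"
  with j(1) show "?U i"
  proof (induction rule: inc_induct)
    case base
    then show ?case using j(2) by (intro exI[of _ j]) auto
  next
    case (step m)
    then show ?case using unfold[of m] until_unfold[of m Q P] by blast
  qed
next
  assume "?U i"
  then obtain j where j: "j \<ge> i" "Q j" "\<forall>k. i \<le> k \<and> k < j \<longrightarrow> P k" by blast
  from j(1) show "X i"
  proof (induction rule: inc_induct)
    case base
    show ?case using unfold[of j] j(2) by blast
  next
    case (step m)
    then show ?case using unfold[of m] j(3) by blast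
  qed
qed

lemma truth_until:
  assumes "ltl_tag n = 5"
  shows "truth u i n \<longleftrightarrow>
    (\<exists>j\<ge>i. truth u j (ltl_right n) \<and> (\<forall>k. i \<le> k \<and> k < j \<longrightarrow> truth u k (ltl_left n)))"
  using assms by (simp add: truth_def decode_ltl.simps[of n])

lemma true_codes_tableau_step: "tableau_step N (true_codes N u i) (u i) (true_codes N u (Suc i))"
  unfolding tableau_step_def
proof (intro allI impI)
  fix n assume n: "n \<le> N"
  have le: "ltl_tag n \<noteq> 0 \<Longrightarrow> ltl_arg n \<le> N \<and> ltl_left n \<le> N \<and> ltl_right n \<le> N"
    using n ltl_arg_less ltl_left_less ltl_right_less by (meson less_imp_le order_trans)
  show "n \<in> true_codes N u i \<longleftrightarrow>
    local_condition n (true_codes N u i) (u i) (true_codes N u (Suc i))"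
  proof (cases rule: ltl_tag_cases[of n])
    case Until
    have "truth u i n \<longleftrightarrow> truth u i (ltl_right n) \<or> truth u i (ltl_left n) \<and> truth u (Suc i) n"
      unfolding truth_until[OF Until] by (rule until_unfold)
    then show ?thesis using Until le n by (simp add: local_condition_def true_codes_def)
  qed (simp_all add: truth_def decode_ltl.simps[of n] local_condition_def true_codes_def le n)
qed

lemma true_codes_fair:
  assumes "n \<le> N"
  shows "\<exists>\<^sub>\<infinity>j. n \<in> fulfilled N (true_codes N u j)"
  unfolding INFM_nat_le
proof
  fix i
  show "\<exists>j\<ge>i. n \<in> fulfilled N (true_codes N u j)"
  proof (cases "ltl_tag n = 5 \<and> truth u i n")
    case True
    then obtain j where "j \<ge> i" "truth u j (ltl_right n)" using truth_until by blast
    moreover have "ltl_right n \<le> N" using True ltl_right_less[of n] assms by simp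
    ultimately show ?thesis
      using assms by (intro exI[of _ j]) (auto simp: fulfilled_def true_codes_def)
  next
    case False
    then show ?thesis
      using assms by (intro exI[of _ i]) (auto simp: fulfilled_def true_codes_def)
  qed
qed

lemma fair_tableau_truth:
  assumes step: "\<And>i. tableau_step N (A i) (u i) (A (Suc i))"
    and fair: "\<And>n. n \<le> N \<Longrightarrow> \<exists>\<^sub>\<infinity>i. n \<in> fulfilled N (A i)"
    and "n \<le> N"
  shows "n \<in> A i \<longleftrightarrow> truth u i n"
  using assms(3)
proof (induction n arbitrary: i rule: less_induct)
  case (less n)
  have A: "n \<in> A i \<longleftrightarrow> local_condition n (A i) (u i) (A (Suc i))" for i
    using step less.prems by (simp add: tableau_step_def)
  have IH: "m \<in> A i \<longleftrightarrow> truth u i m" if "m < n" for m i using less that by simp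
  show ?case
  proof (cases rule: ltl_tag_cases[of n])
    case Until
    then have "n \<in> A i \<longleftrightarrow> ltl_right n \<in> A i \<or> ltl_left n \<in> A i \<and> n \<in> A (Suc i)" for i
      using A[of i] by (simp add: local_condition_def)
    moreover have "\<exists>j\<ge>i. n \<notin> A j \<or> ltl_right n \<in> A j" for i
    proof -
      obtain j where "j \<ge> i" "n \<in> fulfilled N (A j)"
        using fair[OF less.prems] unfolding INFM_nat_le by blast
      then show ?thesis using Until by (intro exI[of _ j]) (simp add: fulfilled_def)
    qed
    ultimately have "n \<in> A i \<longleftrightarrow>
        (\<exists>j\<ge>i. ltl_right n \<in> A j \<and> (\<forall>k. i \<le> k \<and> k < j \<longrightarrow> ltl_left n \<in> A k))"
      by (rule fair_unfolding_imp_until)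
    then show ?thesis using Until by (simp add: truth_until IH ltl_left_less ltl_right_less)
  qed (use A[of i] IH ltl_arg_less ltl_left_less ltl_right_less in
      \<open>simp_all add: truth_def decode_ltl.simps[of n] local_condition_def\<close>)
qed

text \<open>The index \<open>j\<close> cycles through the codes up to \<open>N\<close>, waiting at each of them until it is
  fulfilled; a round is completed infinitely often iff every code is fulfilled infinitely often.\<close>

definition next_index :: "nat \<Rightarrow> nat set \<Rightarrow> nat \<Rightarrow> nat" where
  "next_index N A j = (if j \<in> fulfilled N A then if j < N then Suc j else 0 else j)"

definition accepting :: "nat \<Rightarrow> nat set \<Rightarrow> nat \<Rightarrow> bool" where
  "accepting N A j \<longleftrightarrow> j = N \<and> N \<in> fulfilled N A"

lemma next_index_le: "j \<le> N \<Longrightarrow> next_index N A j \<le> N"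
  by (simp add: next_index_def)

lemma accepting_imp_fair:
  assumes j: "\<And>i. j (Suc i) = next_index N (A i) (j i)"
    and inf: "\<exists>\<^sub>\<infinity>i. accepting N (A i) (j i)" and n: "n \<le> N"
  shows "\<exists>\<^sub>\<infinity>i. n \<in> fulfilled N (A i)"
proof (rule ccontr)
  assume "\<not> ?thesis"
  then obtain i where never: "\<And>k. k \<ge> i \<Longrightarrow> n \<notin> fulfilled N (A k)" unfolding INFM_nat_le by blast
  obtain k where k: "k \<ge> i" "accepting N (A k) (j k)" using inf unfolding INFM_nat_le by blast
  have waits: "j l \<le> n" if "Suc k \<le> l" for l
    using that
  proof (induction rule: dec_induct)
    case base
    show ?case using k by (simp add: j next_index_def accepting_def)
  next
    case (step l)
    have "n \<notin> fulfilled N (A l)" using never step.hyps k(1) by simp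
    then show ?case
      using step.IH n by (cases "j l = n") (auto simp: j next_index_def)
  qed
  obtain l where l: "l \<ge> Suc k" "accepting N (A l) (j l)" using inf unfolding INFM_nat_le by blast
  then have "n = N" using waits[of l] n by (simp add: accepting_def)
  then show False using never[of l] l k(1) by (simp add: accepting_def)
qed

lemma fair_imp_accepting:
  assumes j: "\<And>i. j (Suc i) = next_index N (A i) (j i)" and j0: "j 0 \<le> N"
    and fair: "\<And>n. n \<le> N \<Longrightarrow> \<exists>\<^sub>\<infinity>i. n \<in> fulfilled N (A i)"
  shows "\<exists>\<^sub>\<infinity>i. accepting N (A i) (j i)"
proof (rule ccontr)
  assume "\<not> ?thesis"
  then obtain i where never: "\<And>k. k \<ge> i \<Longrightarrow> \<not> accepting N (A k) (j k)"
    unfolding INFM_nat_le by blast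
  have le: "j k \<le> N" for k by (induction k) (auto simp: j0 j next_index_le)
  have "N - j (Suc k) \<le> N - j k" if "k \<ge> i" for k
    using never[OF that] le[of k] by (auto simp: j next_index_def accepting_def)
  then obtain l where l: "l \<ge> i" "\<forall>k\<ge>l. N - j k = N - j l"
    using decreasing_nat_eventually_const[of i "\<lambda>k. N - j k"] by blast
  have const: "j k = j l" if "k \<ge> l" for k
    using l(2)[rule_format, OF that] le[of k] le[of l] by simp
  obtain k where k: "k \<ge> l" "j l \<in> fulfilled N (A k)" using fair le unfolding INFM_nat_le by blast
  then have "next_index N (A k) (j l) = j l" using const[of k] const[of "Suc k"] j[of k] by simp
  then have "accepting N (A k) (j k)"
    using k const[OF k(1)] le[of l] by (auto simp: next_index_def accepting_def split: if_splits)
  then show False using never[of k] k(1) l(1) by simp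
qed

definition tableau_run :: "nat \<Rightarrow> nat set list \<Rightarrow> nat set word \<Rightarrow> bool" where
  "tableau_run N x R \<longleftrightarrow> (\<forall>i\<le>length x. R i \<subseteq> {..N}) \<and>
     (\<forall>i<length x. tableau_step N (R i) (x ! i) (R (Suc i)))"

definition profile :: "nat \<Rightarrow> nat set list \<Rightarrow> (nat set \<times> nat set \<times> nat set) set" where
  "profile N x =
     {(R 0, R (length x), \<Union>i<length x. fulfilled N (R i)) |R. tableau_run N x R}"

lemma profile_iff:
  "(A, B, F) \<in> profile N x \<longleftrightarrow> (\<exists>R. tableau_run N x R \<and> R 0 = A \<and> R (length x) = B \<and>
     (\<Union>i<length x. fulfilled N (R i)) = F)"
  unfolding profile_def by blast

definition profile_step ::
  "nat \<Rightarrow> (nat set \<times> nat set \<times> nat set) set \<Rightarrow> nat set \<Rightarrow> (nat set \<times> nat set \<times> nat set) set" where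
  "profile_step N S a =
    {(A, B', F \<union> fulfilled N B) |A B B' F. (A, B, F) \<in> S \<and> tableau_step N B a B' \<and> B' \<subseteq> {..N}}"

lemma tableau_run_snoc:
  "tableau_run N (x @ [a]) R \<longleftrightarrow> tableau_run N x R \<and> R (Suc (length x)) \<subseteq> {..N} \<and>
     tableau_step N (R (length x)) a (R (Suc (length x)))"
  unfolding tableau_run_def by (auto simp: nth_append less_Suc_eq le_Suc_eq)

lemma profile_snoc: "profile N (x @ [a]) = profile_step N (profile N x) a"
proof (intro equalityI subsetI)
  fix P assume "P \<in> profile N (x @ [a])"
  then obtain R where "tableau_run N (x @ [a]) R"
    "P = (R 0, R (Suc (length x)), (\<Union>i<length x. fulfilled N (R i)) \<union> fulfilled N (R (length x)))"
    by (auto simp: profile_def lessThan_Suc Un_commute)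
  then show "P \<in> profile_step N (profile N x) a"
    unfolding profile_step_def profile_def tableau_run_snoc by blast
next
  fix P assume "P \<in> profile_step N (profile N x) a"
  then obtain R B where run: "tableau_run N x R" "tableau_step N (R (length x)) a B" "B \<subseteq> {..N}"
    and P: "P = (R 0, B, (\<Union>i<length x. fulfilled N (R i)) \<union> fulfilled N (R (length x)))"
    unfolding profile_step_def profile_def by blast
  let ?R = "R(Suc (length x) := B)"
  have "tableau_run N x ?R" using run(1) by (auto simp: tableau_run_def)
  then have "tableau_run N (x @ [a]) ?R" using run by (simp add: tableau_run_snoc)
  moreover have "P = (?R 0, ?R (length (x @ [a])), \<Union>i<length (x @ [a]). fulfilled N (?R i))"
    by (auto simp: P lessThan_Suc)
  ultimately show "P \<in> profile N (x @ [a])" unfolding profile_def by blast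
qed

lemma profile_subset: "profile N x \<subseteq> Pow {..N} \<times> Pow {..N} \<times> Pow {..N}"
proof
  fix P assume "P \<in> profile N x"
  then obtain R where "tableau_run N x R"
    and P: "P = (R 0, R (length x), \<Union>i<length x. fulfilled N (R i))" by (auto simp: profile_def)
  then have "R 0 \<subseteq> {..N}" "R (length x) \<subseteq> {..N}" by (simp_all add: tableau_run_def)
  moreover have "(\<Union>i<length x. fulfilled N (R i)) \<subseteq> {..N}" using fulfilled_subset by blast
  ultimately show "P \<in> Pow {..N} \<times> Pow {..N} \<times> Pow {..N}" unfolding P by blast
qed

lemma idx_sequence_ge: "idx_sequence t \<Longrightarrow> k \<le> t k"
  by (intro strict_mono_imp_increasing) (simp add: idx_sequence_def strict_mono_Suc_iff)

lemma glue_tableau_runs: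
  assumes t: "idx_sequence t"
    and run: "\<And>k. tableau_run N (subsequence u (t k) (t (Suc k))) (R k)"
    and joined: "\<And>k. R k (t (Suc k) - t k) = R (Suc k) 0"
  shows "\<exists>A. (\<forall>k d. d < t (Suc k) - t k \<longrightarrow> A (t k + d) = R k d) \<and>
    (\<forall>p. tableau_step N (A p) (u p) (A (Suc p)))"
proof -
  define A where "A = merge (\<lambda>k p. R k (p - t k)) t"
  have lt: "t k < t (Suc k)" for k using t by (simp add: idx_sequence_def)
  have A: "A (t k + d) = R k d" if "d < t (Suc k) - t k" for k d
  proof -
    have "t k + d \<in> {t k..<t (Suc k)}" using that by auto
    from merge[OF t this, of "\<lambda>k p. R k (p - t k)"] show ?thesis by (simp add: A_def)
  qed
  have A': "A (t k + d) = R k d" if "d \<le> t (Suc k) - t k" for k d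
  proof (cases "d = t (Suc k) - t k")
    case True
    then show ?thesis using A[of 0 "Suc k"] lt[of k] lt[of "Suc k"] joined by simp
  qed (use A that in simp)
  have "tableau_step N (A p) (u p) (A (Suc p))" for p
  proof -
    obtain k where k: "p \<in> {t k..<t (Suc k)}" using idx_sequence_interval[OF t] by blast
    define d where "d = p - t k"
    have d: "p = t k + d" "d < t (Suc k) - t k" using k by (auto simp: d_def)
    then have "tableau_step N (R k d) (u p) (R k (Suc d))"
      using run[of k] by (auto simp: tableau_run_def)
    then show ?thesis using A'[of d k] A'[of "Suc d" k] d by simp
  qed
  then show ?thesis using A by blast
qed

lemma true_codes_profile:
  assumes "i \<le> j"
  shows "(true_codes N u i, true_codes N u j, \<Union>d<j - i. fulfilled N (true_codes N u (i + d)))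
    \<in> profile N (subsequence u i j)"
proof -
  have "tableau_run N (subsequence u i j) (\<lambda>d. true_codes N u (i + d))"
    using true_codes_subset true_codes_tableau_step by (auto simp: tableau_run_def)
  then show ?thesis
    unfolding profile_iff using assms by (intro exI[of _ "\<lambda>d. true_codes N u (i + d)"]) simp
qed

lemma profile_saturates:
  assumes t: "idx_sequence t" and t': "idx_sequence t'"
    and profiles: "\<And>k. profile N (subsequence u (t k) (t (Suc k))) =
      profile N (subsequence u' (t' k) (t' (Suc k)))"
    and truth: "truth u 0 N"
  shows "truth u' 0 N"
proof -
  define T where "T = true_codes N u"
  define F where "F k = (\<Union>d<t (Suc k) - t k. fulfilled N (T (t k + d)))" for k
  have "(T (t k), T (t (Suc k)), F k) \<in> profile N (subsequence u' (t' k) (t' (Suc k)))" for k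
    using true_codes_profile[of "t k" "t (Suc k)" N u] t
    by (simp add: T_def F_def profiles idx_sequence_def less_imp_le)
  then obtain R where R: "\<And>k. tableau_run N (subsequence u' (t' k) (t' (Suc k))) (R k)"
    "\<And>k. R k 0 = T (t k)" "\<And>k. R k (t' (Suc k) - t' k) = T (t (Suc k))"
    "\<And>k. (\<Union>d<t' (Suc k) - t' k. fulfilled N (R k d)) = F k"
    unfolding profile_iff subsequence_length by metis
  have joined: "R k (t' (Suc k) - t' k) = R (Suc k) 0" for k by (simp add: R(2,3))
  obtain A where A: "\<And>k d. d < t' (Suc k) - t' k \<Longrightarrow> A (t' k + d) = R k d"
    and step: "\<And>p. tableau_step N (A p) (u' p) (A (Suc p))"
    using glue_tableau_runs[OF t' R(1) joined] by metis
  have fair: "\<exists>\<^sub>\<infinity>p. n \<in> fulfilled N (A p)" if n: "n \<le> N" for n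
    unfolding INFM_nat_le
  proof
    fix m
    obtain i where i: "t m \<le> i" "n \<in> fulfilled N (T i)"
      using true_codes_fair[OF n] unfolding INFM_nat_le T_def by blast
    obtain k where k: "t k \<le> i" "i < t (Suc k)" using idx_sequence_interval[OF t, of i] by auto
    have "n \<in> F k" unfolding F_def using i(2) k by (intro UN_I[of "i - t k"]) auto
    then obtain d where d: "d < t' (Suc k) - t' k" "n \<in> fulfilled N (R k d)"
      unfolding R(4)[symmetric] by blast
    have "m \<le> k" using idx_sequence_mono[OF t, of "Suc k" m] i(1) k(2) by linarith
    then have "m \<le> t' k + d" using idx_sequence_ge[OF t', of k] by simp
    then show "\<exists>p\<ge>m. n \<in> fulfilled N (A p)" using d A by metis
  qed
  have "0 < t' (Suc 0)" using t' unfolding idx_sequence_def by metis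
  then have "A 0 = T 0" using A[of 0 0] R(2)[of 0] t t' by (simp add: idx_sequence_def)
  moreover have "N \<in> T 0" using truth by (simp add: T_def true_codes_def)
  ultimately show ?thesis using fair_tableau_truth[OF step fair order_refl, of 0] by simp
qed

section \<open>Determinisation\<close>

primrec run :: "('q \<Rightarrow> 'a \<Rightarrow> 'q) \<Rightarrow> 'q \<Rightarrow> 'a word \<Rightarrow> 'q word" where
  "run \<delta> q u 0 = q"
| "run \<delta> q u (Suc n) = \<delta> (run \<delta> q u n) (u n)"

locale parity_automaton =
  fixes Q :: "'q set" and q0 :: 'q and \<delta> :: "'q \<Rightarrow> 'a \<Rightarrow> 'q" and prio :: "'q \<Rightarrow> 'a \<Rightarrow> nat"
    and B :: nat and L :: "'a word \<Rightarrow> bool"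
  assumes finite_states: "finite Q" and initial_state: "q0 \<in> Q"
    and step_state: "q \<in> Q \<Longrightarrow> \<delta> q a \<in> Q" and prio_le: "prio q a \<le> B"
    and language: "L u \<longleftrightarrow> even (Min (limit (\<lambda>n. prio (run \<delta> q0 u n) (u n))))"

lemma Min_limit_eq:
  fixes c :: "nat word"
  assumes fin: "finite (range c)" and freq: "\<exists>\<^sub>\<infinity>n. c n = m" and ge: "\<And>n. i \<le> n \<Longrightarrow> m \<le> c n"
  shows "Min (limit c) = m"
proof (rule Min_eqI)
  show "finite (limit c)" using fin limit_in_range by (rule finite_subset[rotated])
  show "m \<in> limit c" using freq by (simp add: limit_iff_frequent)
  fix l assume "l \<in> limit c"
  then obtain n where "i \<le> n" "c n = l" unfolding limit_iff_frequent INFM_nat_le by blast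
  then show "m \<le> l" using ge by blast
qed

text \<open>Two positions of a word merge once the words read since then are congruent. Merging is
  permanent, so at each time there are finitely many leaders, namely the least positive positions of
  the merging classes. The oldest leader that absorbs others infinitely often gives a factorisation
  \<open>a s s s \<dots>\<close> of the word up to congruence.\<close>

locale finite_right_congruence =
  fixes h :: "'a list \<Rightarrow> 'c" and step :: "'c \<Rightarrow> 'a \<Rightarrow> 'c"
  assumes h_snoc: "h (x @ [a]) = step (h x) a"
    and h_Nil: "h x = h [] \<Longrightarrow> x = []"
    and finite_classes: "finite (range h)"
begin

definition cls :: "'a word \<Rightarrow> nat \<Rightarrow> nat \<Rightarrow> 'c" where
  "cls u p n = h (subsequence u p n)"

definition leader :: "'a word \<Rightarrow> nat \<Rightarrow> nat \<Rightarrow> bool" where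
  "leader u n p \<longleftrightarrow> 0 < p \<and> p \<le> n \<and> (\<forall>q. 0 < q \<and> q < p \<longrightarrow> cls u q n \<noteq> cls u p n)"

lemma cls_Suc: "p \<le> n \<Longrightarrow> cls u p (Suc n) = step (cls u p n) (u n)"
  by (simp add: cls_def h_snoc)

lemma cls_self: "cls u n n = h []"
  by (simp add: cls_def)

lemma cls_eq_NilD: "cls u p n = h [] \<Longrightarrow> n \<le> p"
  using h_Nil subsequence_empty unfolding cls_def by blast

lemma cls_in_range: "cls u p n \<in> range h"
  by (simp add: cls_def)

lemma step_in_range: "c \<in> range h \<Longrightarrow> step c a \<in> range h"
  using h_snoc by (metis rangeE rangeI)

lemma cls_eq_mono:
  assumes "cls u p m = cls u q m" "p \<le> m" "q \<le> m" "m \<le> n"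
  shows "cls u p n = cls u q n"
  using assms(4,1-3) by (induction rule: dec_induct) (auto simp: cls_Suc)

lemma leader_bounds: "leader u n p \<Longrightarrow> 0 < p \<and> p \<le> n"
  by (simp add: leader_def)

lemma leader_cls_Suc: "leader u n p \<Longrightarrow> cls u p (Suc n) = step (cls u p n) (u n)"
  by (simp add: leader_def cls_Suc)

lemma leader_inj: "leader u n p \<Longrightarrow> leader u n q \<Longrightarrow> cls u p n = cls u q n \<Longrightarrow> p = q"
  unfolding leader_def by (metis linorder_neqE_nat)

lemma finite_leaders: "finite {p. leader u n p}"
  by (rule finite_subset[of _ "{..n}"]) (auto simp: leader_def)

lemma card_leaders_le: "card {p. leader u n p} \<le> card (range h)"
  by (rule card_inj_on_le[of "\<lambda>p. cls u p n"])
    (auto simp: inj_on_def cls_in_range finite_classes intro: leader_inj)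

lemma leader_exists:
  assumes "0 < p" "p \<le> n"
  obtains q where "leader u n q" "q \<le> p" "cls u q n = cls u p n"
proof -
  define q where "q = (LEAST q. 0 < q \<and> cls u q n = cls u p n)"
  have q: "0 < q \<and> cls u q n = cls u p n" unfolding q_def by (rule LeastI) (use assms in simp)
  have "q \<le> p" unfolding q_def by (rule Least_le) (use assms in simp)
  moreover have "cls u r n \<noteq> cls u q n" if "0 < r" "r < q" for r
    using that not_less_Least[of r] q unfolding q_def by fastforce
  ultimately show ?thesis using that[of q] q assms(2) by (simp add: leader_def)
qed

lemma leader_antimono: "leader u n p \<Longrightarrow> p \<le> m \<Longrightarrow> m \<le> n \<Longrightarrow> leader u m p"
  unfolding leader_def by (meson cls_eq_mono le_trans less_imp_le)

lemma leader_Suc_self: "leader u (Suc n) (Suc n)"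
  unfolding leader_def using cls_eq_NilD cls_self by (metis not_less order_refl zero_less_Suc)

lemma leader_dropped:
  assumes p: "leader u n p" "\<not> leader u (Suc n) p"
  obtains q where "leader u n q" "leader u (Suc n) q" "q < p" "cls u q (Suc n) = cls u p (Suc n)"
proof -
  note bounds = leader_bounds[OF p(1)]
  obtain q where q: "leader u (Suc n) q" "q \<le> p" "cls u q (Suc n) = cls u p (Suc n)"
    using leader_exists[of p "Suc n" u] bounds by auto
  moreover have "q < p" using q p(2) by (cases "q = p") auto
  moreover have "leader u n q" using leader_antimono[OF q(1)] q(2) bounds by simp
  ultimately show ?thesis using that by blast
qed

definition leader_pasts :: "'a word \<Rightarrow> nat \<Rightarrow> ('c \<times> 'c) set" where
  "leader_pasts u n = {(cls u p n, cls u 0 p) |p. leader u n p}"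

definition leader_pairs :: "'a word \<Rightarrow> nat \<Rightarrow> ('c \<times> 'c \<times> 'c) set" where
  "leader_pairs u n =
     {(cls u p n, cls u q n, cls u p q) |p q. leader u n p \<and> leader u n q \<and> p < q}"

lemma leader_pasts_iff:
  "(c, b) \<in> leader_pasts u n \<longleftrightarrow> (\<exists>p. c = cls u p n \<and> b = cls u 0 p \<and> leader u n p)"
  by (auto simp: leader_pasts_def)

lemma leader_pairs_iff:
  "(c, c', d) \<in> leader_pairs u n \<longleftrightarrow> (\<exists>p q. c = cls u p n \<and> c' = cls u q n \<and> d = cls u p q \<and>
     leader u n p \<and> leader u n q \<and> p < q)"
  by (auto simp: leader_pairs_def)

definition stays_leader :: "('c \<times> 'c \<times> 'c) set \<Rightarrow> 'a \<Rightarrow> 'c \<Rightarrow> bool" where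
  "stays_leader O' a c \<longleftrightarrow> \<not> (\<exists>c' d. (c', c, d) \<in> O' \<and> step c' a = step c a)"

definition det_step :: "'c \<times> ('c \<times> 'c) set \<times> ('c \<times> 'c \<times> 'c) set \<Rightarrow> 'a \<Rightarrow>
    'c \<times> ('c \<times> 'c) set \<times> ('c \<times> 'c \<times> 'c) set" where
  "det_step = (\<lambda>(c, A, O') a.
     (step c a,
      insert (h [], step c a) {(step c' a, b) |c' b. (c', b) \<in> A \<and> stays_leader O' a c'},
      {(step c1 a, step c2 a, d) |c1 c2 d.
         (c1, c2, d) \<in> O' \<and> stays_leader O' a c1 \<and> stays_leader O' a c2} \<union>
      {(step c' a, h [], step c' a) |c' b. (c', b) \<in> A \<and> stays_leader O' a c'}))"

definition det_state :: "'a word \<Rightarrow> nat \<Rightarrow> 'c \<times> ('c \<times> 'c) set \<times> ('c \<times> 'c \<times> 'c) set" where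
  "det_state u n = (cls u 0 n, leader_pasts u n, leader_pairs u n)"

definition det_init :: "'c \<times> ('c \<times> 'c) set \<times> ('c \<times> 'c \<times> 'c) set" where
  "det_init = (h [], {}, {})"

definition det_states :: "('c \<times> ('c \<times> 'c) set \<times> ('c \<times> 'c \<times> 'c) set) set" where
  "det_states = range h \<times> Pow (range h \<times> range h) \<times> Pow (range h \<times> range h \<times> range h)"

lemma stays_leader_iff:
  assumes p: "leader u n p"
  shows "stays_leader (leader_pairs u n) (u n) (cls u p n) \<longleftrightarrow> leader u (Suc n) p"
proof -
  have "(\<exists>c' d. (c', cls u p n, d) \<in> leader_pairs u n \<and> step c' (u n) = step (cls u p n) (u n)) \<longleftrightarrow>
      (\<exists>q. leader u n q \<and> q < p \<and> cls u q (Suc n) = cls u p (Suc n))"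
    unfolding leader_pairs_iff using p by (auto simp: leader_cls_Suc dest: leader_inj) blast
  also have "\<dots> \<longleftrightarrow> \<not> leader u (Suc n) p"
    using leader_dropped[OF p] leader_bounds by (metis leader_def)
  finally show ?thesis by (simp add: stays_leader_def)
qed

lemma leader_Suc_iff:
  "leader u (Suc n) p \<longleftrightarrow>
    p = Suc n \<or> leader u n p \<and> stays_leader (leader_pairs u n) (u n) (cls u p n)"
proof (cases "p = Suc n")
  case False
  have "leader u (Suc n) p \<Longrightarrow> leader u n p"
    using leader_antimono[of u "Suc n" p n] leader_bounds[of u "Suc n" p] False by simp
  then show ?thesis using stays_leader_iff False by blast
qed (simp add: leader_Suc_self)

lemma leader_pasts_Suc:
  "leader_pasts u (Suc n) = insert (h [], step (cls u 0 n) (u n))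
    {(step c (u n), b) |c b. (c, b) \<in> leader_pasts u n \<and> stays_leader (leader_pairs u n) (u n) c}"
proof -
  have "leader_pasts u (Suc n) = insert (cls u (Suc n) (Suc n), cls u 0 (Suc n))
      {(cls u p (Suc n), cls u 0 p) |p.
         leader u n p \<and> stays_leader (leader_pairs u n) (u n) (cls u p n)}"
    unfolding leader_pasts_def leader_Suc_iff by blast
  also have "\<dots> = insert (h [], step (cls u 0 n) (u n))
      {(step (cls u p n) (u n), cls u 0 p) |p.
         leader u n p \<and> stays_leader (leader_pairs u n) (u n) (cls u p n)}"
    by (intro arg_cong2[where f = insert] Collect_cong ex_cong1)
      (auto simp: cls_self cls_Suc leader_cls_Suc)
  finally show ?thesis unfolding leader_pasts_iff by blast
qed

lemma leader_pairs_Suc: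
  "leader_pairs u (Suc n) =
    {(step c1 (u n), step c2 (u n), d) |c1 c2 d. (c1, c2, d) \<in> leader_pairs u n \<and>
       stays_leader (leader_pairs u n) (u n) c1 \<and> stays_leader (leader_pairs u n) (u n) c2} \<union>
    {(step c (u n), h [], step c (u n)) |c b.
       (c, b) \<in> leader_pasts u n \<and> stays_leader (leader_pairs u n) (u n) c}"
proof -
  define stays where "stays p \<longleftrightarrow> leader u n p \<and> stays_leader (leader_pairs u n) (u n) (cls u p n)"
    for p
  have old: "cls u p (Suc n) = step (cls u p n) (u n)" "p < Suc n" if "stays p" for p
    using that leader_bounds[of u n p] by (auto simp: stays_def leader_cls_Suc)
  have pairs: "(c1, c2, d) \<in> leader_pairs u n \<and>
      stays_leader (leader_pairs u n) (u n) c1 \<and> stays_leader (leader_pairs u n) (u n) c2 \<longleftrightarrow>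
      (\<exists>p q. c1 = cls u p n \<and> c2 = cls u q n \<and> d = cls u p q \<and> stays p \<and> stays q \<and> p < q)"
    for c1 c2 d
    unfolding leader_pairs_iff stays_def by blast
  have pasts: "(c, b) \<in> leader_pasts u n \<and> stays_leader (leader_pairs u n) (u n) c \<longleftrightarrow>
      (\<exists>p. c = cls u p n \<and> b = cls u 0 p \<and> stays p)" for c b
    unfolding leader_pasts_iff stays_def by blast
  have "leader_pairs u (Suc n) =
      {(cls u p (Suc n), cls u q (Suc n), cls u p q) |p q. stays p \<and> stays q \<and> p < q} \<union>
      {(cls u p (Suc n), cls u (Suc n) (Suc n), cls u p (Suc n)) |p. stays p}"
    unfolding leader_pairs_def[of u "Suc n"] leader_Suc_iff stays_def[symmetric]
    using old(2) by fastforce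
  also have "\<dots> =
      {(step (cls u p n) (u n), step (cls u q n) (u n), cls u p q) |p q.
         stays p \<and> stays q \<and> p < q} \<union>
      {(step (cls u p n) (u n), h [], step (cls u p n) (u n)) |p. stays p}"
    by (intro arg_cong2[where f = "(\<union>)"] Collect_cong ex_cong1) (auto simp: old cls_self)
  also have "\<dots> =
      {(step c1 (u n), step c2 (u n), d) |c1 c2 d.
         \<exists>p q. c1 = cls u p n \<and> c2 = cls u q n \<and> d = cls u p q \<and> stays p \<and> stays q \<and> p < q} \<union>
      {(step c (u n), h [], step c (u n)) |c b. \<exists>p. c = cls u p n \<and> b = cls u 0 p \<and> stays p}"
    by (intro arg_cong2[where f = "(\<union>)"]) (blast, blast)
  finally show ?thesis unfolding pairs pasts .
qed

lemma run_det_step: "run det_step det_init u n = det_state u n"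
proof (induction n)
  case 0
  show ?case
    by (auto simp: det_state_def det_init_def leader_pasts_def leader_pairs_def leader_def cls_self)
next
  case (Suc n)
  then show ?case
    by (simp add: det_state_def det_step_def leader_pasts_Suc leader_pairs_Suc cls_Suc)
qed

definition older_leaders :: "('c \<times> 'c \<times> 'c) set \<Rightarrow> 'c \<Rightarrow> nat" where
  "older_leaders O' c = card {c'. \<exists>d. (c', c, d) \<in> O'}"

definition merges :: "'c \<times> ('c \<times> 'c) set \<times> ('c \<times> 'c \<times> 'c) set \<Rightarrow> 'a \<Rightarrow> ('c \<times> 'c) set \<Rightarrow> nat \<Rightarrow> bool"
  where
  "merges = (\<lambda>(c0, A, O') a X k. \<exists>c c' d b. (c, c', d) \<in> O' \<and> step c a = step c' a \<and>
     stays_leader O' a c \<and> older_leaders O' c = k \<and> (c, b) \<in> A \<and> (b, d) \<in> X)"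

text \<open>The priority announces the oldest leader that absorbs another one, and its parity tells
  whether the resulting factorisation belongs to \<open>X\<close>.\<close>

definition det_prio ::
  "('c \<times> 'c) set \<Rightarrow> 'c \<times> ('c \<times> 'c) set \<times> ('c \<times> 'c \<times> 'c) set \<Rightarrow> 'a \<Rightarrow> nat" where
  "det_prio X s a =
    (if \<exists>k\<le>card (range h). merges s a UNIV k
     then let k = LEAST k. merges s a UNIV k in if merges s a X k then 2 * k else Suc (2 * k)
     else Suc (2 * Suc (card (range h))))"

lemma det_prio_cases:
  obtains (none) "\<And>l. l \<le> card (range h) \<Longrightarrow> \<not> merges s a UNIV l"
      "det_prio X s a = Suc (2 * Suc (card (range h)))"
    | (least) l where "l \<le> card (range h)" "merges s a UNIV l" "\<And>j. merges s a UNIV j \<Longrightarrow> l \<le> j"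
      "det_prio X s a = (if merges s a X l then 2 * l else Suc (2 * l))"
proof (cases "\<exists>l\<le>card (range h). merges s a UNIV l")
  case True
  define l where "l = (LEAST l. merges s a UNIV l)"
  have "merges s a UNIV l" unfolding l_def using True by (auto intro: LeastI)
  moreover have "l \<le> j" if "merges s a UNIV j" for j unfolding l_def using that by (rule Least_le)
  moreover from this have "l \<le> card (range h)" using True order_trans by blast
  ultimately show ?thesis using least[of l] True
    by (simp add: det_prio_def l_def[symmetric] Let_def)
next
  case False
  then show ?thesis using none unfolding det_prio_def by (simp only: if_False) blast
qed

lemma det_prio_le: "det_prio X s a \<le> Suc (2 * Suc (card (range h)))"
  by (cases rule: det_prio_cases[of s a X]) auto

definition leader_rank :: "'a word \<Rightarrow> nat \<Rightarrow> nat \<Rightarrow> nat" where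
  "leader_rank u n p = card {q. leader u n q \<and> q < p}"

lemma leader_rank_le: "leader_rank u n p \<le> card (range h)"
  unfolding leader_rank_def
  by (rule order_trans[OF card_mono card_leaders_le]) (auto intro: finite_leaders)

lemma leader_rank_less: "leader u n p \<Longrightarrow> p < q \<Longrightarrow> leader_rank u n p < leader_rank u n q"
  unfolding leader_rank_def
  by (intro psubset_card_mono) (auto intro: finite_subset[OF _ finite_leaders])

lemma leader_rank_inj:
  "leader u n p \<Longrightarrow> leader u n q \<Longrightarrow> leader_rank u n p = leader_rank u n q \<Longrightarrow> p = q"
  using leader_rank_less by (metis less_irrefl linorder_neqE_nat)

lemma older_leaders_eq_leader_rank:
  assumes "leader u n p"
  shows "older_leaders (leader_pairs u n) (cls u p n) = leader_rank u n p"
proof -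
  have "{c. \<exists>d. (c, cls u p n, d) \<in> leader_pairs u n} = (\<lambda>q. cls u q n) ` {q. leader u n q \<and> q < p}"
    using assms by (auto simp: leader_pairs_iff dest: leader_inj)
  moreover have "inj_on (\<lambda>q. cls u q n) {q. leader u n q \<and> q < p}"
    by (auto simp: inj_on_def intro: leader_inj)
  ultimately show ?thesis by (simp add: older_leaders_def leader_rank_def card_image)
qed

definition absorbs :: "'a word \<Rightarrow> nat \<Rightarrow> nat \<Rightarrow> nat \<Rightarrow> bool" where
  "absorbs u n p q \<longleftrightarrow> leader u n p \<and> leader u n q \<and> p < q \<and>
     cls u p (Suc n) = cls u q (Suc n) \<and> leader u (Suc n) p"

lemma absorbs_not_leader_Suc: "absorbs u n p q \<Longrightarrow> \<not> leader u (Suc n) q"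
  unfolding absorbs_def leader_def by auto

lemma merges_iff:
  "merges (det_state u n) (u n) X k \<longleftrightarrow>
    (\<exists>p q. absorbs u n p q \<and> leader_rank u n p = k \<and> (cls u 0 p, cls u p q) \<in> X)" (is "?M \<longleftrightarrow> ?A")
proof
  assume ?M
  then obtain c c' d b where m: "(c, c', d) \<in> leader_pairs u n" "step c (u n) = step c' (u n)"
    "stays_leader (leader_pairs u n) (u n) c" "older_leaders (leader_pairs u n) c = k"
    "(c, b) \<in> leader_pasts u n" "(b, d) \<in> X"
    unfolding merges_def det_state_def by auto
  from m(1) obtain p q where p: "c = cls u p n" "c' = cls u q n" "d = cls u p q" "leader u n p"
    "leader u n q" "p < q"
    unfolding leader_pairs_iff by blast
  have "b = cls u 0 p" using m(5) p unfolding leader_pasts_iff by (auto dest: leader_inj)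
  moreover have "absorbs u n p q"
    using p m(2,3) by (simp add: absorbs_def stays_leader_iff leader_cls_Suc)
  ultimately show ?A using p m(4,6) older_leaders_eq_leader_rank[OF p(4)] by auto
next
  assume ?A
  then obtain p q where a: "absorbs u n p q" "leader_rank u n p = k" "(cls u 0 p, cls u p q) \<in> X"
    by blast
  then have l: "leader u n p" "leader u n q" "p < q" "leader u (Suc n) p"
    "step (cls u p n) (u n) = step (cls u q n) (u n)"
    by (auto simp: absorbs_def leader_cls_Suc)
  have "(cls u p n, cls u q n, cls u p q) \<in> leader_pairs u n"
    "(cls u p n, cls u 0 p) \<in> leader_pasts u n"
    using l unfolding leader_pairs_iff leader_pasts_iff by blast+
  moreover have "stays_leader (leader_pairs u n) (u n) (cls u p n)"
    "older_leaders (leader_pairs u n) (cls u p n) = k"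
    using a(2) l by (simp_all add: stays_leader_iff older_leaders_eq_leader_rank)
  ultimately show ?M unfolding merges_def det_state_def prod.case using a(3) l(5) by blast
qed

lemma frequently_absorbs: "\<exists>\<^sub>\<infinity>n. \<exists>p q. absorbs u n p q"
proof (rule ccontr)
  assume "\<not> ?thesis"
  then obtain i where never: "\<And>n p q. i \<le> n \<Longrightarrow> \<not> absorbs u n p q" unfolding INFM_nat_le by blast
  have keep: "leader u (Suc n) p" if "leader u n p" "i \<le> n" for n p
    using leader_dropped[OF that(1)] never[OF that(2)] that(1) unfolding absorbs_def by metis
  have "{i<..i + d} \<subseteq> {p. leader u (i + d) p}" for d
  proof (induction d)
    case (Suc d)
    then show ?case using keep leader_Suc_self[of u "i + d"] by (auto simp: le_Suc_eq)
  qed simp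
  then have "card {i<..i + d} \<le> card (range h)" for d
    by (meson card_mono card_leaders_le finite_leaders order_trans)
  from this[of "Suc (card (range h))"] show False by simp
qed

text \<open>If \<open>p\<close> keeps absorbing positions \<open>q\<close> with \<open>cls u p q = s\<close>, these are unbounded, as none is
  absorbed twice; later positions see them merged with \<open>p\<close>, so \<open>s\<close> is also the class between two
  of them that are far enough apart.\<close>

definition merged_positions :: "'a word \<Rightarrow> nat \<Rightarrow> 'c \<Rightarrow> nat set" where
  "merged_positions u p s = {q. p < q \<and> cls u p q = s \<and> (\<exists>m\<ge>q. cls u q m = cls u p m)}"

lemma merged_positions_unbounded:
  assumes freq: "\<exists>\<^sub>\<infinity>n. \<exists>q. absorbs u n p q \<and> cls u p q = s"
  shows "\<exists>q\<in>merged_positions u p s. b < q"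
proof (rule ccontr)
  assume none: "\<not> ?thesis"
  have "q \<le> b" if "absorbs u n p q" "cls u p q = s" for n q
  proof -
    have "q \<le> Suc n" "p < q" "cls u q (Suc n) = cls u p (Suc n)"
      using that(1) leader_bounds[of u n q] by (auto simp: absorbs_def)
    then have "q \<in> merged_positions u p s" using that(2) unfolding merged_positions_def by blast
    then show ?thesis using none by (simp add: not_less)
  qed
  then have "\<exists>\<^sub>\<infinity>n. \<exists>q\<in>{..b}. absorbs u n p q" using freq by (elim INFM_mono) auto
  then obtain q where q: "\<exists>\<^sub>\<infinity>n. absorbs u n p q" by (auto simp: frequently_bex_finite_distrib)
  obtain n where n: "absorbs u n p q" using q unfolding INFM_nat_le by blast
  obtain m where m: "m \<ge> Suc n" "absorbs u m p q" using q unfolding INFM_nat_le by blast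
  have "q \<le> Suc n" using n leader_bounds[of u n q] by (simp add: absorbs_def)
  then have "leader u (Suc n) q"
    using leader_antimono[of u m q "Suc n"] m by (simp add: absorbs_def)
  then show False using absorbs_not_leader_Suc[OF n] by blast
qed

lemma factorisation_exists:
  assumes "\<exists>\<^sub>\<infinity>n. \<exists>q. absorbs u n p q \<and> cls u p q \<in> S"
  obtains s t where "s \<in> S" "idx_sequence t" "t 1 = p"
    "\<And>k. cls u (t (Suc k)) (t (Suc (Suc k))) = s"
proof -
  have "\<exists>\<^sub>\<infinity>n. \<exists>s\<in>range h. \<exists>q. absorbs u n p q \<and> cls u p q = s \<and> s \<in> S"
    using assms by (rule INFM_mono) (use cls_in_range in blast)
  then obtain s where s: "\<exists>\<^sub>\<infinity>n. \<exists>q. absorbs u n p q \<and> cls u p q = s \<and> s \<in> S"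
    unfolding frequently_bex_finite_distrib[OF finite_classes] by blast
  then have "s \<in> S" and "0 < p" using INFM_EX leader_bounds unfolding absorbs_def by blast+
  let ?Y = "merged_positions u p s"
  have "\<exists>\<^sub>\<infinity>n. \<exists>q. absorbs u n p q \<and> cls u p q = s" using s by (rule INFM_mono) blast
  note unbounded = merged_positions_unbounded[OF this]
  have "\<exists>q'\<in>?Y. q < q' \<and> cls u q q' = s" if q: "q \<in> ?Y" for q
  proof -
    obtain m where m: "m \<ge> q" "cls u q m = cls u p m" "p < q"
      using q unfolding merged_positions_def by blast
    obtain q' where q': "q' \<in> ?Y" "m < q'" using unbounded by blast
    have "cls u q q' = cls u p q'" using cls_eq_mono[OF m(2,1), of q'] m q' by simp
    then show ?thesis using q' m(1) by (intro bexI[of _ q']) (auto simp: merged_positions_def)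
  qed
  then obtain f where f: "\<And>k. f k \<in> ?Y \<and> f k < f (Suc k) \<and> cls u (f k) (f (Suc k)) = s"
    using dependent_nat_choice[of "\<lambda>_ q. q \<in> ?Y" "\<lambda>_ q q'. q < q' \<and> cls u q q' = s"] unbounded
    by metis
  define t where "t = case_nat 0 (case_nat p f)"
  have first: "p < f 0" "cls u p (f 0) = s" using f[of 0] by (auto simp: merged_positions_def)
  show ?thesis
  proof (rule that[OF \<open>s \<in> S\<close>])
    show "idx_sequence t"
      unfolding idx_sequence_def t_def using f first \<open>0 < p\<close> by (auto split: nat.split)
    show "cls u (t (Suc k)) (t (Suc (Suc k))) = s" for k
      unfolding t_def using f first by (cases k) auto
  qed (simp add: t_def)
qed

lemma leader_persists:
  assumes p: "leader u n p"
    and younger: "\<And>r q. absorbs u n r q \<Longrightarrow> leader_rank u n p \<le> leader_rank u n r"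
  shows "leader u (Suc n) p" and "leader_rank u (Suc n) p = leader_rank u n p"
proof -
  have keep: "leader u (Suc n) r" if r: "leader u n r" "r \<le> p" for r
  proof (rule ccontr)
    assume "\<not> leader u (Suc n) r"
    from leader_dropped[OF r(1) this] obtain q where q: "leader u n q" "q < r" "absorbs u n q r"
      using r(1) unfolding absorbs_def by blast
    then show False using younger[OF q(3)] leader_rank_less[OF q(1), of p] r(2) by simp
  qed
  show "leader u (Suc n) p" by (rule keep[OF p]) simp
  have "{q. leader u (Suc n) q \<and> q < p} = {q. leader u n q \<and> q < p}"
    using keep leader_bounds[OF p] by (auto intro: leader_antimono)
  then show "leader_rank u (Suc n) p = leader_rank u n p" by (simp add: leader_rank_def)
qed

lemma stable_leader_exists:
  "\<exists>p k i. (\<forall>n\<ge>i. leader u n p \<and> leader_rank u n p = k) \<and>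
    (\<forall>n\<ge>i. \<forall>r q. absorbs u n r q \<longrightarrow> k \<le> leader_rank u n r) \<and>
    (\<exists>\<^sub>\<infinity>n. \<exists>q. absorbs u n p q)"
proof -
  define absorbing where "absorbing k n \<longleftrightarrow> (\<exists>p q. absorbs u n p q \<and> leader_rank u n p = k)" for k n
  have "\<exists>\<^sub>\<infinity>n. \<exists>k\<in>{..card (range h)}. absorbing k n"
    using frequently_absorbs[of u] by (rule INFM_mono) (use leader_rank_le absorbing_def in auto)
  then have "\<exists>k. \<exists>\<^sub>\<infinity>n. absorbing k n" by (auto simp: frequently_bex_finite_distrib)
  define k where "k = (LEAST k. \<exists>\<^sub>\<infinity>n. absorbing k n)"
  have k: "\<exists>\<^sub>\<infinity>n. absorbing k n"
    unfolding k_def using \<open>\<exists>k. \<exists>\<^sub>\<infinity>n. absorbing k n\<close> by (rule LeastI_ex)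
  have "\<forall>j\<in>{..<k}. \<forall>\<^sub>\<infinity>n. \<not> absorbing j n"
    using not_less_Least[of _ "\<lambda>k. \<exists>\<^sub>\<infinity>n. absorbing k n"] by (auto simp: k_def)
  then have "\<forall>\<^sub>\<infinity>n. \<forall>j\<in>{..<k}. \<not> absorbing j n" by (simp add: eventually_ball_finite_distrib)
  then obtain i0 where i0: "\<And>n j. i0 \<le> n \<Longrightarrow> j < k \<Longrightarrow> \<not> absorbing j n" unfolding MOST_nat_le by auto
  obtain i where i: "i0 \<le> i" "absorbing k i" using k unfolding INFM_nat_le by blast
  then obtain p where p: "leader u i p" "leader_rank u i p = k"
    by (auto simp: absorbing_def absorbs_def)
  have ge: "k \<le> leader_rank u n r" if "i \<le> n" "absorbs u n r q" for n r q
  proof -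
    have "absorbing (leader_rank u n r) n" using that(2) unfolding absorbing_def by blast
    then show ?thesis using i0[of n "leader_rank u n r"] that(1) i(1) by fastforce
  qed
  have stable: "leader u n p \<and> leader_rank u n p = k" if "i \<le> n" for n
    using that
  proof (induction rule: dec_induct)
    case (step n)
    then have "leader_rank u n p \<le> leader_rank u n r" if "absorbs u n r q" for r q
      using ge[OF _ that] by simp
    then show ?case using leader_persists[of u n p] step.IH by simp
  qed (simp add: p)
  have "\<exists>\<^sub>\<infinity>n. absorbing k n \<and> i \<le> n" using k by (intro INFM_conjI MOST_ge_nat)
  then have "\<exists>\<^sub>\<infinity>n. \<exists>q. absorbs u n p q"
  proof (rule INFM_mono)
    fix n assume n: "absorbing k n \<and> i \<le> n"
    then obtain r q where "absorbs u n r q" "leader_rank u n r = k" by (auto simp: absorbing_def)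
    moreover from this have "r = p"
      using stable[of n] n leader_rank_inj[of u n r p] by (simp add: absorbs_def)
    ultimately show "\<exists>q. absorbs u n p q" by blast
  qed
  with stable ge show ?thesis by blast
qed

lemma det_prio_oldest:
  assumes p: "leader u n p" "leader_rank u n p = k"
    and oldest: "\<And>r q. absorbs u n r q \<Longrightarrow> k \<le> leader_rank u n r"
  shows "2 * k \<le> det_prio X (det_state u n) (u n)"
    and "det_prio X (det_state u n) (u n) = 2 * k \<longleftrightarrow>
      (\<exists>q. absorbs u n p q \<and> (cls u 0 p, cls u p q) \<in> X)"
    and "absorbs u n p q \<Longrightarrow> det_prio X (det_state u n) (u n) \<le> Suc (2 * k)"
proof -
  let ?m = "merges (det_state u n) (u n)" and ?prio = "det_prio X (det_state u n) (u n)"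
  have "k \<le> card (range h)" using p(2) leader_rank_le by metis
  have "r = p" if "absorbs u n r q" "leader_rank u n r = k" for r q
    using that p leader_rank_inj[of u n r p] by (simp add: absorbs_def)
  then have merges_k: "?m Y k \<longleftrightarrow> (\<exists>q. absorbs u n p q \<and> (cls u 0 p, cls u p q) \<in> Y)" for Y
    unfolding merges_iff using p(2) by blast
  have "2 * k \<le> ?prio \<and> (?prio = 2 * k \<longleftrightarrow> ?m X k) \<and> (?m UNIV k \<longrightarrow> ?prio \<le> Suc (2 * k))"
  proof (cases rule: det_prio_cases[of "det_state u n" "u n" X])
    case none
    have "\<not> ?m X k" using none(1)[OF \<open>k \<le> card (range h)\<close>] unfolding merges_iff by blast
    then show ?thesis using none \<open>k \<le> card (range h)\<close> by auto
  next
    case (least l)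
    have "k \<le> l" using least(2) oldest unfolding merges_iff by blast
    moreover have "l = k" if "?m UNIV k" using least(3)[OF that] \<open>k \<le> l\<close> by simp
    moreover have "?m X k \<Longrightarrow> ?m UNIV k" unfolding merges_iff by blast
    ultimately show ?thesis using least(4) by (cases "l = k") auto
  qed
  then show "2 * k \<le> ?prio"
    and "?prio = 2 * k \<longleftrightarrow> (\<exists>q. absorbs u n p q \<and> (cls u 0 p, cls u p q) \<in> X)"
    and "absorbs u n p q \<Longrightarrow> ?prio \<le> Suc (2 * k)"
    unfolding merges_k by blast+
qed

lemma Min_limit_det_prio:
  obtains p where "even (Min (limit (\<lambda>n. det_prio X (det_state u n) (u n)))) \<longleftrightarrow>
      (\<exists>\<^sub>\<infinity>n. \<exists>q. absorbs u n p q \<and> cls u p q \<in> {s. (cls u 0 p, s) \<in> X})"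
    "\<exists>\<^sub>\<infinity>n. \<exists>q. absorbs u n p q"
proof -
  let ?prio = "\<lambda>n. det_prio X (det_state u n) (u n)"
  obtain p k i where stable: "\<forall>n\<ge>i. leader u n p \<and> leader_rank u n p = k"
    and oldest: "\<forall>n\<ge>i. \<forall>r q. absorbs u n r q \<longrightarrow> k \<le> leader_rank u n r"
    and freq: "\<exists>\<^sub>\<infinity>n. \<exists>q. absorbs u n p q" using stable_leader_exists[of u] by blast
  have prio: "2 * k \<le> ?prio n"
    "?prio n = 2 * k \<longleftrightarrow> (\<exists>q. absorbs u n p q \<and> (cls u 0 p, cls u p q) \<in> X)"
    "absorbs u n p q \<Longrightarrow> ?prio n \<le> Suc (2 * k)" if "i \<le> n" for n q
    using det_prio_oldest[where u = u and n = n and p = p and k = k and X = X] stable oldest that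
    by simp_all
  define good where "good n \<longleftrightarrow> (\<exists>q. absorbs u n p q \<and> (cls u 0 p, cls u p q) \<in> X)" for n
  have "range ?prio \<subseteq> {..Suc (2 * Suc (card (range h)))}"
    by (intro image_subsetI) (simp only: atMost_iff det_prio_le)
  then have fin: "finite (range ?prio)" by (rule finite_subset) simp
  have "even (Min (limit ?prio)) \<longleftrightarrow> (\<exists>\<^sub>\<infinity>n. good n)"
  proof (cases "\<exists>\<^sub>\<infinity>n. good n")
    case True
    then have "\<exists>\<^sub>\<infinity>n. good n \<and> i \<le> n" by (intro INFM_conjI MOST_ge_nat)
    then have "\<exists>\<^sub>\<infinity>n. ?prio n = 2 * k" by (rule INFM_mono) (use prio(2) good_def in auto)
    then have "Min (limit ?prio) = 2 * k" by (rule Min_limit_eq[OF fin]) (rule prio(1))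
    then show ?thesis using True by simp
  next
    case False
    then obtain j where j: "\<And>n. j \<le> n \<Longrightarrow> \<not> good n" unfolding INFM_nat_le by blast
    have ge: "Suc (2 * k) \<le> ?prio n" if "max i j \<le> n" for n
      using prio(1,2)[of n] j[of n] that by (force simp: good_def)
    have "\<exists>\<^sub>\<infinity>n. (\<exists>q. absorbs u n p q) \<and> max i j \<le> n"
      using freq by (intro INFM_conjI MOST_ge_nat)
    then have "\<exists>\<^sub>\<infinity>n. ?prio n = Suc (2 * k)"
    proof (rule INFM_mono)
      fix n assume n: "(\<exists>q. absorbs u n p q) \<and> max i j \<le> n"
      then show "?prio n = Suc (2 * k)" using prio(3) ge[of n] by (auto intro: antisym)
    qed
    then have "Min (limit ?prio) = Suc (2 * k)" using ge by (rule Min_limit_eq[OF fin])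
    then show ?thesis using False by simp
  qed
  then show ?thesis using that freq by (simp add: good_def)
qed

end

locale saturated_language = finite_right_congruence h step
  for h :: "'a list \<Rightarrow> 'c" and step :: "'c \<Rightarrow> 'a \<Rightarrow> 'c" +
  fixes L :: "'a word \<Rightarrow> bool"
  assumes saturated: "idx_sequence t \<Longrightarrow> idx_sequence t' \<Longrightarrow>
    (\<And>k. cls u (t k) (t (Suc k)) = cls u' (t' k) (t' (Suc k))) \<Longrightarrow> L u \<Longrightarrow> L u'"
begin

definition accepting_pairs :: "('c \<times> 'c) set" where
  "accepting_pairs = {(cls u 0 (t 1), s) |u t s. idx_sequence t \<and>
     (\<forall>k. cls u (t (Suc k)) (t (Suc (Suc k))) = s) \<and> L u}"

lemma language_iff_accepting_pair:
  assumes t: "idx_sequence t" and s: "\<And>k. cls u (t (Suc k)) (t (Suc (Suc k))) = s"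
  shows "L u \<longleftrightarrow> (cls u 0 (t 1), s) \<in> accepting_pairs"
proof
  assume "L u"
  then show "(cls u 0 (t 1), s) \<in> accepting_pairs" using t s unfolding accepting_pairs_def by blast
next
  assume "(cls u 0 (t 1), s) \<in> accepting_pairs"
  then obtain u' t' where t': "idx_sequence t'" "cls u' 0 (t' 1) = cls u 0 (t 1)"
    "\<And>k. cls u' (t' (Suc k)) (t' (Suc (Suc k))) = s" "L u'"
    unfolding accepting_pairs_def by auto
  have "cls u' (t' k) (t' (Suc k)) = cls u (t k) (t (Suc k))" for k
    using t t' s by (cases k) (auto simp: idx_sequence_def)
  then show "L u" using saturated[OF t'(1) t] t'(4) by blast
qed

lemma language_iff_even_Min_limit:
  "L u \<longleftrightarrow> even (Min (limit (\<lambda>n. det_prio accepting_pairs (det_state u n) (u n))))"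
proof -
  obtain p where parity: "even (Min (limit (\<lambda>n. det_prio accepting_pairs (det_state u n) (u n)))) \<longleftrightarrow>
      (\<exists>\<^sub>\<infinity>n. \<exists>q. absorbs u n p q \<and> cls u p q \<in> {s. (cls u 0 p, s) \<in> accepting_pairs})"
      (is "_ \<longleftrightarrow> ?good")
    and freq: "\<exists>\<^sub>\<infinity>n. \<exists>q. absorbs u n p q"
    by (rule Min_limit_det_prio)
  have "L u \<longleftrightarrow> ?good"
  proof (cases ?good)
    case True
    then obtain s t where "(cls u 0 p, s) \<in> accepting_pairs" "idx_sequence t" "t 1 = p"
      "\<And>k. cls u (t (Suc k)) (t (Suc (Suc k))) = s"
      by (rule factorisation_exists) simp
    then show ?thesis using True language_iff_accepting_pair[of t u s] by simp
  next
    case False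
    then have "\<exists>\<^sub>\<infinity>n. (\<exists>q. absorbs u n p q) \<and>
        \<not> (\<exists>q. absorbs u n p q \<and> cls u p q \<in> {s. (cls u 0 p, s) \<in> accepting_pairs})"
      using freq by (intro INFM_conjI) (simp_all only: not_frequently)
    then have "\<exists>\<^sub>\<infinity>n. \<exists>q. absorbs u n p q \<and> cls u p q \<in> {s. (cls u 0 p, s) \<notin> accepting_pairs}"
      by (rule INFM_mono) blast
    then obtain s t where "(cls u 0 p, s) \<notin> accepting_pairs" "idx_sequence t" "t 1 = p"
      "\<And>k. cls u (t (Suc k)) (t (Suc (Suc k))) = s"
      by (rule factorisation_exists) simp
    then show ?thesis using False language_iff_accepting_pair[of t u s] by simp
  qed
  then show ?thesis using parity by simp
qed

theorem parity_automaton_det: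
  "parity_automaton det_states det_init det_step (det_prio accepting_pairs)
     (Suc (2 * Suc (card (range h)))) L"
proof
  show "finite det_states" using finite_classes by (simp add: det_states_def)
  show "det_init \<in> det_states" by (simp add: det_init_def det_states_def)
  show "det_step s a \<in> det_states" if "s \<in> det_states" for s a
    using that by (cases s) (auto simp: det_step_def det_states_def intro: step_in_range)
  show "det_prio accepting_pairs s a \<le> Suc (2 * Suc (card (range h)))" for s a
    by (rule det_prio_le)
  show "L u \<longleftrightarrow>
    even (Min (limit (\<lambda>n. det_prio accepting_pairs (run det_step det_init u n) (u n))))" for u
    unfolding run_det_step by (rule language_iff_even_Min_limit)
qed

end

text \<open>The first component puts the empty word in a class of its own.\<close>

definition profile_class :: "nat \<Rightarrow> nat set list \<Rightarrow> bool \<times> (nat set \<times> nat set \<times> nat set) set" where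
  "profile_class N x = (x = [], profile N x)"

definition profile_class_step :: "nat \<Rightarrow> bool \<times> (nat set \<times> nat set \<times> nat set) set \<Rightarrow> nat set \<Rightarrow>
    bool \<times> (nat set \<times> nat set \<times> nat set) set" where
  "profile_class_step N c a = (False, profile_step N (snd c) a)"

interpretation profile_class: finite_right_congruence "profile_class N" "profile_class_step N" for N
proof
  show "profile_class N (x @ [a]) = profile_class_step N (profile_class N x) a" for x a
    by (simp add: profile_class_def profile_class_step_def profile_snoc)
  show "x = []" if "profile_class N x = profile_class N []" for x
    using that by (simp add: profile_class_def)
  have "range (profile_class N) \<subseteq> UNIV \<times> Pow (Pow {..N} \<times> Pow {..N} \<times> Pow {..N})"
    unfolding profile_class_def using profile_subset by blast
  then show "finite (range (profile_class N))" by (rule finite_subset) simp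
qed

interpretation profile_class: saturated_language "profile_class N" "profile_class_step N"
  "\<lambda>u. truth u 0 N" for N
proof
  fix t t' and u u' :: "nat set word"
  assume t: "idx_sequence t" "idx_sequence t'"
    and "\<And>k. profile_class.cls N u (t k) (t (Suc k)) = profile_class.cls N u' (t' k) (t' (Suc k))"
  then have "profile N (subsequence u (t k) (t (Suc k))) =
      profile N (subsequence u' (t' k) (t' (Suc k)))" for k
    by (simp add: profile_class.cls_def profile_class_def)
  then show "truth u 0 N \<Longrightarrow> truth u' 0 N" by (rule profile_saturates[OF t])
qed

section \<open>Certificates\<close>

text \<open>Finite-state controllers of the two players: every move \<open>m, x, m'\<close> on which they insist
  satisfies \<open>ok\<close>.\<close>

definition O_controller ::
  "'p set \<Rightarrow> 'p set \<Rightarrow> 'm set \<Rightarrow> ('m \<Rightarrow> 'p set \<Rightarrow> 'm \<Rightarrow> bool) \<Rightarrow> bool" where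
  "O_controller inputs outputs S ok \<longleftrightarrow>
     (\<forall>m\<in>S. \<exists>a\<subseteq>outputs. \<forall>i\<subseteq>inputs. \<exists>m'\<in>S. ok m (a \<union> i) m')"

definition I_controller ::
  "'p set \<Rightarrow> 'p set \<Rightarrow> 'm set \<Rightarrow> ('m \<Rightarrow> 'p set \<Rightarrow> 'm \<Rightarrow> bool) \<Rightarrow> bool" where
  "I_controller inputs outputs S ok \<longleftrightarrow>
     (\<forall>m\<in>S. \<forall>a\<subseteq>outputs. \<exists>i\<subseteq>inputs. \<exists>m'\<in>S. ok m (a \<union> i) m')"

lemma strategy_O_subset: "lO \<in> strategies_O inputs outputs \<Longrightarrow> h \<in> histories inputs outputs \<Longrightarrow>
    lO h \<subseteq> outputs"
  by (auto simp: strategies_O_def)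

lemma strategy_I_subset: "lI \<in> strategies_I inputs outputs \<Longrightarrow> h \<in> histories inputs outputs \<Longrightarrow>
    a \<subseteq> outputs \<Longrightarrow> lI (h, a) \<subseteq> inputs"
  unfolding strategies_I_def by blast

lemma history_after_in_histories:
  assumes "lO \<in> strategies_O inputs outputs" "lI \<in> strategies_I inputs outputs"
  shows "history_after lO lI n \<in> histories inputs outputs"
proof (induction n)
  case (Suc n)
  have "lO (history_after lO lI n) \<subseteq> outputs" using assms(1) Suc by (rule strategy_O_subset)
  moreover from this have "lI (history_after lO lI n, lO (history_after lO lI n)) \<subseteq> inputs"
    by (rule strategy_I_subset[OF assms(2) Suc])
  ultimately show ?case using Suc by (simp add: histories_def Let_def)
qed (simp add: histories_def)

lemma O_controller_strategy:
  assumes "O_controller inputs outputs S ok" and m0: "m0 \<in> S"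
  obtains lO where "lO \<in> strategies_O inputs outputs"
    "\<And>lI. lI \<in> strategies_I inputs outputs \<Longrightarrow>
      \<exists>\<rho>. \<rho> 0 = m0 \<and> (\<forall>n. ok (\<rho> n) (outcome lO lI n) (\<rho> (Suc n)))"
proof -
  obtain f where f: "\<And>m. m \<in> S \<Longrightarrow> f m \<subseteq> outputs \<and> (\<forall>i\<subseteq>inputs. \<exists>m'\<in>S. ok m (f m \<union> i) m')"
    using assms(1) unfolding O_controller_def by metis
  then obtain g where
    g: "\<And>m i. m \<in> S \<Longrightarrow> i \<subseteq> inputs \<Longrightarrow> g m i \<in> S \<and> ok m (f m \<union> i) (g m i)" by metis
  define state where "state = foldl (\<lambda>m (a :: 'a set, i). g m i) m0"
  have state: "state h \<in> S" if "h \<in> histories inputs outputs" for h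
    using that by (induction h rule: rev_induct) (auto simp: state_def m0 histories_def g)
  define lO where "lO h = f (state h)" for h
  have lO: "lO \<in> strategies_O inputs outputs" using f state by (auto simp: strategies_O_def lO_def)
  have play: "ok (state (history_after lO lI n)) (outcome lO lI n)
      (state (history_after lO lI (Suc n)))"
    if lI: "lI \<in> strategies_I inputs outputs" for lI n
  proof -
    let ?h = "history_after lO lI n"
    have h: "?h \<in> histories inputs outputs" by (rule history_after_in_histories[OF lO lI])
    have "lI (?h, lO ?h) \<subseteq> inputs" by (rule strategy_I_subset[OF lI h strategy_O_subset[OF lO h]])
    then show ?thesis
      using g[OF state[OF h], of "lI (?h, lO ?h)"]
      by (simp add: outcome_def Let_def state_def lO_def)
  qed
  show ?thesis
  proof (rule that[OF lO])
    fix lI assume "lI \<in> strategies_I inputs outputs"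
    then show "\<exists>\<rho>. \<rho> 0 = m0 \<and> (\<forall>n. ok (\<rho> n) (outcome lO lI n) (\<rho> (Suc n)))"
      by (intro exI[of _ "\<lambda>n. state (history_after lO lI n)"] conjI allI play) (simp add: state_def)
  qed
qed

lemma I_controller_strategy:
  assumes "I_controller inputs outputs S ok" and m0: "m0 \<in> S"
  obtains lI where "lI \<in> strategies_I inputs outputs"
    "\<And>lO. lO \<in> strategies_O inputs outputs \<Longrightarrow>
      \<exists>\<rho>. \<rho> 0 = m0 \<and> (\<forall>n. ok (\<rho> n) (outcome lO lI n) (\<rho> (Suc n)))"
proof -
  obtain f where f: "\<And>m a. m \<in> S \<Longrightarrow> a \<subseteq> outputs \<Longrightarrow>
      f m a \<subseteq> inputs \<and> (\<exists>m'\<in>S. ok m (a \<union> f m a) m')"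
    using assms(1) unfolding I_controller_def by metis
  then obtain g where
    g: "\<And>m a. m \<in> S \<Longrightarrow> a \<subseteq> outputs \<Longrightarrow> g m a \<in> S \<and> ok m (a \<union> f m a) (g m a)" by metis
  define state where "state = foldl (\<lambda>m (a, i :: 'a set). g m a) m0"
  have state: "state h \<in> S" if "h \<in> histories inputs outputs" for h
    using that by (induction h rule: rev_induct) (auto simp: state_def m0 histories_def g)
  define lI where "lI = (\<lambda>(h, a). f (state h) a)"
  have lI: "lI \<in> strategies_I inputs outputs" using f state by (auto simp: strategies_I_def lI_def)
  have play: "ok (state (history_after lO lI n)) (outcome lO lI n)
      (state (history_after lO lI (Suc n)))"
    if lO: "lO \<in> strategies_O inputs outputs" for lO n
  proof -
    let ?h = "history_after lO lI n"
    have h: "?h \<in> histories inputs outputs" by (rule history_after_in_histories[OF lO lI])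
    then show ?thesis
      using g[OF state[OF h] strategy_O_subset[OF lO h]]
      by (simp add: outcome_def Let_def state_def lI_def)
  qed
  show ?thesis
  proof (rule that[OF lI])
    fix lO assume "lO \<in> strategies_O inputs outputs"
    then show "\<exists>\<rho>. \<rho> 0 = m0 \<and> (\<forall>n. ok (\<rho> n) (outcome lO lI n) (\<rho> (Suc n)))"
      by (intro exI[of _ "\<lambda>n. state (history_after lO lI n)"] conjI allI play) (simp add: state_def)
  qed
qed

text \<open>A progress measure on the product of a controller with the tableau, indexed by the state of
  the controller, the guess and the obligation waited for. Rank \<open>0\<close> marks the irrelevant triples.\<close>

definition measure_step ::
  "nat \<Rightarrow> ('m \<Rightarrow> nat set \<Rightarrow> nat \<Rightarrow> nat) \<Rightarrow> ('m \<Rightarrow> nat set \<Rightarrow> nat \<Rightarrow> nat) \<Rightarrow> int \<Rightarrow>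
   'm \<Rightarrow> nat set \<Rightarrow> 'm \<Rightarrow> bool" where
  "measure_step N \<kappa> \<pi> c m x m' \<longleftrightarrow> (\<forall>A\<subseteq>{..N}. \<forall>A'\<subseteq>{..N}. \<forall>j\<le>N.
     tableau_step N A x A' \<longrightarrow> 0 < \<kappa> m A j \<longrightarrow>
     0 < \<kappa> m' A' (next_index N A j) \<and>
     progress_step (\<kappa> m A j) (\<kappa> m' A' (next_index N A j))
       (int (\<pi> m A j)) (int (\<pi> m' A' (next_index N A j))) c (accepting N A j))"

definition letter_energy :: "'p set \<Rightarrow> 'p set \<Rightarrow> ('p literal \<Rightarrow> int) \<Rightarrow> 'p set \<Rightarrow> int" where
  "letter_energy inputs outputs w x =
     letter_weight w outputs (x \<inter> outputs) + letter_weight w inputs (x \<inter> inputs)"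

definition realizability_certificate ::
  "nat set \<Rightarrow> nat set \<Rightarrow> (nat literal \<Rightarrow> int) \<Rightarrow> nat \<Rightarrow> 'm set \<Rightarrow> 'm \<Rightarrow> ('m \<Rightarrow> nat) \<Rightarrow>
   ('m \<Rightarrow> nat set \<Rightarrow> nat \<Rightarrow> nat) \<Rightarrow> ('m \<Rightarrow> nat set \<Rightarrow> nat \<Rightarrow> nat) \<Rightarrow> bool" where
  "realizability_certificate inputs outputs w N S m0 e \<kappa> \<pi> \<longleftrightarrow>
     m0 \<in> S \<and> (\<forall>A\<subseteq>{..N}. N \<notin> A \<longrightarrow> 0 < \<kappa> m0 A 0) \<and>
     O_controller inputs outputs S (\<lambda>m x m'.
       int (e m') \<le> int (e m) + letter_energy inputs outputs w x \<and> measure_step N \<kappa> \<pi> 0 m x m')"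

definition unrealizability_certificate ::
  "nat set \<Rightarrow> nat set \<Rightarrow> (nat literal \<Rightarrow> int) \<Rightarrow> nat \<Rightarrow> 'm set \<Rightarrow> 'm \<Rightarrow> nat \<Rightarrow>
   ('m \<Rightarrow> nat set \<Rightarrow> nat \<Rightarrow> nat) \<Rightarrow> ('m \<Rightarrow> nat set \<Rightarrow> nat \<Rightarrow> nat) \<Rightarrow> bool" where
  "unrealizability_certificate inputs outputs w N S m0 C \<kappa> \<pi> \<longleftrightarrow>
     m0 \<in> S \<and> 0 < C \<and> (\<forall>A\<subseteq>{..N}. N \<in> A \<longrightarrow> 0 < \<kappa> m0 A 0) \<and>
     I_controller inputs outputs S (\<lambda>m x m'.
       measure_step N \<kappa> \<pi> (int C * letter_energy inputs outputs w x) m x m')"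

lemma energy_level_eq_sum:
  "energy_level inputs outputs w u n = (\<Sum>k<n. letter_energy inputs outputs w (u k))"
  by (simp add: energy_level_def letter_energy_def)

lemma measure_step_cost_unbounded:
  assumes C: "0 < C" and step: "\<And>n. measure_step N \<kappa> \<pi> (int C * c n) (m n) (u n) (m (Suc n))"
    and init: "0 < \<kappa> (m 0) (true_codes N u 0) 0"
  shows "\<exists>n. (\<Sum>k<n. c k) < b"
proof -
  define A where "A = true_codes N u"
  define j where "j = rec_nat 0 (\<lambda>n. next_index N (A n))"
  have j: "j 0 = 0" "j (Suc n) = next_index N (A n) (j n)" for n by (simp_all add: j_def)
  have j_le: "j n \<le> N" for n by (induction n) (simp_all add: j next_index_le)
  have tableau: "tableau_step N (A n) (u n) (A (Suc n))" for n
    using true_codes_tableau_step by (simp add: A_def)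
  have "\<exists>\<^sub>\<infinity>n. accepting N (A n) (j n)"
    by (rule fair_imp_accepting) (use j true_codes_fair A_def in auto)
  moreover have "0 < \<kappa> (m n) (A n) (j n)" for n
  proof (induction n)
    case (Suc n)
    then show ?case
      using step[of n] tableau[of n] j_le[of n] unfolding measure_step_def A_def j(2)
      by (simp add: true_codes_subset)
  qed (use init A_def j(1) in simp)
  then have "progress_step (\<kappa> (m n) (A n) (j n)) (\<kappa> (m (Suc n)) (A (Suc n)) (j (Suc n)))
      (int (\<pi> (m n) (A n) (j n))) (int (\<pi> (m (Suc n)) (A (Suc n)) (j (Suc n))))
      (int C * c n) (accepting N (A n) (j n))" for n
    using step[of n] tableau[of n] j_le[of n] unfolding measure_step_def A_def j(2)
    by (simp add: true_codes_subset)
  ultimately show ?thesis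
    using C
    by (intro progress_cost_unbounded[where C = "int C" and acc = "\<lambda>n. accepting N (A n) (j n)"
          and k = "\<lambda>n. \<kappa> (m n) (A n) (j n)" and p = "\<lambda>n. int (\<pi> (m n) (A n) (j n))"]) simp_all
qed

lemma realizability_certificate_sound:
  assumes "realizability_certificate inputs outputs w N S m0 e \<kappa> \<pi>"
  shows "E_realizable inputs outputs w (decode_ltl N)"
proof -
  have m0: "m0 \<in> S" and init: "\<And>A. A \<subseteq> {..N} \<Longrightarrow> N \<notin> A \<Longrightarrow> 0 < \<kappa> m0 A 0"
    and controller: "O_controller inputs outputs S (\<lambda>m x m'.
      int (e m') \<le> int (e m) + letter_energy inputs outputs w x \<and> measure_step N \<kappa> \<pi> 0 m x m')"
    using assms unfolding realizability_certificate_def by blast+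
  obtain lO where lO: "lO \<in> strategies_O inputs outputs"
    and play: "\<And>lI. lI \<in> strategies_I inputs outputs \<Longrightarrow> \<exists>\<rho>. \<rho> 0 = m0 \<and> (\<forall>n.
      int (e (\<rho> (Suc n))) \<le> int (e (\<rho> n)) + letter_energy inputs outputs w (outcome lO lI n) \<and>
      measure_step N \<kappa> \<pi> 0 (\<rho> n) (outcome lO lI n) (\<rho> (Suc n)))"
    by (rule O_controller_strategy[OF controller m0]) blast
  show ?thesis
    unfolding E_realizable_def
  proof (intro bexI[OF _ lO] exI[of _ "e m0"] ballI conjI allI)
    fix lI assume "lI \<in> strategies_I inputs outputs"
    then obtain \<rho> where \<rho>: "\<rho> 0 = m0"
      "\<And>n. int (e (\<rho> (Suc n))) \<le> int (e (\<rho> n)) + letter_energy inputs outputs w (outcome lO lI n)"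
      "\<And>n. measure_step N \<kappa> \<pi> 0 (\<rho> n) (outcome lO lI n) (\<rho> (Suc n))"
      using play by metis
    show "models (outcome lO lI) (decode_ltl N)"
    proof (rule ccontr)
      assume "\<not> ?thesis"
      then have "0 < \<kappa> (\<rho> 0) (true_codes N (outcome lO lI) 0) 0"
        unfolding \<rho>(1) by (intro init) (auto simp: true_codes_def truth_def models_def)
      then show False
        using measure_step_cost_unbounded[of 1 N \<kappa> \<pi> "\<lambda>_. 0" \<rho> "outcome lO lI" 0] \<rho>(3) by simp
    qed
    fix n
    have "int (e (\<rho> n)) \<le> int (e m0) + energy_level inputs outputs w (outcome lO lI) n"
    proof (induction n)
      case (Suc n)
      then show ?case using \<rho>(2)[of n] by (simp add: energy_level_eq_sum)
    qed (simp add: \<rho>(1) energy_level_eq_sum)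
    then show "0 \<le> int (e m0) + energy_level inputs outputs w (outcome lO lI) n"
      by (rule order_trans[rotated]) simp
  qed
qed

lemma unrealizability_certificate_sound:
  assumes "unrealizability_certificate inputs outputs w N S m0 C \<kappa> \<pi>"
  shows "\<not> E_realizable inputs outputs w (decode_ltl N)"
proof
  assume "E_realizable inputs outputs w (decode_ltl N)"
  then obtain lO c0 where lO: "lO \<in> strategies_O inputs outputs"
    and win: "\<And>lI. lI \<in> strategies_I inputs outputs \<Longrightarrow> models (outcome lO lI) (decode_ltl N) \<and>
        (\<forall>n. int c0 + energy_level inputs outputs w (outcome lO lI) n \<ge> 0)"
    unfolding E_realizable_def by blast
  have m0: "m0 \<in> S" and C: "0 < C" and init: "\<And>A. A \<subseteq> {..N} \<Longrightarrow> N \<in> A \<Longrightarrow> 0 < \<kappa> m0 A 0"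
    and controller: "I_controller inputs outputs S (\<lambda>m x m'.
      measure_step N \<kappa> \<pi> (int C * letter_energy inputs outputs w x) m x m')"
    using assms unfolding unrealizability_certificate_def by blast+
  obtain lI where lI: "lI \<in> strategies_I inputs outputs"
    and play: "\<And>lO. lO \<in> strategies_O inputs outputs \<Longrightarrow> \<exists>\<rho>. \<rho> 0 = m0 \<and> (\<forall>n.
      measure_step N \<kappa> \<pi> (int C * letter_energy inputs outputs w (outcome lO lI n))
        (\<rho> n) (outcome lO lI n) (\<rho> (Suc n)))"
    by (rule I_controller_strategy[OF controller m0]) blast
  let ?u = "outcome lO lI"
  obtain \<rho> where \<rho>: "\<rho> 0 = m0"
    "\<And>n. measure_step N \<kappa> \<pi> (int C * letter_energy inputs outputs w (?u n))
      (\<rho> n) (?u n) (\<rho> (Suc n))"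
    using play[OF lO] by blast
  have "0 < \<kappa> (\<rho> 0) (true_codes N ?u 0) 0"
    unfolding \<rho>(1) using win[OF lI]
    by (intro init true_codes_subset) (simp add: true_codes_def truth_def models_def)
  then obtain n where "(\<Sum>k<n. letter_energy inputs outputs w (?u k)) < - int c0"
    using measure_step_cost_unbounded[of C N \<kappa> \<pi> "\<lambda>n. letter_energy inputs outputs w (?u n)" \<rho> ?u]
      C \<rho>(2) by blast
  then show False
    using conjunct2[OF win[OF lI], rule_format, of n] by (simp add: energy_level_eq_sum)
qed

section \<open>Existence of certificates\<close>

definition tableau_product ::
  "nat \<Rightarrow> ('m \<times> 'm) set \<Rightarrow> ('m \<Rightarrow> nat set) \<Rightarrow> (('m \<times> nat set \<times> nat) \<times> ('m \<times> nat set \<times> nat)) set" where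
  "tableau_product N H letter = {((x, A, j), (z, A', j')) |x A j z A' j'.
     (x, z) \<in> H \<and> A \<subseteq> {..N} \<and> A' \<subseteq> {..N} \<and> j \<le> N \<and> j' = next_index N A j \<and>
     tableau_step N A (letter z) A'}"

lemma tableau_product_subset:
  "H \<subseteq> S \<times> S \<Longrightarrow>
    tableau_product N H letter \<subseteq> (S \<times> Pow {..N} \<times> {..N}) \<times> (S \<times> Pow {..N} \<times> {..N})"
  by (auto simp: tableau_product_def next_index_le)

lemma walk_tableau_product_fst:
  "walk (tableau_product N H letter) v cs v' \<Longrightarrow> walk H (fst v) (map fst cs) (fst v')"
  by (rule walk_map) (auto simp: tableau_product_def)

text \<open>The measure is defined on the part of the product that is reachable from \<open>x0\<close> with an initial
  guess in \<open>I\<close>, and its ranks are increased to make them positive there.\<close>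

lemma tableau_measure_exists:
  fixes \<omega> :: "'m \<Rightarrow> int"
  assumes fin: "finite S" and H: "H \<subseteq> S \<times> S"
    and neg: "\<And>A ss v cs. A \<in> I \<Longrightarrow> walk (tableau_product N H letter) (x0, A, 0) ss v \<Longrightarrow>
      walk (tableau_product N H letter) v cs v \<Longrightarrow> \<exists>(x, A, j)\<in>set cs. accepting N A j \<Longrightarrow>
      (\<Sum>x\<leftarrow>map fst cs. \<omega> x) < 0"
  obtains \<kappa> \<pi> :: "'m \<Rightarrow> nat set \<Rightarrow> nat \<Rightarrow> nat" and C where "0 < C" "\<forall>A\<in>I. 0 < \<kappa> x0 A 0"
    "\<forall>(m, m')\<in>H. measure_step N \<kappa> \<pi> (int C * \<omega> m') m (letter m') m'"
proof -
  define T where "T = tableau_product N H letter"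
  define R where "R = T\<^sup>* `` ((\<lambda>A. (x0, A, 0)) ` I)"
  define V where "V = S \<times> Pow {..N} \<times> {..N}"
  let ?T = "{(a, b) \<in> T. a \<in> R}" and ?acc = "\<lambda>(x :: 'm, A, j). accepting N A j"
  have "finite V" using fin by (simp add: V_def)
  moreover have "?T \<subseteq> V \<times> V"
    using tableau_product_subset[OF H, of N letter] unfolding T_def V_def by blast
  moreover have "sum_list (map (\<omega> \<circ> fst) cs) < 0"
    if cs: "walk ?T v cs v" "\<exists>z\<in>set cs. ?acc z" for v cs
  proof -
    have "v \<in> R" using cs by (cases cs) auto
    then obtain A where A: "A \<in> I" "((x0, A, 0), v) \<in> T\<^sup>*" by (auto simp: R_def)
    obtain ss where ss: "walk T (x0, A, 0) ss v" using A(2) by (rule rtrancl_imp_walk)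
    have "walk T v cs v" using cs(1) by (rule walk_mono) auto
    then have "(\<Sum>x\<leftarrow>map fst cs. \<omega> x) < 0" using neg[OF A(1)] ss cs(2) by (simp add: T_def)
    then show ?thesis by simp
  qed
  ultimately obtain \<kappa> \<pi> :: "'m \<times> nat set \<times> nat \<Rightarrow> nat" and C :: nat where C: "0 < C"
    and step: "\<And>v v'. (v, v') \<in> ?T \<Longrightarrow> progress_step (\<kappa> v) (\<kappa> v') (int (\<pi> v)) (int (\<pi> v'))
      (int C * (\<omega> \<circ> fst) v') (?acc v)"
    by (rule nat_progress_measure_exists[of V ?T ?acc "\<omega> \<circ> fst"]) blast+
  define \<kappa>' where "\<kappa>' m A j = (if (m, A, j) \<in> R then \<kappa> (m, A, j) + 2 else 0)" for m A j
  have "measure_step N \<kappa>' (\<lambda>m A j. \<pi> (m, A, j)) (int C * \<omega> m') m (letter m') m'"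
    if mm': "(m, m') \<in> H" for m m'
    unfolding measure_step_def
  proof (intro allI impI)
    fix A A' j assume a: "A \<subseteq> {..N}" "A' \<subseteq> {..N}" "j \<le> N" "tableau_step N A (letter m') A'"
      "0 < \<kappa>' m A j"
    let ?v = "(m, A, j)" and ?v' = "(m', A', next_index N A j)"
    have R: "?v \<in> R" using a(5) by (auto simp: \<kappa>'_def split: if_splits)
    have T: "(?v, ?v') \<in> T" using a mm' by (auto simp: T_def tableau_product_def)
    then have R': "?v' \<in> R" using R unfolding R_def by (auto intro: rtrancl_into_rtrancl)
    show "0 < \<kappa>' m' A' (next_index N A j) \<and> progress_step (\<kappa>' m A j) (\<kappa>' m' A' (next_index N A j))
        (int (\<pi> ?v)) (int (\<pi> ?v')) (int C * \<omega> m') (accepting N A j)"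
      using step[of ?v ?v'] T R R' by (auto simp: \<kappa>'_def progress_step_def)
  qed
  moreover have "\<forall>A\<in>I. 0 < \<kappa>' x0 A 0" by (auto simp: \<kappa>'_def R_def)
  ultimately show ?thesis using C by (intro that[of C \<kappa>' "\<lambda>m A j. \<pi> (m, A, j)"]) auto
qed

text \<open>Besides the state of the automaton, a position records the last letter, or the part of it
  chosen so far, and the priority seen when the last complete letter was read.\<close>

datatype 'q position =
    is_Output: Output_turn (pos_state: 'q) (pos_letter: "nat set") (pos_priority: nat)
  | Input_turn (pos_state: 'q) (pos_letter: "nat set") (pos_priority: nat)

locale ltl_automaton = parity_automaton Q q0 \<delta> prio B "\<lambda>u. truth u 0 N"
  for Q :: "'q set" and q0 and \<delta> :: "'q \<Rightarrow> nat set \<Rightarrow> 'q" and prio B N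
begin

definition follows :: "'q position \<Rightarrow> 'q position \<Rightarrow> bool" where
  "follows v v' \<longleftrightarrow> pos_state v' = \<delta> (pos_state v) (pos_letter v') \<and>
     pos_priority v' = prio (pos_state v) (pos_letter v')"

end

locale automaton_controller = ltl_automaton Q q0 \<delta> prio B N
  for Q :: "'q set" and q0 and \<delta> :: "'q \<Rightarrow> nat set \<Rightarrow> 'q" and prio B N +
  fixes S :: "'m set" and H :: "('m \<times> 'm) set" and x0 :: 'm and pos :: "'m \<Rightarrow> 'q position"
  assumes finite_controller: "finite S" and moves: "H \<subseteq> S \<times> S"
    and start: "pos_state (pos x0) = q0" and follows: "(x, z) \<in> H \<Longrightarrow> follows (pos x) (pos z)"
begin

definition letter :: "'m \<Rightarrow> nat set" where "letter x = pos_letter (pos x)"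
definition priority :: "'m \<Rightarrow> nat" where "priority x = pos_priority (pos x)"

lemma prio_run_letter:
  assumes "X 0 = x0" and "\<And>n. (X n, X (Suc n)) \<in> H"
  shows "prio (run \<delta> q0 (\<lambda>n. letter (X (Suc n))) n) (letter (X (Suc n))) = priority (X (Suc n))"
proof -
  note step = follows[OF assms(2), unfolded follows_def]
  have "run \<delta> q0 (\<lambda>n. letter (X (Suc n))) n = pos_state (pos (X n))"
    by (induction n) (simp_all add: assms(1) start step letter_def)
  then show ?thesis by (simp add: step letter_def priority_def)
qed

lemma limit_comp_lasso:
  assumes "cs \<noteq> []" shows "limit (f \<circ> (ss \<frown> cs\<^sup>\<omega>)) = f ` set cs"
proof -
  have "f \<circ> cs\<^sup>\<omega> = (map f cs)\<^sup>\<omega>" using assms by (auto simp: fun_eq_iff)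
  then show ?thesis using assms by simp
qed

lemma tableau_product_lasso:
  assumes stem: "walk (tableau_product N H letter) (x0, A, 0) ss v"
    and cycle: "walk (tableau_product N H letter) v cs v"
    and acc: "\<exists>(x, A, j)\<in>set cs. accepting N A j"
  shows "N \<in> A \<longleftrightarrow> even (Min (priority ` fst ` set cs))"
proof -
  have ne: "cs \<noteq> []" using acc by auto
  define \<rho> where "\<rho> = ss \<frown> cs\<^sup>\<omega>"
  note loop = infinite_path_iter[OF cycle ne]
  have stem': "walk (tableau_product N H letter) (x0, A, 0) ss (cs\<^sup>\<omega> 0)"
    using stem by (simp only: loop(2))
  have \<rho>0: "\<rho> 0 = (x0, A, 0)" unfolding \<rho>_def using stem' by (rule conc_start)
  have "infinite_path (tableau_product N H letter) \<rho>"
    unfolding \<rho>_def using stem' loop(1) by (rule infinite_path_conc)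
  then have \<rho>: "(\<rho> n, \<rho> (Suc n)) \<in> tableau_product N H letter" for n by (rule infinite_pathD)
  define X G j where "X n = fst (\<rho> n)" and "G n = fst (snd (\<rho> n))" and "j n = snd (snd (\<rho> n))" for n
  define u where "u n = letter (X (Suc n))" for n
  have edges: "(X n, X (Suc n)) \<in> H" "j (Suc n) = next_index N (G n) (j n)"
    "tableau_step N (G n) (u n) (G (Suc n))" for n
    using \<rho>[of n] by (auto simp: tableau_product_def X_def G_def j_def u_def)
  obtain z where z: "z \<in> set cs" "accepting N (fst (snd z)) (snd (snd z))" using acc by auto
  have "z \<in> limit \<rho>" using limit_comp_lasso[OF ne, of id ss] z(1) by (simp add: \<rho>_def)
  then have "\<exists>\<^sub>\<infinity>n. \<rho> n = z" by (simp add: limit_iff_frequent)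
  then have "\<exists>\<^sub>\<infinity>n. accepting N (G n) (j n)"
    by (rule INFM_mono) (use z(2) in \<open>auto simp: G_def j_def\<close>)
  then have "N \<in> G 0 \<longleftrightarrow> truth u 0 N"
    using fair_tableau_truth[of N G u N 0] accepting_imp_fair[of j N G] edges(2,3) by simp
  also have "\<dots> \<longleftrightarrow> even (Min (limit (\<lambda>n. prio (run \<delta> q0 u n) (u n))))" by (rule language)
  also have "(\<lambda>n. prio (run \<delta> q0 u n) (u n)) = suffix 1 (priority \<circ> fst \<circ> \<rho>)"
    using prio_run_letter[of X, OF _ edges(1)] \<rho>0 by (simp add: fun_eq_iff u_def[abs_def] X_def)
  also have "limit (suffix 1 (priority \<circ> fst \<circ> \<rho>)) = priority ` fst ` set cs"
    by (simp only: limit_suffix \<rho>_def limit_comp_lasso[OF ne] image_comp)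
  finally show ?thesis by (simp add: G_def \<rho>0)
qed

lemma realizability_measures_exist:
  fixes \<omega> :: "nat set \<Rightarrow> int"
  assumes good: "\<And>x xs. walk H x xs x \<Longrightarrow> xs \<noteq> [] \<Longrightarrow>
    0 \<le> (\<Sum>x\<leftarrow>xs. \<omega> (letter x)) \<and> even (Min (priority ` set xs))"
  obtains e :: "'m \<Rightarrow> nat" and \<kappa> \<pi> where "\<forall>A\<subseteq>{..N}. N \<notin> A \<longrightarrow> 0 < \<kappa> x0 A 0"
    "\<forall>(m, m')\<in>H.
      int (e m') \<le> int (e m) + \<omega> (letter m') \<and> measure_step N \<kappa> \<pi> 0 m (letter m') m'"
proof -
  have "(\<Sum>x\<leftarrow>xs. - \<omega> (letter x)) \<le> 0" if "walk H x xs x" "xs \<noteq> []" for x xs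
    using good[OF that] by (simp add: uminus_sum_list_map[symmetric, unfolded comp_def])
  then obtain \<eta> :: "'m \<Rightarrow> int" where \<eta>: "\<And>x y. (x, y) \<in> H \<Longrightarrow> \<eta> y + - \<omega> (letter x) \<le> \<eta> x"
    using potential_exists[OF finite_controller moves, of "\<lambda>x. - \<omega> (letter x)"] by metis
  obtain D where D: "\<And>x. x \<in> S \<Longrightarrow> 0 \<le> (\<eta> x + \<omega> (letter x)) + D"
    using finite_nonneg_shift[OF finite_controller, of "\<lambda>x. \<eta> x + \<omega> (letter x)"] by blast
  define e where "e x = nat (\<eta> x + \<omega> (letter x) + D)" for x
  have e: "int (e m') \<le> int (e m) + \<omega> (letter m')" if "(m, m') \<in> H" for m m'
    using that moves \<eta>[OF that] D[of m] D[of m'] by (auto simp: e_def)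
  have contradiction: "(\<Sum>x\<leftarrow>map fst cs. 0) < (0 :: int)"
    if A: "A \<in> {A. A \<subseteq> {..N} \<and> N \<notin> A}" and stem: "walk (tableau_product N H letter) (x0, A, 0) ss v"
      and cycle: "walk (tableau_product N H letter) v cs v"
      and acc: "\<exists>(x, A, j)\<in>set cs. accepting N A j" for A ss v cs
  proof -
    have "map fst cs \<noteq> []" using acc by auto
    then have "even (Min (priority ` set (map fst cs)))"
      using good[OF walk_tableau_product_fst[OF cycle]] by blast
    then show ?thesis using tableau_product_lasso[OF stem cycle acc] A by simp
  qed
  obtain \<kappa> \<pi> :: "'m \<Rightarrow> nat set \<Rightarrow> nat \<Rightarrow> nat" and C :: nat where
    "\<forall>A\<in>{A. A \<subseteq> {..N} \<and> N \<notin> A}. 0 < \<kappa> x0 A 0"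
    "\<forall>(m, m')\<in>H. measure_step N \<kappa> \<pi> (int C * 0) m (letter m') m'"
    by (rule tableau_measure_exists[OF finite_controller moves contradiction]) blast
  then show ?thesis using e by (intro that[of \<kappa> e \<pi>]) auto
qed

lemma unrealizability_measures_exist:
  fixes \<omega> :: "nat set \<Rightarrow> int"
  assumes bad: "\<And>x xs. walk H x xs x \<Longrightarrow> xs \<noteq> [] \<Longrightarrow> even (Min (priority ` set xs)) \<Longrightarrow>
    (\<Sum>x\<leftarrow>xs. \<omega> (letter x)) < 0"
  obtains C :: nat and \<kappa> \<pi> where "0 < C" "\<forall>A\<subseteq>{..N}. N \<in> A \<longrightarrow> 0 < \<kappa> x0 A 0"
    "\<forall>(m, m')\<in>H. measure_step N \<kappa> \<pi> (int C * \<omega> (letter m')) m (letter m') m'"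
proof -
  have negative: "(\<Sum>x\<leftarrow>map fst cs. \<omega> (letter x)) < 0"
    if A: "A \<in> {A. A \<subseteq> {..N} \<and> N \<in> A}" and stem: "walk (tableau_product N H letter) (x0, A, 0) ss v"
      and cycle: "walk (tableau_product N H letter) v cs v"
      and acc: "\<exists>(x, A, j)\<in>set cs. accepting N A j" for A ss v cs
  proof (rule bad[OF walk_tableau_product_fst[OF cycle]])
    show "map fst cs \<noteq> []" using acc by auto
    show "even (Min (priority ` set (map fst cs)))"
      using tableau_product_lasso[OF stem cycle acc] A by simp
  qed
  obtain \<kappa> \<pi> :: "'m \<Rightarrow> nat set \<Rightarrow> nat \<Rightarrow> nat" and C :: nat where "0 < C"
    "\<forall>A\<in>{A. A \<subseteq> {..N} \<and> N \<in> A}. 0 < \<kappa> x0 A 0"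
    "\<forall>(m, m')\<in>H. measure_step N \<kappa> \<pi> (int C * \<omega> (letter m')) m (letter m') m'"
    by (rule tableau_measure_exists[OF finite_controller moves negative]) blast
  then show ?thesis by (intro that[of C \<kappa> \<pi>]) auto
qed

end

section \<open>The energy parity game of a specification\<close>

lemma O_controller_of_graph:
  assumes H: "H \<subseteq> S \<times> S" and ok: "\<And>m m'. (m, m') \<in> H \<Longrightarrow> ok m (letter m') m'"
    and answer: "\<And>m. m \<in> S \<Longrightarrow> \<exists>a\<subseteq>outputs. \<forall>i\<subseteq>inputs. \<exists>m'. (m, m') \<in> H \<and> letter m' = a \<union> i"
  shows "O_controller inputs outputs S ok"
  unfolding O_controller_def
proof
  fix m assume m: "m \<in> S"
  obtain a where a: "a \<subseteq> outputs" "\<forall>i\<subseteq>inputs. \<exists>m'. (m, m') \<in> H \<and> letter m' = a \<union> i"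
    using answer[OF m] by metis
  have "\<exists>m'\<in>S. ok m (a \<union> i) m'" if i: "i \<subseteq> inputs" for i
  proof -
    obtain m' where m': "(m, m') \<in> H" "letter m' = a \<union> i" using a(2) i by metis
    have "m' \<in> S" using H m'(1) by blast
    then show ?thesis using ok[OF m'(1)] unfolding m'(2) by (rule bexI[rotated])
  qed
  then show "\<exists>a\<subseteq>outputs. \<forall>i\<subseteq>inputs. \<exists>m'\<in>S. ok m (a \<union> i) m'" using a(1) by blast
qed

lemma I_controller_of_graph:
  assumes H: "H \<subseteq> S \<times> S" and ok: "\<And>m m'. (m, m') \<in> H \<Longrightarrow> ok m (letter m') m'"
    and answer: "\<And>m a. m \<in> S \<Longrightarrow> a \<subseteq> outputs \<Longrightarrow> \<exists>i\<subseteq>inputs. \<exists>m'. (m, m') \<in> H \<and> letter m' = a \<union> i"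
  shows "I_controller inputs outputs S ok"
  unfolding I_controller_def
proof (intro ballI allI impI)
  fix m a assume m: "m \<in> S" and a: "a \<subseteq> outputs"
  obtain i m' where m': "i \<subseteq> inputs" "(m, m') \<in> H" "letter m' = a \<union> i"
    using answer[OF m a] by metis
  have "m' \<in> S" using H m'(2) by blast
  then show "\<exists>i\<subseteq>inputs. \<exists>m'\<in>S. ok m (a \<union> i) m'" using ok[OF m'(2)] m'(1) unfolding m'(3) by metis
qed

definition round_graph :: "('m \<times> 'm) set \<Rightarrow> ('m \<Rightarrow> 'q position) \<Rightarrow> ('m \<times> 'm) set" where
  "round_graph F pos = {(x, z). \<exists>y. (x, y) \<in> F \<and> (y, z) \<in> F \<and> is_Output (pos x)}"

locale energy_arena = ltl_automaton Q q0 \<delta> prio B N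
  for Q :: "'q set" and q0 and \<delta> :: "'q \<Rightarrow> nat set \<Rightarrow> 'q" and prio B N +
  fixes inputs outputs :: "nat set" and w :: "nat literal \<Rightarrow> int"
  assumes finite_inputs: "finite inputs" and finite_outputs: "finite outputs"
begin

definition arena_weight :: "'q position \<Rightarrow> int" where
  "arena_weight v = (if is_Output v then letter_energy inputs outputs w (pos_letter v) else 0)"

lemma arena_weight_simps [simp]:
  "arena_weight (Output_turn q x p) = letter_energy inputs outputs w x"
  "arena_weight (Input_turn q a p) = 0"
  by (simp_all add: arena_weight_def)

definition arena_vertices :: "'q position set" where
  "arena_vertices =
     (\<lambda>(q, a, p). Output_turn q a p) ` (Q \<times> Pow (inputs \<union> outputs) \<times> {..B}) \<union>
     (\<lambda>(q, a, p). Input_turn q a p) ` (Q \<times> Pow outputs \<times> {..B})"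

definition arena_edges :: "('q position \<times> 'q position) set" where
  "arena_edges =
     {(Output_turn q x p, Input_turn q a p) |q x p a.
        q \<in> Q \<and> x \<subseteq> inputs \<union> outputs \<and> p \<le> B \<and> a \<subseteq> outputs} \<union>
     {(Input_turn q a p, Output_turn (\<delta> q (a \<union> i)) (a \<union> i) (prio q (a \<union> i))) |q a p i.
        q \<in> Q \<and> a \<subseteq> outputs \<and> p \<le> B \<and> i \<subseteq> inputs}"

definition arena_init :: "'q position" where
  "arena_init = Output_turn q0 {} 0"

definition input_turns :: "'q position set" where
  "input_turns = {v. \<not> is_Output v}"

lemma finite_arena_vertices: "finite arena_vertices"
  using finite_states finite_inputs finite_outputs by (simp add: arena_vertices_def)

lemma arena_init_vertex: "arena_init \<in> arena_vertices"
  using initial_state by (force simp: arena_init_def arena_vertices_def)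

lemma arena_edges_subset: "arena_edges \<subseteq> arena_vertices \<times> arena_vertices"
proof -
  have out_vertex: "Output_turn q x p \<in> arena_vertices"
    if "q \<in> Q" "x \<subseteq> inputs \<union> outputs" "p \<le> B" for q x p
    unfolding arena_vertices_def using that
    by (intro UnI1 image_eqI[of _ _ "(q, x, p)"]) simp_all
  have in_vertex: "Input_turn q a p \<in> arena_vertices" if "q \<in> Q" "a \<subseteq> outputs" "p \<le> B" for q a p
    unfolding arena_vertices_def using that
    by (intro UnI2 image_eqI[of _ _ "(q, a, p)"]) simp_all
  show ?thesis
    unfolding arena_edges_def by (auto intro!: out_vertex in_vertex step_state prio_le)
qed

lemma arena_edges_total:
  assumes "v \<in> arena_vertices"
  shows "\<exists>v'. (v, v') \<in> arena_edges"
proof -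
  from assms consider
      (output_turn) q x p where "v = Output_turn q x p" "q \<in> Q" "x \<subseteq> inputs \<union> outputs" "p \<le> B"
    | (input_turn) q a p where "v = Input_turn q a p" "q \<in> Q" "a \<subseteq> outputs" "p \<le> B"
    by (auto simp: arena_vertices_def)
  then show ?thesis
  proof cases
    case output_turn
    then have "(v, Input_turn q {} p) \<in> arena_edges" by (auto simp: arena_edges_def)
    then show ?thesis ..
  next
    case input_turn
    then have "(v, Output_turn (\<delta> q (a \<union> {})) (a \<union> {}) (prio q (a \<union> {}))) \<in> arena_edges"
      unfolding arena_edges_def by blast
    then show ?thesis ..
  qed
qed

lemma output_edge_cases:
  assumes "(v, v') \<in> arena_edges" "is_Output v"
  obtains q x p a where "v = Output_turn q x p" "v' = Input_turn q a p"
    "q \<in> Q" "a \<subseteq> outputs" "p \<le> B"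
  using assms by (auto simp: arena_edges_def)

lemma input_edge_cases:
  assumes "(Input_turn q a p, v') \<in> arena_edges"
  obtains i where "v' = Output_turn (\<delta> q (a \<union> i)) (a \<union> i) (prio q (a \<union> i))" "i \<subseteq> inputs"
  using assms by (auto simp: arena_edges_def)

end

text \<open>A graph \<open>F\<close> of single turns in the arena, reached from the initial position \<open>x0\<close>; both
  finite-memory strategies of the output player and positional ones of the input player are such.\<close>

locale turn_graph = energy_arena Q q0 \<delta> prio B N inputs outputs w
  for Q :: "'q set" and q0 and \<delta> :: "'q \<Rightarrow> nat set \<Rightarrow> 'q" and prio B N inputs outputs w +
  fixes X :: "'m set" and F :: "('m \<times> 'm) set" and pos :: "'m \<Rightarrow> 'q position" and x0 :: 'm
  assumes finite_turns: "finite X" and turns: "F \<subseteq> X \<times> X"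
    and turn_edge: "(x, y) \<in> F \<Longrightarrow> (pos x, pos y) \<in> arena_edges"
    and first: "x0 \<in> X" "pos x0 = arena_init"
begin

definition controller_states :: "'m set" where
  "controller_states = {x \<in> X. is_Output (pos x)}"

lemma initial_controller_state: "x0 \<in> controller_states"
  using first by (simp add: controller_states_def arena_init_def)

lemma round_cases:
  assumes "(x, z) \<in> round_graph F pos"
  obtains y q u p a i where "(x, y) \<in> F" "(y, z) \<in> F" "pos x = Output_turn q u p"
    "pos y = Input_turn q a p" "pos z = Output_turn (\<delta> q (a \<union> i)) (a \<union> i) (prio q (a \<union> i))"
proof -
  obtain y where y: "(x, y) \<in> F" "(y, z) \<in> F" "is_Output (pos x)"
    using assms by (auto simp: round_graph_def)
  obtain q u p a where xy: "pos x = Output_turn q u p" "pos y = Input_turn q a p"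
    using turn_edge[OF y(1)] y(3) by (rule output_edge_cases)
  obtain i where "pos z = Output_turn (\<delta> q (a \<union> i)) (a \<union> i) (prio q (a \<union> i))"
    using turn_edge[OF y(2)] unfolding xy(2) by (rule input_edge_cases)
  then show ?thesis using that y(1,2) xy by blast
qed

lemma round_graph_subset: "round_graph F pos \<subseteq> controller_states \<times> controller_states"
proof (intro subrelI SigmaI)
  fix x z assume "(x, z) \<in> round_graph F pos"
  then show "x \<in> controller_states" "z \<in> controller_states"
    using turns by (elim round_cases; force simp: controller_states_def)+
qed

sublocale automaton_controller Q q0 \<delta> prio B N controller_states "round_graph F pos" x0 pos
proof
  show "finite controller_states" using finite_turns by (simp add: controller_states_def)
  show "pos_state (pos x0) = q0" by (simp add: first arena_init_def)
  show "follows (pos x) (pos z)" if "(x, z) \<in> round_graph F pos" for x z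
    using that by (elim round_cases) (simp add: follows_def)
qed (rule round_graph_subset)

lemma walk_of_rounds:
  assumes "walk (round_graph F pos) x xs z"
  obtains ys where "walk F x ys z" "ys = [] \<longleftrightarrow> xs = []"
    "sum_list (map arena_weight (map pos ys)) =
      (\<Sum>x\<leftarrow>xs. letter_energy inputs outputs w (letter x))"
    "pos_priority ` pos ` set ys = priority ` set xs"
  using assms
proof (induction arbitrary: thesis rule: walk.induct)
  case (walk_Nil x)
  show ?case by (rule walk_Nil[of "[]"]) simp_all
next
  case (walk_Cons x z xs t)
  obtain ys where ys: "walk F z ys t"
    "sum_list (map arena_weight (map pos ys)) =
      (\<Sum>x\<leftarrow>xs. letter_energy inputs outputs w (letter x))"
    "pos_priority ` pos ` set ys = priority ` set xs" by (rule walk_Cons.IH)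
  obtain y q u p a where y: "(x, y) \<in> F" "(y, z) \<in> F" "pos x = Output_turn q u p"
    "pos y = Input_turn q a p" using walk_Cons.hyps(1) by (rule round_cases)
  show ?case
  proof (rule walk_Cons.prems[of "x # y # ys"])
    show "walk F x (x # y # ys) t" using y(1,2) ys(1) by auto
  qed (use y(3,4) ys(2,3) in \<open>simp_all add: letter_def priority_def\<close>)
qed

lemma closed_walk_of_rounds:
  assumes "walk (round_graph F pos) x xs x" "xs \<noteq> []"
  obtains ys where "walk F x ys x" "ys \<noteq> []"
    "good_cycle arena_weight pos_priority (map pos ys) \<longleftrightarrow>
      0 \<le> (\<Sum>x\<leftarrow>xs. letter_energy inputs outputs w (letter x)) \<and> even (Min (priority ` set xs))"
proof -
  obtain ys where "walk F x ys x" "ys = [] \<longleftrightarrow> xs = []"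
    "sum_list (map arena_weight (map pos ys)) =
      (\<Sum>x\<leftarrow>xs. letter_energy inputs outputs w (letter x))"
    "pos_priority ` pos ` set ys = priority ` set xs"
    using assms(1) by (rule walk_of_rounds)
  then show ?thesis using that assms(2) unfolding good_cycle_def by simp
qed

end

context energy_arena
begin

lemma strategy_graph_answers:
  assumes "strategy_graph input_turns arena_weight pos_priority arena_edges X F pos"
    and m: "m \<in> X" "is_Output (pos m)"
  shows "\<exists>a\<subseteq>outputs. \<forall>i\<subseteq>inputs. \<exists>z. (m, z) \<in> round_graph F pos \<and> pos_letter (pos z) = a \<union> i"
proof -
  interpret strategy_graph input_turns arena_weight pos_priority arena_edges X F pos by fact
  obtain y where y: "(m, y) \<in> F" using moves_total[OF m(1)] by blast
  obtain q u p a where edge: "pos m = Output_turn q u p" "pos y = Input_turn q a p" "q \<in> Q"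
    "a \<subseteq> outputs" "p \<le> B" using moves_edges[OF y] m(2) by (rule output_edge_cases)
  have "\<exists>z. (m, z) \<in> round_graph F pos \<and> pos_letter (pos z) = a \<union> i" if i: "i \<subseteq> inputs" for i
  proof -
    let ?v = "Output_turn (\<delta> q (a \<union> i)) (a \<union> i) (prio q (a \<union> i))"
    have "(pos y, ?v) \<in> arena_edges" unfolding edge(2) arena_edges_def using edge(3-5) i by blast
    moreover have "y \<in> X" "pos y \<in> input_turns"
      using y moves_subset edge(2) by (auto simp: input_turns_def)
    ultimately obtain z where "(y, z) \<in> F" "pos z = ?v" using moves_cover by blast
    then show ?thesis using y m(2) by (auto simp: round_graph_def)
  qed
  then show ?thesis using edge(4) by blast
qed

lemma spoiler_graph_answers:
  assumes "spoiler_graph input_turns arena_weight pos_priority arena_vertices arena_edges s E"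
    and m: "m \<in> arena_vertices" "is_Output m" and a: "a \<subseteq> outputs"
  shows "\<exists>i\<subseteq>inputs. \<exists>z. (m, z) \<in> round_graph E id \<and> pos_letter z = a \<union> i"
proof -
  interpret spoiler_graph input_turns arena_weight pos_priority arena_vertices arena_edges s E
    by fact
  obtain q u p where v: "m = Output_turn q u p" "q \<in> Q" "u \<subseteq> inputs \<union> outputs" "p \<le> B"
    using m by (auto simp: arena_vertices_def)
  let ?y = "Input_turn q a p"
  have "(m, ?y) \<in> arena_edges" using v a by (auto simp: arena_edges_def)
  then have y: "(m, ?y) \<in> E" "?y \<in> arena_vertices"
    using m(2) arena_edges_subset by (auto simp: input_turns_def intro: player_edges)
  then obtain z where z: "(?y, z) \<in> E" using total by blast
  then obtain i where i: "z = Output_turn (\<delta> q (a \<union> i)) (a \<union> i) (prio q (a \<union> i))" "i \<subseteq> inputs"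
    using subset input_edge_cases by blast
  moreover have "(m, z) \<in> round_graph E id" using y(1) z m(2) by (auto simp: round_graph_def)
  ultimately show ?thesis by (intro exI[of _ i] exI[of _ z] conjI) simp_all
qed

lemma realizability_certificate_exists:
  assumes "player_wins input_turns arena_weight pos_priority arena_edges arena_init"
  shows "\<exists>(S :: nat set) m0 e \<kappa> \<pi>.
    finite S \<and> realizability_certificate inputs outputs w N S m0 e \<kappa> \<pi>"
proof -
  obtain X :: "nat set" and F pos x0 where
    S: "strategy_graph input_turns arena_weight pos_priority arena_edges X F pos"
    and x0: "x0 \<in> X" "pos x0 = arena_init"
    using assms unfolding player_wins_def image_iff by metis
  interpret strategy_graph input_turns arena_weight pos_priority arena_edges X F pos by (rule S)
  interpret turn_graph Q q0 \<delta> prio B N inputs outputs w X F pos x0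
    by standard (use finite_states moves_subset moves_edges x0 in auto)
  have good: "0 \<le> (\<Sum>x\<leftarrow>xs. letter_energy inputs outputs w (letter x)) \<and>
      even (Min (priority ` set xs))" if "walk (round_graph F pos) x xs x" "xs \<noteq> []" for x xs
    using closed_walk_of_rounds[OF that] cycles_good by metis
  obtain e :: "nat \<Rightarrow> nat" and \<kappa> \<pi> where init: "\<forall>A\<subseteq>{..N}. N \<notin> A \<longrightarrow> 0 < \<kappa> x0 A 0"
    and move: "\<forall>(m, m')\<in>round_graph F pos.
      int (e m') \<le> int (e m) + letter_energy inputs outputs w (letter m') \<and>
      measure_step N \<kappa> \<pi> 0 m (letter m') m'"
    by (rule realizability_measures_exist[OF good])
  have answer: "\<exists>a\<subseteq>outputs. \<forall>i\<subseteq>inputs. \<exists>z. (m, z) \<in> round_graph F pos \<and> letter z = a \<union> i"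
    if "m \<in> controller_states" for m
    using that strategy_graph_answers[OF S] unfolding controller_states_def letter_def by blast
  have "O_controller inputs outputs controller_states (\<lambda>m x m'.
      int (e m') \<le> int (e m) + letter_energy inputs outputs w x \<and> measure_step N \<kappa> \<pi> 0 m x m')"
    by (rule O_controller_of_graph[OF round_graph_subset _ answer]) (use move in blast)
  then have "realizability_certificate inputs outputs w N controller_states x0 e \<kappa> \<pi>"
    unfolding realizability_certificate_def using init initial_controller_state by blast
  then show ?thesis using finite_controller by blast
qed

definition reachable :: "('q position \<times> 'q position) set \<Rightarrow> 'q position set" where
  "reachable E = E\<^sup>* `` {arena_init}"

definition reachable_edges :: "('q position \<times> 'q position) set \<Rightarrow> ('q position \<times> 'q position) set"
  where "reachable_edges E = {(x, y) \<in> E. x \<in> reachable E}"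

lemma reachable_subset:
  assumes "E \<subseteq> arena_edges"
  shows "reachable E \<subseteq> arena_vertices"
proof -
  have "E `` arena_vertices \<subseteq> arena_vertices" using assms arena_edges_subset by blast
  then show ?thesis
    using Image_closed_trancl[of E arena_vertices] arena_init_vertex
    unfolding reachable_def by blast
qed

lemma reachable_edges_subset: "reachable_edges E \<subseteq> reachable E \<times> reachable E"
  unfolding reachable_edges_def reachable_def by (auto intro: rtrancl_into_rtrancl)

lemma round_graph_reachable_edges:
  "(m, z) \<in> round_graph E id \<Longrightarrow> m \<in> reachable E \<Longrightarrow> (m, z) \<in> round_graph (reachable_edges E) id"
  using reachable_edges_subset[of E] by (force simp: round_graph_def reachable_edges_def)

lemma turn_graph_reachable:
  assumes "E \<subseteq> arena_edges"
  shows "turn_graph Q q0 \<delta> prio B N inputs outputs (reachable E) (reachable_edges E) id arena_init"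
proof
  show "finite (reachable E)"
    using reachable_subset[OF assms] finite_arena_vertices by (rule finite_subset)
  show "(id x, id y) \<in> arena_edges" if "(x, y) \<in> reachable_edges E" for x y
    using that assms by (auto simp: reachable_edges_def)
qed (use reachable_edges_subset in \<open>simp_all add: reachable_def\<close>)

lemma unrealizability_certificate_exists:
  assumes "opponent_wins input_turns arena_weight pos_priority
    arena_vertices arena_edges arena_init"
  shows "\<exists>(S :: 'q position set) m0 C \<kappa> \<pi>.
    finite S \<and> unrealizability_certificate inputs outputs w N S m0 C \<kappa> \<pi>"
proof -
  obtain E where spoiler: "spoiler_graph input_turns arena_weight pos_priority arena_vertices
    arena_edges arena_init E" using assms unfolding opponent_wins_def by blast
  interpret spoiler_graph input_turns arena_weight pos_priority arena_vertices arena_edges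
    arena_init E by (rule spoiler)
  define F where "F = reachable_edges E"
  interpret turn_graph Q q0 \<delta> prio B N inputs outputs w "reachable E" F id arena_init
    unfolding F_def by (rule turn_graph_reachable[OF subset])
  have bad: "(\<Sum>x\<leftarrow>xs. letter_energy inputs outputs w (letter x)) < 0"
    if xs: "walk (round_graph F id) x xs x" "xs \<noteq> []" and ev: "even (Min (priority ` set xs))"
      for x xs
  proof -
    obtain ys where ys: "walk F x ys x" "ys \<noteq> []"
      "good_cycle arena_weight pos_priority (map id ys) \<longleftrightarrow>
        0 \<le> (\<Sum>x\<leftarrow>xs. letter_energy inputs outputs w (letter x)) \<and> even (Min (priority ` set xs))"
      using xs by (rule closed_walk_of_rounds)
    have "(arena_init, x) \<in> E\<^sup>*"
      using ys(1,2) by (cases ys) (auto simp: F_def reachable_edges_def reachable_def)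
    moreover have "walk E x ys x"
      using ys(1) by (rule walk_mono) (auto simp: F_def reachable_edges_def)
    ultimately have "\<not> good_cycle arena_weight pos_priority ys" using ys(2) by (rule cycles_bad)
    then show ?thesis using ys(3) ev by simp
  qed
  obtain C :: nat and \<kappa> \<pi> where C: "0 < C" and init: "\<forall>A\<subseteq>{..N}. N \<in> A \<longrightarrow> 0 < \<kappa> arena_init A 0"
    and move: "\<forall>(m, m')\<in>round_graph F id.
      measure_step N \<kappa> \<pi> (int C * letter_energy inputs outputs w (letter m')) m (letter m') m'"
    by (rule unrealizability_measures_exist[OF bad])
  have answer: "\<exists>i\<subseteq>inputs. \<exists>z. (m, z) \<in> round_graph F id \<and> letter z = a \<union> i"
    if m: "m \<in> controller_states" and a: "a \<subseteq> outputs" for m a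
  proof -
    have "m \<in> reachable E" "m \<in> arena_vertices" "is_Output m"
      using m reachable_subset[OF subset] by (auto simp: controller_states_def)
    then show ?thesis using spoiler_graph_answers[OF spoiler _ _ a] round_graph_reachable_edges
      unfolding letter_def id_apply F_def by meson
  qed
  have "I_controller inputs outputs controller_states (\<lambda>m x m'.
      measure_step N \<kappa> \<pi> (int C * letter_energy inputs outputs w x) m x m')"
    by (rule I_controller_of_graph[OF round_graph_subset _ answer]) (use move in blast)
  then have "unrealizability_certificate inputs outputs w N controller_states arena_init C \<kappa> \<pi>"
    unfolding unrealizability_certificate_def using C init initial_controller_state by blast
  then show ?thesis using finite_controller by blast
qed

lemma certificate_exists:
  "(\<exists>(S :: nat set) m0 e \<kappa> \<pi>. finite S \<and> realizability_certificate inputs outputs w N S m0 e \<kappa> \<pi>) \<or>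
   (\<exists>(S :: 'q position set) m0 C \<kappa> \<pi>.
      finite S \<and> unrealizability_certificate inputs outputs w N S m0 C \<kappa> \<pi>)"
proof -
  have "player_wins input_turns arena_weight pos_priority arena_edges arena_init \<or>
      opponent_wins input_turns arena_weight pos_priority arena_vertices arena_edges arena_init"
    by (intro player_wins_or_opponent_wins finite_arena_vertices arena_edges_subset
        arena_edges_total arena_init_vertex)
  then show ?thesis
    using realizability_certificate_exists unrealizability_certificate_exists by argo
qed

end

section \<open>Computable functions\<close>

definition recursive_on :: "nat \<Rightarrow> (nat list \<Rightarrow> nat) \<Rightarrow> bool" where
  "recursive_on n f \<longleftrightarrow> (\<exists>g. recursive n g \<and> (\<forall>xs. length xs = n \<longrightarrow> f xs = g xs))"

lemma recursive_imp_recursive_on: "recursive n f \<Longrightarrow> recursive_on n f"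
  by (auto simp: recursive_on_def)

lemma recursive_on_cong:
  "recursive_on n f \<Longrightarrow> (\<And>xs. length xs = n \<Longrightarrow> f xs = g xs) \<Longrightarrow> recursive_on n g"
  unfolding recursive_on_def by metis

lemma recursive_on_nth: "i < n \<Longrightarrow> recursive_on n (\<lambda>xs. xs ! i)"
  by (rule recursive_imp_recursive_on) (rule recursive.proj)

lemma recursive_on_comp:
  assumes "recursive_on (length fs) f" "\<And>a. a \<in> set fs \<Longrightarrow> recursive_on n a"
  shows "recursive_on n (\<lambda>xs. f (map (\<lambda>a. a xs) fs))"
proof -
  obtain g where g: "recursive (length fs) g" "\<And>xs. length xs = length fs \<Longrightarrow> f xs = g xs"
    using assms(1) by (auto simp: recursive_on_def)
  obtain c where c: "\<And>a. a \<in> set fs \<Longrightarrow> recursive n (c a)"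
    "\<And>a xs. a \<in> set fs \<Longrightarrow> length xs = n \<Longrightarrow> a xs = c a xs"
    using assms(2) unfolding recursive_on_def by metis
  have "recursive n (\<lambda>xs. g (map (\<lambda>a. a xs) (map c fs)))"
    by (rule recursive.comp) (use g(1) c(1) in auto)
  moreover have "f (map (\<lambda>a. a xs) fs) = g (map (\<lambda>a. a xs) (map c fs))" if "length xs = n" for xs
    using g(2) c(2) that by (simp cong: map_cong)
  ultimately show ?thesis unfolding recursive_on_def by blast
qed

lemma computable_iff_recursive_on: "computable f \<longleftrightarrow> recursive_on 1 (\<lambda>xs. f (xs ! 0))"
proof
  assume "recursive_on 1 (\<lambda>xs. f (xs ! 0))"
  then obtain g where "recursive 1 g" "\<And>xs. length xs = 1 \<Longrightarrow> f (xs ! 0) = g xs"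
    by (auto simp: recursive_on_def)
  then have "recursive 1 g \<and> (\<forall>x. f x = g [x])"
    by (metis length_Cons list.size(3) nth_Cons_0 One_nat_def)
  then show "computable f" unfolding computable_def by blast
next
  assume "computable f"
  then obtain g where "recursive 1 g" "\<And>x. f x = g [x]" by (auto simp: computable_def)
  moreover from this have "f (xs ! 0) = g xs" if "length xs = 1" for xs
    using that by (cases xs) auto
  ultimately show "recursive_on 1 (\<lambda>xs. f (xs ! 0))" unfolding recursive_on_def by blast
qed

lemma recursive_on_comp1: "computable f \<Longrightarrow> recursive_on n a \<Longrightarrow> recursive_on n (\<lambda>xs. f (a xs))"
  using recursive_on_comp[of "[a]" "\<lambda>xs. f (xs ! 0)" n] by (simp add: computable_iff_recursive_on)

lemma recursive_on_comp2:
  "recursive_on 2 (\<lambda>xs. f (xs ! 0) (xs ! 1)) \<Longrightarrow> recursive_on n a \<Longrightarrow> recursive_on n b \<Longrightarrow>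
    recursive_on n (\<lambda>xs. f (a xs) (b xs))"
  using recursive_on_comp[of "[a, b]" "\<lambda>xs. f (xs ! 0) (xs ! 1)" n] by (auto simp: numeral_2_eq_2)

lemma computable_comp: "computable f \<Longrightarrow> computable g \<Longrightarrow> computable (\<lambda>x. f (g x))"
  using recursive_on_comp1[of f 1] by (simp add: computable_iff_recursive_on)

lemma computable_comp2:
  "recursive_on 2 (\<lambda>xs. f (xs ! 0) (xs ! 1)) \<Longrightarrow> computable a \<Longrightarrow> computable b \<Longrightarrow>
    computable (\<lambda>x. f (a x) (b x))"
  using recursive_on_comp2[of f 1] by (simp add: computable_iff_recursive_on)

lemma computable_ident: "computable (\<lambda>x. x)"
  by (simp add: computable_iff_recursive_on recursive_on_nth)

lemma computable_Suc_fun: "computable Suc"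
  unfolding computable_def
  by (intro exI[of _ "\<lambda>xs. Suc (hd xs)"]) (simp add: recursive.succ[unfolded One_nat_def])

lemma computable_const: "computable (\<lambda>_. k)"
proof (induction k)
  case 0
  show ?case unfolding computable_def by (intro exI[of _ "\<lambda>_. 0"]) (simp add: recursive.zero)
next
  case (Suc k)
  then show ?case using computable_comp[OF computable_Suc_fun] by simp
qed

lemma recursive_on_rec:
  assumes "computable g" "recursive_on 3 (\<lambda>xs. h (xs ! 0) (xs ! 1) (xs ! 2))"
  shows "recursive_on 2 (\<lambda>xs. rec_nat (g (xs ! 1)) (\<lambda>k r. h k r (xs ! 1)) (xs ! 0))"
proof -
  obtain g' where g': "recursive 1 g'" "\<And>x. g x = g' [x]" using assms(1)
    by (auto simp: computable_def)
  obtain h' where h': "recursive 3 h'"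
    "\<And>xs. length xs = 3 \<Longrightarrow> h (xs ! 0) (xs ! 1) (xs ! 2) = h' xs"
    using assms(2) by (auto simp: recursive_on_def)
  have eq: "h k r x = h' [k, r, x]" for k r x using h'(2)[of "[k, r, x]"] by simp
  have "recursive 2 (\<lambda>xs. rec_nat (g' (tl xs)) (\<lambda>k r. h' (k # r # tl xs)) (hd xs))"
    using recursive.prim_rec[of 1 g' h'] g'(1) h'(1) by (simp add: numeral_eq_Suc)
  then show ?thesis
  proof (rule recursive_on_cong[OF recursive_imp_recursive_on])
    fix xs :: "nat list" assume "length xs = 2"
    then obtain m x where "xs = [m, x]" by (auto simp: numeral_2_eq_2 length_Suc_conv)
    then show "rec_nat (g' (tl xs)) (\<lambda>k r. h' (k # r # tl xs)) (hd xs) =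
        rec_nat (g (xs ! 1)) (\<lambda>k r. h k r (xs ! 1)) (xs ! 0)" by (simp add: g'(2) eq)
  qed
qed

lemma recursive_on_Suc: "recursive_on n a \<Longrightarrow> recursive_on n (\<lambda>xs. Suc (a xs))"
  by (rule recursive_on_comp1[OF computable_Suc_fun])

lemma recursive_on_add: "recursive_on n a \<Longrightarrow> recursive_on n b \<Longrightarrow> recursive_on n (\<lambda>xs. a xs + b xs)"
proof (erule (1) recursive_on_comp2[where f = "(+)", rotated])
  have "recursive_on 2 (\<lambda>xs. rec_nat (xs ! 1) (\<lambda>k r. Suc r) (xs ! 0))"
    by (intro recursive_on_rec computable_ident recursive_on_Suc recursive_on_nth) simp
  moreover have "rec_nat y (\<lambda>k r. Suc r) x = x + y" for x y :: nat by (induction x) auto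
  ultimately show "recursive_on 2 (\<lambda>xs. xs ! 0 + xs ! 1)" by simp
qed

lemma recursive_on_mult: "recursive_on n a \<Longrightarrow> recursive_on n b \<Longrightarrow> recursive_on n (\<lambda>xs. a xs * b xs)"
proof (erule (1) recursive_on_comp2[where f = "(*)", rotated])
  have "recursive_on 2 (\<lambda>xs. rec_nat 0 (\<lambda>k r. r + xs ! 1) (xs ! 0))"
    by (intro recursive_on_rec computable_const recursive_on_add recursive_on_nth) simp_all
  moreover have "rec_nat 0 (\<lambda>k r. r + y) x = x * y" for x y :: nat by (induction x) auto
  ultimately show "recursive_on 2 (\<lambda>xs. xs ! 0 * xs ! 1)" by simp
qed

lemma recursive_on_diff: "recursive_on n a \<Longrightarrow> recursive_on n b \<Longrightarrow> recursive_on n (\<lambda>xs. a xs - b xs)"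
proof (erule (1) recursive_on_comp2[where f = "(-)", rotated])
  have "recursive_on 2 (\<lambda>xs. rec_nat 0 (\<lambda>k r. k) (xs ! 0))"
    by (intro recursive_on_rec computable_const recursive_on_nth) simp
  moreover have "rec_nat 0 (\<lambda>k r. k) x = x - 1" for x :: nat by (cases x) auto
  ultimately have pred: "computable (\<lambda>x. x - 1)"
    using computable_comp2[of "\<lambda>x _. x - 1", OF _ computable_ident computable_ident] by simp
  have "recursive_on 3 (\<lambda>xs. xs ! 1 - 1)"
    using recursive_on_comp1[OF pred recursive_on_nth[of 1 3]] by simp
  then have "recursive_on 2 (\<lambda>xs. rec_nat (xs ! 1) (\<lambda>k r. r - 1) (xs ! 0))"
    by (rule recursive_on_rec[of "\<lambda>x. x" "\<lambda>k r x. r - 1", OF computable_ident])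
  moreover have "rec_nat x (\<lambda>k r. r - 1) y = x - y" for x y :: nat by (induction y) auto
  ultimately have "recursive_on 2 (\<lambda>xs. xs ! 1 - xs ! 0)" by simp
  then show "recursive_on 2 (\<lambda>xs. xs ! 0 - xs ! 1)"
    by (rule recursive_on_comp2[of "\<lambda>y x. x - y"]) (simp_all add: recursive_on_nth)
qed

lemma computable_triangle: "computable triangle"
proof -
  have "recursive_on 2 (\<lambda>xs. rec_nat 0 (\<lambda>k r. r + Suc k) (xs ! 0))"
    by (intro recursive_on_rec computable_const recursive_on_add recursive_on_Suc recursive_on_nth)
      simp_all
  moreover have "rec_nat 0 (\<lambda>k r. r + Suc k) n = triangle n" for n by (induction n) simp_all
  ultimately show ?thesis
    using computable_comp2[of "\<lambda>x _. triangle x", OF _ computable_ident computable_ident] by simp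
qed

lemma recursive_on_prod_encode:
  "recursive_on n a \<Longrightarrow> recursive_on n b \<Longrightarrow> recursive_on n (\<lambda>xs. prod_encode (a xs, b xs))"
  unfolding prod_encode_def split_conv
  by (intro recursive_on_add recursive_on_comp1[OF computable_triangle])

text \<open>From here on all functions are unary, and several arguments are paired by \<open>prod_encode\<close>: in
  the rules for binders the bound variable is the first component.\<close>

abbreviation pfst :: "nat \<Rightarrow> nat" where "pfst z \<equiv> fst (prod_decode z)"
abbreviation psnd :: "nat \<Rightarrow> nat" where "psnd z \<equiv> snd (prod_decode z)"

lemma triangle_mono: "m \<le> n \<Longrightarrow> triangle m \<le> triangle n"
  unfolding triangle_def by (intro div_le_mono mult_le_mono) simp_all

lemma triangle_add_pfst: "triangle (pfst z + psnd z) + pfst z = z"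
  using prod_decode_inverse[of z] by (cases "prod_decode z") (simp add: prod_encode_def)

lemma Least_triangle_eq: "(LEAST s. z < triangle (Suc s)) = pfst z + psnd z"
proof (rule Least_equality)
  show "z < triangle (Suc (pfst z + psnd z))" using triangle_add_pfst[of z] by simp
  show "pfst z + psnd z \<le> s" if "z < triangle (Suc s)" for s
    using triangle_mono[of "Suc s" "pfst z + psnd z"] triangle_add_pfst[of z] that by linarith
qed

lemma computable_Least_zero:
  assumes "recursive_on 2 (\<lambda>xs. f (xs ! 0) (xs ! 1))" and "\<And>x. \<exists>k. f k x = 0"
  shows "computable (\<lambda>x. LEAST k. f k x = 0)"
proof -
  obtain g where g: "recursive 2 g" "\<And>xs. length xs = 2 \<Longrightarrow> f (xs ! 0) (xs ! 1) = g xs"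
    using assms(1) by (auto simp: recursive_on_def)
  have g_eq: "g [k, x] = f k x" for k x using g(2)[of "[k, x]"] by simp
  have "recursive 1 (\<lambda>xs. LEAST k. g (k # xs) = 0)"
    using g(1) g_eq assms(2)
    by (intro recursive.minimise) (auto simp: length_Suc_conv numeral_2_eq_2)
  then show ?thesis
    unfolding computable_def using g_eq by (intro exI[of _ "\<lambda>xs. LEAST k. g (k # xs) = 0"]) simp
qed

lemma computable_pfst_psnd: "computable pfst" "computable psnd"
proof -
  have "computable (\<lambda>z. LEAST s. Suc z - triangle (Suc s) = 0)"
  proof (rule computable_Least_zero)
    show "recursive_on 2 (\<lambda>xs. Suc (xs ! 1) - triangle (Suc (xs ! 0)))"
      by (intro recursive_on_diff recursive_on_comp1[OF computable_triangle] recursive_on_Suc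
          recursive_on_nth) simp_all
    show "\<exists>s. Suc z - triangle (Suc s) = 0" for z
      using triangle_add_pfst[of z] by (intro exI[of _ "pfst z + psnd z"]) simp
  qed
  then have sum: "computable (\<lambda>z. pfst z + psnd z)"
    by (simp only: diff_is_0_eq Suc_le_eq Least_triangle_eq)
  have "computable (\<lambda>z. z - triangle (pfst z + psnd z))"
    by (intro computable_comp2[of "(-)"] computable_comp[OF computable_triangle] sum
        computable_ident recursive_on_diff recursive_on_nth) simp_all
  moreover have "z - triangle (pfst z + psnd z) = pfst z" for z
    using triangle_add_pfst[of z] by linarith
  ultimately show fst: "computable pfst" by simp
  have "computable (\<lambda>z. (pfst z + psnd z) - pfst z)"
    by (intro computable_comp2[of "(-)"] sum fst recursive_on_diff recursive_on_nth) simp_all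
  then show "computable psnd" by simp
qed

lemma computable_pfst: "computable a \<Longrightarrow> computable (\<lambda>x. pfst (a x))"
  and computable_psnd: "computable a \<Longrightarrow> computable (\<lambda>x. psnd (a x))"
  using computable_comp computable_pfst_psnd by blast+

lemma computable_Suc: "computable a \<Longrightarrow> computable (\<lambda>x. Suc (a x))"
  by (rule computable_comp[OF computable_Suc_fun])

lemma computable_add: "computable a \<Longrightarrow> computable b \<Longrightarrow> computable (\<lambda>x. a x + b x)"
  and computable_mult: "computable a \<Longrightarrow> computable b \<Longrightarrow> computable (\<lambda>x. a x * b x)"
  and computable_diff: "computable a \<Longrightarrow> computable b \<Longrightarrow> computable (\<lambda>x. a x - b x)"
  and computable_prod_encode:
    "computable a \<Longrightarrow> computable b \<Longrightarrow> computable (\<lambda>x. prod_encode (a x, b x))"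
  by (simp_all add: computable_iff_recursive_on recursive_on_add recursive_on_mult
      recursive_on_diff recursive_on_prod_encode)

lemma computable_rec:
  assumes "computable g" "computable b"
    and h: "computable (\<lambda>z. h (pfst z) (pfst (psnd z)) (psnd (psnd z)))"
  shows "computable (\<lambda>x. rec_nat (g x) (\<lambda>k r. h k r x) (b x))"
proof -
  have "recursive_on 3 (\<lambda>xs. h (xs ! 0) (xs ! 1) (xs ! 2))"
    using recursive_on_comp1[OF h, of 3 "\<lambda>xs. prod_encode (xs ! 0, prod_encode (xs ! 1, xs ! 2))"]
    by (simp add: recursive_on_prod_encode recursive_on_nth)
  from recursive_on_rec[OF assms(1) this] show ?thesis
    by (rule computable_comp2[of "\<lambda>m x. rec_nat (g x) (\<lambda>k r. h k r x) m"])
      (use assms(2) computable_ident in simp_all)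
qed

lemma computable_sum_lessThan:
  assumes "computable b" "computable (\<lambda>z. f (pfst z) (psnd z))"
  shows "computable (\<lambda>x. \<Sum>k<b x. f k x)"
proof -
  have "computable (\<lambda>z. f (pfst z) (psnd (psnd z)))"
    using computable_comp[OF assms(2), of "\<lambda>z. prod_encode (pfst z, psnd (psnd z))"]
    by (simp add: computable_prod_encode computable_pfst computable_psnd computable_ident)
  then have "computable (\<lambda>x. rec_nat 0 (\<lambda>k r. r + f k x) (b x))"
    by (intro computable_rec computable_add computable_pfst computable_psnd computable_const
        computable_ident assms(1))
  moreover have "rec_nat 0 (\<lambda>k r. r + f k x) m = (\<Sum>k<m. f k x)" for m x by (induction m) auto
  ultimately show ?thesis by simp
qed

lemma computable_power2: "computable a \<Longrightarrow> computable (\<lambda>x. 2 ^ a x)"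
proof -
  assume "computable a"
  then have "computable (\<lambda>x. rec_nat 1 (\<lambda>k r. 2 * r) (a x))"
    by (intro computable_rec computable_mult computable_pfst computable_psnd computable_const
        computable_ident)
  moreover have "rec_nat 1 (\<lambda>k r. 2 * r) m = (2 ^ m :: nat)" for m by (induction m) auto
  ultimately show ?thesis by simp
qed

lemma computable_comp_psnd: "computable a \<Longrightarrow> computable (\<lambda>z. a (psnd z))"
  using computable_comp[of a psnd] by (simp add: computable_pfst_psnd)

subsection \<open>Decidable predicates\<close>

definition decidable :: "(nat \<Rightarrow> bool) \<Rightarrow> bool" where
  "decidable P \<longleftrightarrow> computable (\<lambda>x. of_bool (P x))"

lemma decidable_comp: "decidable P \<Longrightarrow> computable g \<Longrightarrow> decidable (\<lambda>x. P (g x))"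
  unfolding decidable_def by (rule computable_comp)

lemma computable_of_bool: "decidable P \<Longrightarrow> computable (\<lambda>x. of_bool (P x))"
  by (simp add: decidable_def)

lemma decidable_True: "decidable (\<lambda>_. True)"
  unfolding decidable_def by (rule computable_const)

lemma decidable_eq_0: "computable a \<Longrightarrow> decidable (\<lambda>x. a x = 0)"
proof -
  assume "computable a"
  then have "computable (\<lambda>x. 1 - a x)" by (intro computable_diff computable_const)
  moreover have "1 - a x = of_bool (a x = 0)" for x by simp
  ultimately show ?thesis by (simp add: decidable_def)
qed

lemma decidable_not: "decidable P \<Longrightarrow> decidable (\<lambda>x. \<not> P x)"
  using decidable_eq_0[of "\<lambda>x. of_bool (P x)"] by (simp add: decidable_def)

lemma decidable_conj: "decidable P \<Longrightarrow> decidable Q \<Longrightarrow> decidable (\<lambda>x. P x \<and> Q x)"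
  unfolding decidable_def of_bool_conj by (rule computable_mult)

lemma decidable_disj: "decidable P \<Longrightarrow> decidable Q \<Longrightarrow> decidable (\<lambda>x. P x \<or> Q x)"
  using decidable_not[OF decidable_conj[OF decidable_not decidable_not], of P Q] by simp

lemma decidable_imp: "decidable P \<Longrightarrow> decidable Q \<Longrightarrow> decidable (\<lambda>x. P x \<longrightarrow> Q x)"
  unfolding imp_conv_disj by (intro decidable_disj decidable_not)

lemma decidable_iff: "decidable P \<Longrightarrow> decidable Q \<Longrightarrow> decidable (\<lambda>x. P x \<longleftrightarrow> Q x)"
  unfolding iff_conv_conj_imp by (intro decidable_conj decidable_imp)

lemma decidable_if:
  "decidable P \<Longrightarrow> decidable Q \<Longrightarrow> decidable R \<Longrightarrow> decidable (\<lambda>x. if P x then Q x else R x)"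
  unfolding if_bool_eq_conj by (intro decidable_conj decidable_imp decidable_not)

lemma decidable_le: "computable a \<Longrightarrow> computable b \<Longrightarrow> decidable (\<lambda>x. a x \<le> b x)"
  using decidable_eq_0[of "\<lambda>x. a x - b x"] by (simp add: computable_diff)

lemma decidable_less: "computable a \<Longrightarrow> computable b \<Longrightarrow> decidable (\<lambda>x. a x < b x)"
  using decidable_le[of "\<lambda>x. Suc (a x)" b] by (simp add: computable_Suc Suc_le_eq)

lemma decidable_eq: "computable a \<Longrightarrow> computable b \<Longrightarrow> decidable (\<lambda>x. a x = b x)"
  unfolding order_eq_iff by (intro decidable_conj decidable_le)

lemma computable_if:
  assumes "decidable P" "computable a" "computable b"
  shows "computable (\<lambda>x. if P x then a x else b x)"
proof -
  have "computable (\<lambda>x. of_bool (P x) * a x + of_bool (\<not> P x) * b x)"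
    by (intro computable_add computable_mult computable_of_bool decidable_not assms)
  moreover have "of_bool (P x) * a x + of_bool (\<not> P x) * b x = (if P x then a x else b x)" for x
    by simp
  ultimately show ?thesis by simp
qed

lemma decidable_all_less:
  assumes "computable b" "decidable (\<lambda>z. P (pfst z) (psnd z))"
  shows "decidable (\<lambda>x. \<forall>k<b x. P k x)"
proof -
  have "decidable (\<lambda>x. (\<Sum>k<b x. of_bool (\<not> P k x)) = (0 :: nat))"
    by (intro decidable_eq_0 computable_sum_lessThan computable_of_bool decidable_not assms)
  moreover have "(\<Sum>k<m. of_bool (\<not> P k x)) = (0 :: nat) \<longleftrightarrow> (\<forall>k<m. P k x)" for m x by auto
  ultimately show ?thesis by simp
qed

lemma decidable_all_le:
  "computable b \<Longrightarrow> decidable (\<lambda>z. P (pfst z) (psnd z)) \<Longrightarrow> decidable (\<lambda>x. \<forall>k\<le>b x. P k x)"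
  using decidable_all_less[of "\<lambda>x. Suc (b x)" P] by (simp add: computable_Suc less_Suc_eq_le)

lemma computable_Least:
  assumes "decidable (\<lambda>z. P (pfst z) (psnd z))" "\<And>x. \<exists>k. P k x"
  shows "computable (\<lambda>x. LEAST k. P k x)"
proof -
  have "computable (\<lambda>z. of_bool (\<not> P (pfst z) (psnd z)))"
    by (intro computable_of_bool decidable_not assms(1))
  from recursive_on_comp1[OF this, of 2 "\<lambda>xs. prod_encode (xs ! 0, xs ! 1)"]
  have "recursive_on 2 (\<lambda>xs. of_bool (\<not> P (xs ! 0) (xs ! 1)))"
    by (simp add: recursive_on_prod_encode recursive_on_nth)
  then have "computable (\<lambda>x. LEAST k. of_bool (\<not> P k x) = (0 :: nat))"
    by (rule computable_Least_zero) (simp add: assms(2))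
  then show ?thesis by simp
qed

lemma decidable_Post:
  assumes P: "decidable (\<lambda>z. P (pfst z) (psnd z))" and R: "decidable (\<lambda>z. R (pfst z) (psnd z))"
    and pos: "\<And>x. Q x \<longleftrightarrow> (\<exists>k. P k x)" and neg: "\<And>x. \<not> Q x \<longleftrightarrow> (\<exists>k. R k x)"
  shows "decidable Q"
proof -
  define witness where "witness x = (LEAST k. P k x \<or> R k x)" for x
  have ex: "\<exists>k. P k x \<or> R k x" for x using pos[of x] neg[of x] by blast
  have "computable witness"
    unfolding witness_def by (intro computable_Least decidable_disj P R ex)
  then have "decidable (\<lambda>x. P (witness x) x)"
    using decidable_comp[OF P, of "\<lambda>x. prod_encode (witness x, x)"]
    by (simp add: computable_prod_encode computable_ident)
  moreover have "Q = (\<lambda>x. P (witness x) x)"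
  proof
    show "Q x = P (witness x) x" for x
      using LeastI_ex[OF ex, of x] pos[of x] neg[of x] unfolding witness_def by blast
  qed
  ultimately show ?thesis by simp
qed

lemma computable_div:
  assumes "computable a" "computable b" "\<And>x. 0 < b x"
  shows "computable (\<lambda>x. a x div b x)"
proof -
  have "computable (\<lambda>x. LEAST q. a x < Suc q * b x)"
  proof (rule computable_Least)
    show "decidable (\<lambda>z. a (psnd z) < Suc (pfst z) * b (psnd z))"
      by (intro decidable_less computable_mult computable_Suc computable_pfst computable_ident
          computable_comp[OF assms(1)] computable_comp[OF assms(2)] computable_psnd)
    show "\<exists>q. a x < Suc q * b x" for x
      using assms(3)[of x] by (intro exI[of _ "a x"]) (cases "b x"; simp)
  qed
  moreover have "(LEAST q. a x < Suc q * b x) = a x div b x" for x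
  proof (rule Least_equality)
    show "a x < Suc (a x div b x) * b x"
      using dividend_less_div_times[OF assms(3), of "a x" x] by simp
    show "a x div b x \<le> q" if "a x < Suc q * b x" for q
      using that assms(3)[of x] by (simp add: div_less_iff_less_mult less_Suc_eq_le[symmetric])
  qed
  ultimately show ?thesis by simp
qed

lemma decidable_even: "computable a \<Longrightarrow> decidable (\<lambda>x. even (a x))"
proof -
  assume "computable a"
  then have "decidable (\<lambda>x. a x \<le> 2 * (a x div 2))"
    by (intro decidable_le computable_mult computable_const computable_div) simp_all
  moreover have "m \<le> 2 * (m div 2) \<longleftrightarrow> even m" for m :: nat by presburger
  ultimately show ?thesis by simp
qed

subsection \<open>Computable finite sets\<close>

definition computable_set :: "(nat \<Rightarrow> nat set) \<Rightarrow> bool" where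
  "computable_set A \<longleftrightarrow> (\<forall>x. finite (A x)) \<and> computable (\<lambda>x. set_encode (A x))"

lemma set_decode_imp_less: "k \<in> set_decode b \<Longrightarrow> k < b"
proof -
  assume "k \<in> set_decode b"
  then have "set_decode (2 ^ k) \<subseteq> set_decode b"
    using set_encode_inverse[of "{k}"] by (simp add: set_encode_def)
  then have "2 ^ k \<le> b" by (rule subset_decode_imp_le)
  then show ?thesis using less_exp[of k] by linarith
qed

lemma less_set_encode: "finite A \<Longrightarrow> k \<in> A \<Longrightarrow> k < set_encode A"
  using set_decode_imp_less[of k "set_encode A"] by simp

lemma computable_set_comp: "computable_set A \<Longrightarrow> computable g \<Longrightarrow> computable_set (\<lambda>x. A (g x))"
  unfolding computable_set_def using computable_comp[of "\<lambda>x. set_encode (A x)" g] by simp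

lemma computable_set_comp_psnd: "computable_set A \<Longrightarrow> computable_set (\<lambda>z. A (psnd z))"
  using computable_set_comp[of A psnd] by (simp add: computable_pfst_psnd)

lemma computable_set_encode: "computable_set A \<Longrightarrow> computable (\<lambda>x. set_encode (A x))"
  by (simp add: computable_set_def)

lemma computable_set_decode: "computable a \<Longrightarrow> computable_set (\<lambda>x. set_decode (a x))"
  by (simp add: computable_set_def)

lemma decidable_mem: "computable a \<Longrightarrow> computable_set A \<Longrightarrow> decidable (\<lambda>x. a x \<in> A x)"
proof -
  assume a: "computable a" and A: "computable_set A"
  have "decidable (\<lambda>x. odd (set_encode (A x) div 2 ^ a x))"
    by (intro decidable_not decidable_even computable_div computable_power2 computable_set_encode
        a A)
      simp
  moreover have "k \<in> B \<longleftrightarrow> odd (set_encode B div 2 ^ k)" if "finite B" for k B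
    using set_encode_inverse[OF that] by (auto simp: set_decode_def)
  ultimately show ?thesis using A by (simp add: computable_set_def)
qed

lemma computable_set_Collect:
  assumes "computable b" "decidable (\<lambda>z. P (pfst z) (psnd z))"
  shows "computable_set (\<lambda>x. {k. k < b x \<and> P k x})"
proof -
  have "computable (\<lambda>x. \<Sum>k<b x. of_bool (P k x) * 2 ^ k)"
    by (intro computable_sum_lessThan computable_mult computable_of_bool computable_power2
        computable_pfst computable_ident assms)
  moreover have "(\<Sum>k<m. of_bool (P k x) * 2 ^ k) = set_encode {k. k < m \<and> P k x}" for m x
    unfolding set_encode_def by (rule sum.mono_neutral_cong_right) auto
  ultimately show ?thesis by (simp add: computable_set_def)
qed

lemma computable_set_Un:
  assumes A: "computable_set A" and B: "computable_set B"
  shows "computable_set (\<lambda>x. A x \<union> B x)"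
proof -
  have "computable_set (\<lambda>x. {k. k < set_encode (A x) + set_encode (B x) \<and> (k \<in> A x \<or> k \<in> B x)})"
    by (intro computable_set_Collect computable_add computable_set_encode decidable_disj
        decidable_mem computable_pfst computable_ident computable_set_comp[OF A]
        computable_set_comp[OF B] computable_psnd A B)
  moreover have "{k. k < set_encode X + set_encode Y \<and> (k \<in> X \<or> k \<in> Y)} = X \<union> Y"
    if fin: "finite X" "finite Y" for X Y
  proof -
    have "k < set_encode X + set_encode Y" if "k \<in> X \<union> Y" for k
      using that less_set_encode[OF fin(1), of k] less_set_encode[OF fin(2), of k] by auto
    then show ?thesis by blast
  qed
  ultimately show ?thesis using A B by (simp add: computable_set_def)
qed

lemma computable_set_Diff:
  assumes A: "computable_set A" and B: "computable_set B"
  shows "computable_set (\<lambda>x. A x - B x)"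
proof -
  have "computable_set (\<lambda>x. {k. k < set_encode (A x) \<and> k \<in> A x \<and> k \<notin> B x})"
    by (intro computable_set_Collect computable_set_encode decidable_conj decidable_not
        decidable_mem computable_pfst computable_ident computable_set_comp[OF A]
        computable_set_comp[OF B] computable_psnd A)
  moreover have "{k. k < set_encode X \<and> k \<in> X \<and> k \<notin> Y} = X - Y" if "finite X" for X Y
    using less_set_encode[OF that] by blast
  ultimately show ?thesis using A by (simp add: computable_set_def)
qed

lemma computable_set_lessThan: "computable b \<Longrightarrow> computable_set (\<lambda>x. {..<b x})"
  using computable_set_Collect[of b "\<lambda>_ _. True"] by (simp add: decidable_True lessThan_def)

lemma computable_set_atMost: "computable b \<Longrightarrow> computable_set (\<lambda>x. {..b x})"
  using computable_set_lessThan[of "\<lambda>x. Suc (b x)"]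
  by (simp add: computable_Suc lessThan_Suc_atMost)

lemma decidable_Ball:
  assumes A: "computable_set A" and P: "decidable (\<lambda>z. P (pfst z) (psnd z))"
  shows "decidable (\<lambda>x. \<forall>k\<in>A x. P k x)"
proof -
  have "decidable (\<lambda>x. \<forall>k<set_encode (A x). k \<in> A x \<longrightarrow> P k x)"
    by (intro decidable_all_less computable_set_encode decidable_imp decidable_mem computable_pfst
        computable_ident computable_set_comp[OF A] computable_psnd A P)
  moreover have "(\<forall>k<set_encode (A x). k \<in> A x \<longrightarrow> P k x) \<longleftrightarrow> (\<forall>k\<in>A x. P k x)" for x
    using A less_set_encode by (auto simp: computable_set_def)
  ultimately show ?thesis by simp
qed

lemma decidable_Bex:
  assumes "computable_set A" and "decidable (\<lambda>z. P (pfst z) (psnd z))"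
  shows "decidable (\<lambda>x. \<exists>k\<in>A x. P k x)"
  using decidable_not[OF decidable_Ball[of A "\<lambda>k x. \<not> P k x"]] assms
  by (simp add: decidable_not)

lemma decidable_all_subset:
  assumes A: "computable_set A" and P: "decidable (\<lambda>z. P (set_decode (pfst z)) (psnd z))"
  shows "decidable (\<lambda>x. \<forall>X\<subseteq>A x. P X x)"
proof -
  have "decidable (\<lambda>x. \<forall>b<Suc (set_encode (A x)).
      (\<forall>k\<in>set_decode b. k \<in> A x) \<longrightarrow> P (set_decode b) x)"
    by (intro decidable_all_less computable_Suc computable_set_encode decidable_imp decidable_Ball
        decidable_mem computable_set_decode computable_pfst computable_psnd computable_ident
        computable_set_comp[OF A] A P)
  moreover have "(\<forall>b<Suc (set_encode Y). (\<forall>k\<in>set_decode b. k \<in> Y) \<longrightarrow> P (set_decode b) x) \<longleftrightarrow>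
      (\<forall>X\<subseteq>Y. P X x)" if Y: "finite Y" for Y x
  proof (intro iffI allI impI)
    fix X assume all: "\<forall>b<Suc (set_encode Y). (\<forall>k\<in>set_decode b. k \<in> Y) \<longrightarrow> P (set_decode b) x"
      and X: "X \<subseteq> Y"
    have X': "set_decode (set_encode X) = X"
      using finite_subset[OF X Y] by (rule set_encode_inverse)
    then have "set_encode X \<le> set_encode Y" using X Y by (intro subset_decode_imp_le) simp
    then have "(\<forall>k\<in>set_decode (set_encode X). k \<in> Y) \<longrightarrow> P (set_decode (set_encode X)) x"
      using all by (meson le_imp_less_Suc)
    then show "P X x" unfolding X' using X by blast
  qed blast
  ultimately show ?thesis using A by (simp add: computable_set_def)
qed

lemma decidable_ex_subset:
  assumes "computable_set A" and "decidable (\<lambda>z. P (set_decode (pfst z)) (psnd z))"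
  shows "decidable (\<lambda>x. \<exists>X\<subseteq>A x. P X x)"
  using decidable_not[OF decidable_all_subset[of A "\<lambda>X x. \<not> P X x"]] assms
  by (simp add: decidable_not)

lemma computable_sum:
  assumes A: "computable_set A" and f: "computable (\<lambda>z. f (pfst z) (psnd z))"
  shows "computable (\<lambda>x. \<Sum>k\<in>A x. f k x)"
proof -
  have "computable (\<lambda>x. \<Sum>k<set_encode (A x). if k \<in> A x then f k x else 0)"
    by (intro computable_sum_lessThan computable_set_encode computable_if decidable_mem
        computable_pfst computable_ident computable_const computable_set_comp[OF A]
        computable_psnd A f)
  moreover have "(\<Sum>k<set_encode (A x). if k \<in> A x then f k x else 0) = (\<Sum>k\<in>A x. f k x)" for x
    using A less_set_encode
    by (intro sum.mono_neutral_cong_right) (auto simp: computable_set_def)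
  ultimately show ?thesis by simp
qed

lemma computable_set_Int:
  assumes "computable_set A" "computable_set B" shows "computable_set (\<lambda>x. A x \<inter> B x)"
proof -
  have "computable_set (\<lambda>x. A x - (A x - B x))" by (intro computable_set_Diff assms)
  then show ?thesis by (simp only: Diff_Diff_Int)
qed

lemma computable_card: "computable_set A \<Longrightarrow> computable (\<lambda>x. card (A x))"
  unfolding card_eq_sum by (intro computable_sum computable_const)

subsection \<open>Computable integer functions\<close>

definition computable_int :: "(nat \<Rightarrow> int) \<Rightarrow> bool" where
  "computable_int f \<longleftrightarrow> (\<exists>p q. computable p \<and> computable q \<and> (\<forall>x. f x = int (p x) - int (q x)))"

lemma computable_intI:
  "computable p \<Longrightarrow> computable q \<Longrightarrow> (\<And>x. f x = int (p x) - int (q x)) \<Longrightarrow> computable_int f"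
  unfolding computable_int_def by blast

lemma computable_int_of_nat: "computable a \<Longrightarrow> computable_int (\<lambda>x. int (a x))"
  by (rule computable_intI[OF _ computable_const[of 0]]) simp_all

lemma computable_int_of_bool: "decidable P \<Longrightarrow> computable_int (\<lambda>x. of_bool (P x))"
  using computable_int_of_nat[OF computable_of_bool] by simp

lemma computable_int_0: "computable_int (\<lambda>_. 0)"
  using computable_int_of_nat[OF computable_const[of 0]] by simp

lemma computable_int_add:
  assumes "computable_int f" "computable_int g" shows "computable_int (\<lambda>x. f x + g x)"
proof -
  obtain p q p' q' where "computable p" "computable q" "\<And>x. f x = int (p x) - int (q x)"
    "computable p'" "computable q'" "\<And>x. g x = int (p' x) - int (q' x)"
    using assms by (auto simp: computable_int_def)
  then show ?thesis
    by (intro computable_intI[of "\<lambda>x. p x + p' x" "\<lambda>x. q x + q' x"] computable_add) simp_all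
qed

lemma computable_int_mult:
  assumes "computable_int f" "computable_int g" shows "computable_int (\<lambda>x. f x * g x)"
proof -
  obtain p q p' q' where "computable p" "computable q" "computable p'" "computable q'"
    and eq: "\<And>x. f x = int (p x) - int (q x)" "\<And>x. g x = int (p' x) - int (q' x)"
    using assms by (auto simp: computable_int_def)
  moreover have "f x * g x = int (p x * p' x + q x * q' x) - int (p x * q' x + q x * p' x)" for x
    unfolding eq by (simp add: algebra_simps)
  ultimately show ?thesis
    by (intro computable_intI[of "\<lambda>x. p x * p' x + q x * q' x" "\<lambda>x. p x * q' x + q x * p' x"]
        computable_add computable_mult)
qed

lemma computable_int_sum:
  assumes A: "computable_set A" and "computable_int (\<lambda>z. f (pfst z) (psnd z))"
  shows "computable_int (\<lambda>x. \<Sum>k\<in>A x. f k x)"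
proof -
  obtain p q where "computable p" "computable q"
    and f: "\<And>z. f (pfst z) (psnd z) = int (p z) - int (q z)"
    using assms(2) by (auto simp: computable_int_def)
  have "f k x = int (p (prod_encode (k, x))) - int (q (prod_encode (k, x)))" for k x
    using f[of "prod_encode (k, x)"] by simp
  then show ?thesis
    using \<open>computable p\<close> \<open>computable q\<close>
    by (intro computable_intI[of "\<lambda>x. \<Sum>k\<in>A x. p (prod_encode (k, x))"
          "\<lambda>x. \<Sum>k\<in>A x. q (prod_encode (k, x))"] computable_sum A)
      (simp_all add: sum_subtractf)
qed

lemma computable_int_decode:
  assumes "computable a" shows "computable_int (\<lambda>x. int_decode (a x))"
proof (rule computable_intI)
  show "computable (\<lambda>x. if even (a x) then a x div 2 else 0)"
    "computable (\<lambda>x. if even (a x) then 0 else Suc (a x div 2))"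
    by (intro computable_if decidable_even computable_div computable_Suc computable_const assms;
        simp)+
  show "int_decode (a x) = int (if even (a x) then a x div 2 else 0) -
      int (if even (a x) then 0 else Suc (a x div 2))" for x
    by (auto simp: int_decode_def sum_decode_def)
qed

lemma decidable_int_le:
  assumes "computable_int f" "computable_int g" shows "decidable (\<lambda>x. f x \<le> g x)"
proof -
  obtain p q p' q' where c: "computable p" "computable q" "computable p'" "computable q'"
    and "\<And>x. f x = int (p x) - int (q x)" "\<And>x. g x = int (p' x) - int (q' x)"
    using assms by (auto simp: computable_int_def)
  then have "f x \<le> g x \<longleftrightarrow> p x + q' x \<le> p' x + q x" for x by auto
  then show ?thesis using c by (simp add: decidable_le computable_add)
qed

subsection \<open>Coded lists and tables\<close>

text \<open>Beyond the end of the coded list the value is \<open>0\<close>, because \<open>0 - 1 = 0\<close>.\<close>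

definition code_nth :: "nat \<Rightarrow> nat \<Rightarrow> nat" where
  "code_nth n k = pfst (rec_nat n (\<lambda>_ r. psnd (r - 1)) k - 1)"

lemma code_nth_list_encode:
  assumes "k < length xs" shows "code_nth (list_encode xs) k = xs ! k"
proof -
  have drop: "rec_nat (list_encode xs) (\<lambda>_ r. psnd (r - 1)) k = list_encode (drop k xs)"
    if "k \<le> length xs" for k
    using that
  proof (induction k)
    case (Suc k)
    then have "drop k xs = xs ! k # drop (Suc k) xs" by (simp add: Cons_nth_drop_Suc)
    then show ?case using Suc by simp
  qed simp
  have "drop k xs = xs ! k # drop (Suc k) xs" using assms by (simp add: Cons_nth_drop_Suc)
  then show ?thesis unfolding code_nth_def drop[OF less_imp_le[OF assms]] by simp
qed

lemma computable_code_nth: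
  "computable a \<Longrightarrow> computable b \<Longrightarrow> computable (\<lambda>x. code_nth (a x) (b x))"
  unfolding code_nth_def
  by (intro computable_pfst computable_psnd computable_diff computable_rec computable_const
      computable_ident)

lemma code_nth_exists:
  assumes "finite D" "inj_on index D"
  shows "\<exists>t. \<forall>d\<in>D. code_nth t (index d) = v d"
proof -
  obtain b where b: "\<And>k. k \<in> index ` D \<Longrightarrow> k < b"
    using finite_imageI[OF assms(1), of index] by (meson finite_nat_set_iff_bounded)
  let ?t = "list_encode (map (\<lambda>k. v (inv_into D index k)) [0..<b])"
  have "code_nth ?t (index d) = v d" if "d \<in> D" for d
    using b[of "index d"] that assms(2) by (simp add: code_nth_list_encode)
  then show ?thesis by blast
qed

definition table :: "nat \<Rightarrow> nat \<Rightarrow> nat set \<Rightarrow> nat \<Rightarrow> nat" where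
  "table t m A j = code_nth t (prod_encode (m, prod_encode (set_encode A, j)))"

lemma computable_table:
  "computable t \<Longrightarrow> computable m \<Longrightarrow> computable_set A \<Longrightarrow> computable j \<Longrightarrow>
    computable (\<lambda>x. table (t x) (m x) (A x) (j x))"
  unfolding table_def by (intro computable_code_nth computable_prod_encode computable_set_encode)

lemma table_exists:
  assumes "finite S" "inj_on f S"
  shows "\<exists>t. \<forall>m\<in>S. \<forall>A\<subseteq>{..N}. \<forall>j\<le>N. table t (f m) A j = \<kappa> m A j"
proof -
  let ?index = "\<lambda>(m, A, j). prod_encode (f m, prod_encode (set_encode A, j))"
  have "finite A" if "A \<subseteq> {..N}" for A using that finite_subset by blast
  then have "inj_on ?index (S \<times> Pow {..N} \<times> {..N})"
    using assms(2) by (auto simp: inj_on_def set_encode_eq)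
  then obtain t where "\<forall>d\<in>S \<times> Pow {..N} \<times> {..N}. code_nth t (?index d) = (\<lambda>(m, A, j). \<kappa> m A j) d"
    using code_nth_exists[of "S \<times> Pow {..N} \<times> {..N}" ?index] assms(1) by blast
  then have "\<forall>m\<in>S. \<forall>A\<subseteq>{..N}. \<forall>j\<le>N. table t (f m) A j = \<kappa> m A j" by (simp add: table_def)
  then show ?thesis ..
qed

section \<open>Deciding E-realizability\<close>

lemma O_controller_image:
  assumes "O_controller inputs outputs S ok"
    and "\<And>m x m'. m \<in> S \<Longrightarrow> m' \<in> S \<Longrightarrow> ok m x m' \<Longrightarrow> ok' (f m) x (f m')"
  shows "O_controller inputs outputs (f ` S) ok'"
  using assms unfolding O_controller_def by (simp add: ball_simps bex_simps) meson

lemma I_controller_image: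
  assumes "I_controller inputs outputs S ok"
    and "\<And>m x m'. m \<in> S \<Longrightarrow> m' \<in> S \<Longrightarrow> ok m x m' \<Longrightarrow> ok' (f m) x (f m')"
  shows "I_controller inputs outputs (f ` S) ok'"
  using assms unfolding I_controller_def by (simp add: ball_simps bex_simps) meson

lemma measure_step_cong:
  assumes "\<And>A j. A \<subseteq> {..N} \<Longrightarrow> j \<le> N \<Longrightarrow> \<kappa> m A j = \<kappa>' k A j \<and> \<pi> m A j = \<pi>' k A j"
    "\<And>A j. A \<subseteq> {..N} \<Longrightarrow> j \<le> N \<Longrightarrow> \<kappa> m' A j = \<kappa>' k' A j \<and> \<pi> m' A j = \<pi>' k' A j"
  shows "measure_step N \<kappa> \<pi> c m x m' \<longleftrightarrow> measure_step N \<kappa>' \<pi>' c k x k'"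
  unfolding measure_step_def using assms by (simp add: next_index_le cong: imp_cong)

lemma numbering_exists:
  assumes "finite S"
  obtains f and M :: nat where "f ` S = {..<M}" "inj_on f S"
  using ex_bij_betw_finite_nat[OF assms] unfolding bij_betw_def atLeast0LessThan by metis

lemma realizability_certificate_tables:
  assumes fin: "finite S" and cert: "realizability_certificate inputs outputs w N S m0 e \<kappa> \<pi>"
  shows "\<exists>M m0 r s t. realizability_certificate inputs outputs w N {..<M} m0
    (code_nth r) (table s) (table t)"
proof -
  obtain f and M :: nat where f: "f ` S = {..<M}" "inj_on f S" using fin by (rule numbering_exists)
  obtain r where r: "\<forall>m\<in>S. code_nth r (f m) = e m" using code_nth_exists[OF fin f(2)] by blast
  obtain s where s: "\<forall>m\<in>S. \<forall>A\<subseteq>{..N}. \<forall>j\<le>N. table s (f m) A j = \<kappa> m A j"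
    using table_exists[OF fin f(2)] by blast
  obtain t where t: "\<forall>m\<in>S. \<forall>A\<subseteq>{..N}. \<forall>j\<le>N. table t (f m) A j = \<pi> m A j"
    using table_exists[OF fin f(2)] by blast
  have step: "measure_step N \<kappa> \<pi> c m x m' \<longleftrightarrow> measure_step N (table s) (table t) c (f m) x (f m')"
    if "m \<in> S" "m' \<in> S" for c m x m' by (rule measure_step_cong) (use s t that in auto)
  have m0: "m0 \<in> S" and positive: "\<forall>A\<subseteq>{..N}. N \<notin> A \<longrightarrow> 0 < \<kappa> m0 A 0"
    using cert unfolding realizability_certificate_def by blast+
  have "f m0 \<in> {..<M}" using m0 f(1) by blast
  moreover have "\<forall>A\<subseteq>{..N}. N \<notin> A \<longrightarrow> 0 < table s (f m0) A 0"
    using positive s m0 by simp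
  moreover have "O_controller inputs outputs {..<M} (\<lambda>m x m'.
      int (code_nth r m') \<le> int (code_nth r m) + letter_energy inputs outputs w x \<and>
      measure_step N (table s) (table t) 0 m x m')"
    using cert unfolding realizability_certificate_def f(1)[symmetric]
    by (elim conjE O_controller_image) (simp add: r step)
  ultimately show ?thesis unfolding realizability_certificate_def by blast
qed

lemma unrealizability_certificate_tables:
  assumes fin: "finite S" and cert: "unrealizability_certificate inputs outputs w N S m0 C \<kappa> \<pi>"
  shows "\<exists>M m0 s t. unrealizability_certificate inputs outputs w N {..<M} m0 C (table s) (table t)"
proof -
  obtain f and M :: nat where f: "f ` S = {..<M}" "inj_on f S" using fin by (rule numbering_exists)
  obtain s where s: "\<forall>m\<in>S. \<forall>A\<subseteq>{..N}. \<forall>j\<le>N. table s (f m) A j = \<kappa> m A j"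
    using table_exists[OF fin f(2)] by blast
  obtain t where t: "\<forall>m\<in>S. \<forall>A\<subseteq>{..N}. \<forall>j\<le>N. table t (f m) A j = \<pi> m A j"
    using table_exists[OF fin f(2)] by blast
  have step: "measure_step N \<kappa> \<pi> c m x m' \<longleftrightarrow> measure_step N (table s) (table t) c (f m) x (f m')"
    if "m \<in> S" "m' \<in> S" for c m x m' by (rule measure_step_cong) (use s t that in auto)
  have m0: "m0 \<in> S" "0 < C" and positive: "\<forall>A\<subseteq>{..N}. N \<in> A \<longrightarrow> 0 < \<kappa> m0 A 0"
    using cert unfolding unrealizability_certificate_def by blast+
  have "f m0 \<in> {..<M}" using m0(1) f(1) by blast
  moreover have "\<forall>A\<subseteq>{..N}. N \<in> A \<longrightarrow> 0 < table s (f m0) A 0"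
    using positive s m0(1) by simp
  moreover have "I_controller inputs outputs {..<M} (\<lambda>m x m'.
      measure_step N (table s) (table t) (int C * letter_energy inputs outputs w x) m x m')"
    using cert unfolding unrealizability_certificate_def f(1)[symmetric]
    by (elim conjE I_controller_image) (simp add: step)
  ultimately show ?thesis using m0(2) unfolding unrealizability_certificate_def by blast
qed

lemma certificate_tables_exist:
  assumes "finite inputs" "finite outputs"
  shows "(\<exists>M m0 r s t. realizability_certificate inputs outputs w N {..<M} m0
      (code_nth r) (table s) (table t)) \<or>
    (\<exists>M m0 C s t. unrealizability_certificate inputs outputs w N {..<M} m0 C (table s) (table t))"
proof -
  interpret energy_arena "profile_class.det_states N" "profile_class.det_init N"
    "profile_class.det_step N" "profile_class.det_prio N (profile_class.accepting_pairs N)"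
    "Suc (2 * Suc (card (range (profile_class N))))" N inputs outputs w
    by (intro energy_arena.intro ltl_automaton.intro energy_arena_axioms.intro
        profile_class.parity_automaton_det assms)
  from certificate_exists show ?thesis
  proof (elim disjE exE conjE)
    fix S :: "nat set" and m0 e \<kappa> \<pi>
    assume "finite S" "realizability_certificate inputs outputs w N S m0 e \<kappa> \<pi>"
    from realizability_certificate_tables[OF this] show ?thesis ..
  next
    fix S m0 C \<kappa> \<pi>
    assume "finite S" "unrealizability_certificate inputs outputs w N S m0 C \<kappa> \<pi>"
    from unrealizability_certificate_tables[OF this] show ?thesis by blast
  qed
qed

definition inputs_of :: "nat \<Rightarrow> nat set" where
  "inputs_of c = set_decode (code_nth c 0)"

definition outputs_of :: "nat \<Rightarrow> nat set" where
  "outputs_of c = set_decode (code_nth c 1)"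

text \<open>A specification lists the weights by increasing propositions, so the index of \<open>p\<close> is the
  number of smaller ones.\<close>

definition weight_code :: "nat \<Rightarrow> nat \<Rightarrow> nat" where
  "weight_code c p = code_nth (code_nth c 2) (card ((inputs_of c \<union> outputs_of c) \<inter> {..<p}))"

definition weight_of :: "nat \<Rightarrow> nat literal \<Rightarrow> int" where
  "weight_of c l = (case l of Pos p \<Rightarrow> int_decode (pfst (weight_code c p))
     | Neg p \<Rightarrow> int_decode (psnd (weight_code c p)))"

definition formula_of :: "nat \<Rightarrow> nat" where
  "formula_of c = code_nth c 3"

lemma card_sorted_less:
  fixes x :: "'a :: linorder"
  assumes "sorted_wrt (<) (xs @ x # ys)"
  shows "card (set (xs @ x # ys) \<inter> {..<x}) = length xs"
proof -
  have "set (xs @ x # ys) \<inter> {..<x} = set xs" using assms by (auto simp: sorted_wrt_append)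
  moreover have "distinct xs"
    using assms by (simp add: sorted_wrt_append strict_sorted_iff)
  ultimately show ?thesis by (simp only: distinct_card)
qed

lemma decode_encode_spec:
  fixes w :: "nat literal \<Rightarrow> int" and \<phi> :: "nat ltl"
  assumes fin: "finite inputs" "finite outputs"
  defines "c \<equiv> encode_spec inputs outputs w \<phi>"
  shows "inputs_of c = inputs" "outputs_of c = outputs" "decode_ltl (formula_of c) = \<phi>"
    "p \<in> inputs \<union> outputs \<Longrightarrow> weight_of c (Pos p) = w (Pos p) \<and> weight_of c (Neg p) = w (Neg p)"
proof -
  let ?P = "inputs \<union> outputs"
  let ?xs = "sorted_list_of_set ?P"
  have fields: "code_nth c 0 = set_encode inputs" "code_nth c 1 = set_encode outputs"
    "code_nth c 2 = encode_weights ?P w" "code_nth c 3 = encode_ltl \<phi>"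
    unfolding c_def encode_spec_def by (simp_all add: code_nth_list_encode del: list_encode.simps)
  show "inputs_of c = inputs" "outputs_of c = outputs" "decode_ltl (formula_of c) = \<phi>"
    unfolding inputs_of_def outputs_of_def formula_of_def fields
    using fin by (simp_all add: decode_encode_ltl)
  note sets = this(1,2)
  assume "p \<in> ?P"
  then obtain ys zs where xs: "?xs = ys @ p # zs"
    using fin split_list[of p ?xs] by auto
  then have "card (?P \<inter> {..<p}) = length ys"
    using card_sorted_less[of ys p zs] fin by (simp flip: xs)
  then have "weight_code c p = prod_encode (int_encode (w (Pos p)), int_encode (w (Neg p)))"
    using xs fin by (simp add: weight_code_def sets fields encode_weights_def code_nth_list_encode
        nth_append)
  then show "weight_of c (Pos p) = w (Pos p) \<and> weight_of c (Neg p) = w (Neg p)"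
    by (simp add: weight_of_def)
qed

lemma E_realizable_cong:
  assumes "\<And>p. p \<in> inputs \<union> outputs \<Longrightarrow> w (Pos p) = w' (Pos p) \<and> w (Neg p) = w' (Neg p)"
  shows "E_realizable inputs outputs w \<phi> \<longleftrightarrow> E_realizable inputs outputs w' \<phi>"
proof -
  have "letter_weight w X (x \<inter> X) = letter_weight w' X (x \<inter> X)" if "X \<subseteq> inputs \<union> outputs" for X x
    unfolding letter_weight_def using assms that by (intro arg_cong2[where f = "(+)"] sum.cong) auto
  then have "energy_level inputs outputs w = energy_level inputs outputs w'"
    by (intro ext) (simp add: energy_level_def)
  then show ?thesis by (simp add: E_realizable_def)
qed

definition codes_realizability :: "nat \<Rightarrow> nat \<Rightarrow> bool" where
  "codes_realizability k c \<longleftrightarrow>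
     realizability_certificate (inputs_of c) (outputs_of c) (weight_of c) (formula_of c)
       {..<code_nth k 0} (code_nth k 1)
       (code_nth (code_nth k 2)) (table (code_nth k 3)) (table (code_nth k 4))"

definition codes_unrealizability :: "nat \<Rightarrow> nat \<Rightarrow> bool" where
  "codes_unrealizability k c \<longleftrightarrow>
     unrealizability_certificate (inputs_of c) (outputs_of c) (weight_of c) (formula_of c)
       {..<code_nth k 0} (code_nth k 1)
       (code_nth k 2) (table (code_nth k 3)) (table (code_nth k 4))"

lemma certificate_code_exists: "\<exists>k. codes_realizability k c \<or> codes_unrealizability k c"
proof -
  have "finite (inputs_of c)" "finite (outputs_of c)"
    by (simp_all add: inputs_of_def outputs_of_def)
  from certificate_tables_exist[OF this, of "weight_of c" "formula_of c"] show ?thesis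
  proof (elim disjE exE)
    fix M m0 r s t
    assume "realizability_certificate (inputs_of c) (outputs_of c) (weight_of c) (formula_of c)
      {..<M} m0 (code_nth r) (table s) (table t)"
    then have "codes_realizability (list_encode [M, m0, r, s, t]) c"
      by (simp add: codes_realizability_def code_nth_list_encode del: list_encode.simps)
    then show ?thesis by blast
  next
    fix M m0 C s t
    assume "unrealizability_certificate (inputs_of c) (outputs_of c) (weight_of c) (formula_of c)
      {..<M} m0 C (table s) (table t)"
    then have "codes_unrealizability (list_encode [M, m0, C, s, t]) c"
      by (simp add: codes_unrealizability_def code_nth_list_encode del: list_encode.simps)
    then show ?thesis by blast
  qed
qed

lemma computable_ltl_tag: "computable a \<Longrightarrow> computable (\<lambda>x. ltl_tag (a x))"
  and computable_ltl_arg: "computable a \<Longrightarrow> computable (\<lambda>x. ltl_arg (a x))"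
  and computable_ltl_left: "computable a \<Longrightarrow> computable (\<lambda>x. ltl_left (a x))"
  and computable_ltl_right: "computable a \<Longrightarrow> computable (\<lambda>x. ltl_right (a x))"
  unfolding ltl_tag_def ltl_arg_def ltl_left_def ltl_right_def
  by (intro computable_pfst computable_psnd; assumption)+

lemma computable_set_fulfilled:
  assumes "computable n" "computable_set A"
  shows "computable_set (\<lambda>x. fulfilled (n x) (A x))"
  unfolding fulfilled_def less_Suc_eq_le[symmetric]
  by (intro computable_set_Collect decidable_imp decidable_disj decidable_not decidable_mem
      decidable_eq computable_ltl_tag computable_ltl_right computable_Suc computable_const
      computable_pfst computable_ident computable_set_comp_psnd assms)

lemma computable_next_index:
  "computable n \<Longrightarrow> computable_set A \<Longrightarrow> computable j \<Longrightarrow>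
    computable (\<lambda>x. next_index (n x) (A x) (j x))"
  unfolding next_index_def
  by (intro computable_if decidable_mem decidable_less computable_set_fulfilled computable_Suc
      computable_const)

lemma decidable_accepting:
  "computable n \<Longrightarrow> computable_set A \<Longrightarrow> computable j \<Longrightarrow>
    decidable (\<lambda>x. accepting (n x) (A x) (j x))"
  unfolding accepting_def
  by (intro decidable_conj decidable_eq decidable_mem computable_set_fulfilled)

lemma decidable_local_condition:
  "computable n \<Longrightarrow> computable_set A \<Longrightarrow> computable_set X \<Longrightarrow> computable_set A' \<Longrightarrow>
    decidable (\<lambda>x. local_condition (n x) (A x) (X x) (A' x))"
  unfolding local_condition_def
  by (intro decidable_if decidable_eq decidable_mem decidable_not decidable_disj decidable_conj
      decidable_True computable_ltl_tag computable_ltl_arg computable_ltl_left computable_ltl_right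
      computable_const)

lemma decidable_tableau_step:
  assumes "computable n" "computable_set A" "computable_set X" "computable_set A'"
  shows "decidable (\<lambda>x. tableau_step (n x) (A x) (X x) (A' x))"
  unfolding tableau_step_def
  by (intro decidable_all_le decidable_iff decidable_mem decidable_local_condition computable_pfst
      computable_ident computable_set_comp_psnd assms)

lemma decidable_progress_step:
  assumes "computable k" "computable k'" "computable p" "computable p'" "computable_int c"
    "decidable P"
  shows "decidable (\<lambda>x. progress_step (k x) (k' x) (int (p x)) (int (p' x)) (c x) (P x))"
  unfolding progress_step_def
  by (intro decidable_disj decidable_conj decidable_less decidable_eq decidable_if decidable_even
      decidable_not decidable_int_le computable_int_add computable_int_of_nat computable_int_of_bool
      assms)

lemma computable_set_inputs_of: "computable c \<Longrightarrow> computable_set (\<lambda>x. inputs_of (c x))"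
  and computable_set_outputs_of: "computable c \<Longrightarrow> computable_set (\<lambda>x. outputs_of (c x))"
  unfolding inputs_of_def outputs_of_def
  by (intro computable_set_decode computable_code_nth computable_const; assumption)+

lemma computable_formula_of: "computable c \<Longrightarrow> computable (\<lambda>x. formula_of (c x))"
  unfolding formula_of_def by (intro computable_code_nth computable_const)

lemma computable_weight_code:
  "computable c \<Longrightarrow> computable p \<Longrightarrow> computable (\<lambda>x. weight_code (c x) (p x))"
  unfolding weight_code_def
  by (intro computable_code_nth computable_const computable_card computable_set_Int
      computable_set_Un computable_set_inputs_of computable_set_outputs_of computable_set_lessThan)

lemma computable_int_weight_of:
  "computable c \<Longrightarrow> computable p \<Longrightarrow> computable_int (\<lambda>x. weight_of (c x) (Pos (p x)))"
  "computable c \<Longrightarrow> computable p \<Longrightarrow> computable_int (\<lambda>x. weight_of (c x) (Neg (p x)))"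
  unfolding weight_of_def literal.case
  by (intro computable_int_decode computable_pfst computable_psnd computable_weight_code;
      assumption)+

lemma computable_int_letter_energy:
  assumes "computable c" "computable_set X"
  shows "computable_int (\<lambda>x.
    letter_energy (inputs_of (c x)) (outputs_of (c x)) (weight_of (c x)) (X x))"
  unfolding letter_energy_def letter_weight_def
  by (intro computable_int_add computable_int_sum computable_int_weight_of computable_set_Int
      computable_set_Diff computable_set_inputs_of computable_set_outputs_of computable_pfst
      computable_ident computable_comp_psnd assms)

lemmas certificate_decidability_rules =
  decidable_conj decidable_imp decidable_not decidable_less decidable_mem decidable_Ball
  decidable_Bex decidable_all_subset decidable_ex_subset decidable_all_le decidable_int_le
  decidable_tableau_step decidable_progress_step decidable_accepting
  computable_int_add computable_int_mult computable_int_of_nat computable_int_0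
  computable_int_letter_energy
  computable_set_inputs_of computable_set_outputs_of computable_set_atMost computable_set_lessThan
  computable_set_decode computable_set_Un
  computable_formula_of computable_code_nth computable_table computable_next_index
  computable_pfst computable_psnd computable_const computable_ident

lemma decidable_codes_realizability: "decidable (\<lambda>z. codes_realizability (pfst z) (psnd z))"
  unfolding codes_realizability_def realizability_certificate_def O_controller_def measure_step_def
    lessThan_iff
  by (intro certificate_decidability_rules)

lemma decidable_codes_unrealizability: "decidable (\<lambda>z. codes_unrealizability (pfst z) (psnd z))"
  unfolding codes_unrealizability_def unrealizability_certificate_def I_controller_def
    measure_step_def lessThan_iff
  by (intro certificate_decidability_rules)

definition encodes_E_realizable :: "nat \<Rightarrow> bool" where
  "encodes_E_realizable c \<longleftrightarrow>
     E_realizable (inputs_of c) (outputs_of c) (weight_of c) (decode_ltl (formula_of c))"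

lemma encodes_E_realizable_encode_spec:
  assumes "finite inputs" "finite outputs"
  shows "encodes_E_realizable (encode_spec inputs outputs w \<phi>) \<longleftrightarrow> E_realizable inputs outputs w \<phi>"
  unfolding encodes_E_realizable_def decode_encode_spec(1-3)[OF assms]
  by (rule E_realizable_cong) (rule decode_encode_spec(4)[OF assms])

theorem decidable_encodes_E_realizable: "decidable encodes_E_realizable"
proof (rule decidable_Post[OF decidable_codes_realizability decidable_codes_unrealizability])
  fix c
  have "encodes_E_realizable c" if "codes_realizability k c" for k
    using that unfolding codes_realizability_def encodes_E_realizable_def
    by (rule realizability_certificate_sound)
  moreover have "\<not> encodes_E_realizable c" if "codes_unrealizability k c" for k
    using that unfolding codes_unrealizability_def encodes_E_realizable_def
    by (rule unrealizability_certificate_sound)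
  ultimately show "encodes_E_realizable c \<longleftrightarrow> (\<exists>k. codes_realizability k c)"
    and "\<not> encodes_E_realizable c \<longleftrightarrow> (\<exists>k. codes_unrealizability k c)"
    using certificate_code_exists[of c] by blast+
qed

definition trivial_game :: "bool \<Rightarrow> nat safety_game" where
  "trivial_game b = \<lparr>states1 = {0}, states2 = {}, init = 0, edges = {(0, 0)},
     safe = (if b then {0} else {})\<rparr>"

lemma is_safety_game_trivial_game: "is_safety_game (trivial_game b)"
  by (simp add: is_safety_game_def states_def trivial_game_def)

lemma plays_trivial_game: "plays (trivial_game b) = {\<lambda>_. 0}"
proof -
  have "\<rho> = (\<lambda>_. 0)" if "\<rho> \<in> plays (trivial_game b)" for \<rho>
  proof
    show "\<rho> n = 0" for n using that by (cases n) (auto simp: plays_def trivial_game_def)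
  qed
  then show ?thesis by (auto simp: plays_def trivial_game_def)
qed

lemma player1_wins_trivial_game: "player1_wins (trivial_game b) \<longleftrightarrow> b"
proof -
  have "\<tau> \<in> strategies1 (trivial_game b) \<longleftrightarrow> (\<forall>h\<in>lists {0}. \<tau> (h @ [0]) = 0)" for \<tau>
    by (simp add: strategies1_def states_def trivial_game_def)
  moreover have "consistent1 (trivial_game b) \<tau> (\<lambda>_. 0) \<longleftrightarrow> (\<forall>n. \<tau> (map (\<lambda>_. 0) [0..<Suc n]) = 0)"
    for \<tau>
    by (auto simp: consistent1_def trivial_game_def)
  moreover have "map (\<lambda>_. 0 :: nat) [0..<n] \<in> lists {0}" for n by auto
  ultimately have consistent: "consistent1 (trivial_game b) \<tau> (\<lambda>_. 0)"
    if "\<tau> \<in> strategies1 (trivial_game b)" for \<tau> using that by simp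
  have "(\<lambda>_. 0) \<in> strategies1 (trivial_game b)" by (simp add: strategies1_def trivial_game_def)
  moreover have "winning1 (trivial_game b) \<tau> \<longleftrightarrow> b" if "\<tau> \<in> strategies1 (trivial_game b)" for \<tau>
    unfolding winning1_def plays_trivial_game using consistent[OF that]
    by (simp add: trivial_game_def)
  ultimately show ?thesis unfolding player1_wins_def by blast
qed

theorem theorem10:
  "\<exists>f. computable f \<and>
    (\<forall>(inputs :: nat set) outputs (w :: nat literal \<Rightarrow> int) (\<phi> :: nat ltl).
      finite inputs \<longrightarrow> finite outputs \<longrightarrow> inputs \<inter> outputs = {} \<longrightarrow>
      atoms \<phi> \<subseteq> inputs \<union> outputs \<longrightarrow>
      (\<exists>G :: nat safety_game.
         f (encode_spec inputs outputs w \<phi>) = encode_game G \<and>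
         is_safety_game G \<and>
         (player1_wins G \<longleftrightarrow> E_realizable inputs outputs w \<phi>)))"
proof -
  define f where "f c = (if encodes_E_realizable c then encode_game (trivial_game True)
    else encode_game (trivial_game False))" for c
  have "computable f"
    unfolding f_def by (intro computable_if decidable_encodes_E_realizable computable_const)
  moreover have "\<exists>G. f (encode_spec inputs outputs w \<phi>) = encode_game G \<and> is_safety_game G \<and>
      (player1_wins G \<longleftrightarrow> E_realizable inputs outputs w \<phi>)"
    if "finite inputs" "finite outputs" for inputs outputs w \<phi>
  proof (intro exI conjI)
    let ?G = "trivial_game (E_realizable inputs outputs w \<phi>)"
    show "f (encode_spec inputs outputs w \<phi>) = encode_game ?G"
      by (simp add: f_def encodes_E_realizable_encode_spec[OF that])
    show "is_safety_game ?G" by (rule is_safety_game_trivial_game)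
    show "player1_wins ?G \<longleftrightarrow> E_realizable inputs outputs w \<phi>" by (rule player1_wins_trivial_game)
  qed
  ultimately show ?thesis by blast
qed

end
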